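(* Let $E:[0,\infty)\times\mathbb R^2\to\mathbb R^2$ be a given electric field. For all $\varepsilon>0$, $\Delta t>0$ and initial data $(x_\varepsilon^0,v_\varepsilon^0)\in\mathbb R^2\times\mathbb R^2$, set $y_\varepsilon^0=x_\varepsilon^0-\varepsilon(v_\varepsilon^0)^\perp$ and consider the first-order scheme, for $n\ge0$ and $t_n=n\Delta t$, $$\frac{v_\varepsilon^{n+1}-v_\varepsilon^n}{\Delta t}=\frac1\varepsilon E\big(t_n,y_\varepsilon^n+\varepsilon(v_\varepsilon^n)^\perp\big)-\frac1{\varepsilon^2}(v_\varepsilon^{n+1})^\perp,\qquad \frac{y_\varepsilon^{n+1}-y_\varepsilon^n}{\Delta t}=-E^\perp\big(t_n,y_\varepsilon^n+\varepsilon(v_\varepsilon^{n+1})^\perp\big).$$ This scheme possesses a unique solution $(y_\varepsilon^n,v_\varepsilon^n)_{n\ge0}$. Moreover, set $x_\varepsilon^n=y_\varepsilon^n+\varepsilon(v_\varepsilon^n)^\perp$, let $(x_\varepsilon(t),v_\varepsilon(t))$ be the exact solution of the characteristic system (see context) with initial data $(x_\varepsilon^0,v_\varepsilon^0)$ at $t=0$, and set $y_\varepsilon(t)=x_\varepsilon(t)-\varepsilon v_\varepsilon^\perp(t)$. Then: (i) when $E\in W^{1,\infty}$, there is a constant $C$ depending only on $E$ such that for all $n\ge0$, $\Delta t>0$, $\varepsilon>0$ and all initial data, $$\|x_\varepsilon^n-x_\varepsilon(t_n)\|\le C\,(1+t_n^3)\,e^{(2+K_x\Delta t)K_xt_n}\,(1+\|v_\varepsilon^0\|+\varepsilon)\,\min\left(\frac{\Delta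 t}{\varepsilon^3}(1+\varepsilon^2),\ \Delta t+\varepsilon\right);$$ (ii) when $E\in W^{2,\infty}$, there is a constant $C$ depending only on $E$ such that for all $n\ge0$, $\Delta t>0$, $\varepsilon>0$ and all initial data, $$\|y_\varepsilon^n-y_\varepsilon(t_n)\|\le C\,(1+t_n^4)\,e^{(2+K_x\Delta t)K_xt_n}\,(1+\|v_\varepsilon^0\|^2+\varepsilon^2)\,\min\left(\frac{\Delta t}{\varepsilon^3}(1+\varepsilon),\ \Delta t+\varepsilon^2\right).$$
   Context: For $a=(a_1,a_2)\in\mathbb R^2$, $a^\perp:=(-a_2,a_1)$, and $E^\perp(t,x):=(E(t,x))^\perp$. $\|\cdot\|$ is the Euclidean norm on vectors and the corresponding operator norm on linear maps. $E\in W^{k,\infty}$ means that $E$ and its derivatives in $(t,x)\in[0,\infty)\times\mathbb R^2$ up to order $k$ are globally bounded. $K_x:=\|\mathrm d_xE\|_{L^\infty}$, where $\mathrm d_x$ is the differential in $x$. The characteristic system is, for $t\ge0$, $$\varepsilon x_\varepsilon'(t)=v_\varepsilon(t),\qquad \varepsilon v_\varepsilon'(t)=E(t,x_\varepsilon(t))-\frac{v_\varepsilon^\perp(t)}{\varepsilon},\qquad x_\varepsilon(0)=x_\varepsilon^0,\ v_\varepsilon(0)=v_\varepsilon^0.$$ *)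

theory Defs
  imports "HOL-Analysis.Analysis" "HOL-Probability.Essential_Supremum"
begin

definition perp :: "real^2 \<Rightarrow> real^2"  ("_\<^sup>\<bottom>" [1000] 1000)
  where "a\<^sup>\<bottom> = vector [- (a $ 2), a $ 1]"


subsection \<open>Sobolev spaces of type L-infinity\<close>

primrec k_times_diff :: "nat \<Rightarrow> ('a::euclidean_space \<Rightarrow> real) \<Rightarrow> bool"
  where
    "k_times_diff 0 f \<longleftrightarrow> continuous_on UNIV f"
  | "k_times_diff (Suc k) f \<longleftrightarrow>
       f differentiable_on UNIV \<and> (\<forall>v. k_times_diff k (\<lambda>x. frechet_derivative f (at x) v))"

definition test_function :: "'a::euclidean_space set \<Rightarrow> ('a \<Rightarrow> real) \<Rightarrow> bool"
  where "test_function S \<phi> \<longleftrightarrow>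
    (\<forall>k. k_times_diff k \<phi>) \<and> compact (closure {z. \<phi> z \<noteq> 0}) \<and> closure {z. \<phi> z \<noteq> 0} \<subseteq> S"

definition ess_bounded :: "'a::euclidean_space set \<Rightarrow> ('a \<Rightarrow> 'b::euclidean_space) \<Rightarrow> bool"
  where "ess_bounded S u \<longleftrightarrow>
    u \<in> borel_measurable (lebesgue_on S) \<and> (\<exists>B. AE z in lebesgue_on S. norm (u z) \<le> B)"

text \<open>\<open>g\<close> is the distributional derivative of \<open>u\<close> on the open set \<open>S\<close> in the direction \<open>v\<close>.
  It is only used for \<open>u\<close> and \<open>g\<close> that are \<open>ess_bounded\<close> on \<open>S\<close>, so both integrals exist.\<close>

definition weak_derivative ::
  "'a::euclidean_space set \<Rightarrow> 'a \<Rightarrow> ('a \<Rightarrow> 'b::euclidean_space) \<Rightarrow> ('a \<Rightarrow> 'b) \<Rightarrow> bool"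
  where "weak_derivative S v u g \<longleftrightarrow>
    (\<forall>\<phi>. test_function S \<phi> \<longrightarrow>
      (LINT z|lebesgue_on S. frechet_derivative \<phi> (at z) v *\<^sub>R u z)
        = - (LINT z|lebesgue_on S. \<phi> z *\<^sub>R g z))"

primrec W_infinity ::
  "nat \<Rightarrow> 'a::euclidean_space set \<Rightarrow> ('a \<Rightarrow> 'b::euclidean_space) \<Rightarrow> bool"
  where
    "W_infinity 0 S u \<longleftrightarrow> ess_bounded S u"
  | "W_infinity (Suc k) S u \<longleftrightarrow>
       ess_bounded S u \<and> (\<forall>v\<in>Basis. \<exists>g. weak_derivative S v u g \<and> W_infinity k S g)"


subsection \<open>The electric field\<close>

text \<open>A field on \<open>[0,\<infinity>) \<times> \<real>\<^sup>2\<close> is a total function of \<open>(t, x)\<close> whose values for \<open>t < 0\<close> are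
  never constrained or used. Weak derivatives are taken in the interior of the domain.\<close>

definition field_domain :: "(real \<times> (real^2)) set"
  where "field_domain = {0<..} \<times> UNIV"

text \<open>Elements of \<open>W\<^sup>k\<^sup>,\<^sup>\<infinity>\<close> with \<open>k \<ge> 1\<close> are classes modulo null sets with a unique representative that
  is continuous on \<open>[0,\<infinity>) \<times> \<real>\<^sup>2\<close>. Since the scheme evaluates the field at points, the field is
  required to be that representative. (Only used for \<open>k \<ge> 1\<close>.)\<close>

definition field_W_infinity :: "nat \<Rightarrow> (real \<times> (real^2) \<Rightarrow> real^2) \<Rightarrow> bool"
  where "field_W_infinity k E \<longleftrightarrow>
    continuous_on ({0..} \<times> UNIV) E \<and> W_infinity k field_domain E"

definition weak_x_differential ::
  "(real \<times> (real^2) \<Rightarrow> real^2) \<Rightarrow> (real \<times> (real^2) \<Rightarrow> real^2 \<Rightarrow> real^2) \<Rightarrow> bool"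
  where "weak_x_differential E D \<longleftrightarrow>
    (\<forall>z. linear (D z)) \<and>
    (\<forall>i\<in>Basis. ess_bounded field_domain (\<lambda>z. D z i) \<and>
                weak_derivative field_domain (0, i) E (\<lambda>z. D z i))"

text \<open>The weak differential is unique up to null sets, so the essential supremum below does not
  depend on the chosen representative.\<close>

definition K\<^sub>x :: "(real \<times> (real^2) \<Rightarrow> real^2) \<Rightarrow> real"
  where "K\<^sub>x E = real_of_ereal (esssup (lebesgue_on field_domain)
    (\<lambda>z. ereal (onorm ((SOME D. weak_x_differential E D) z))))"


subsection \<open>Characteristic system and scheme\<close>

definition exact_solution ::
  "(real \<times> (real^2) \<Rightarrow> real^2) \<Rightarrow> real \<Rightarrow> real^2 \<Rightarrow> real^2 \<Rightarrow> (real \<Rightarrow> real^2) \<Rightarrow> (real \<Rightarrow> real^2) \<Rightarrow> bool"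
  where "exact_solution E \<epsilon> x0 v0 x v \<longleftrightarrow>
    x 0 = x0 \<and> v 0 = v0 \<and>
    (\<forall>t\<ge>0. \<exists>x' v'.
       (x has_vector_derivative x') (at t within {0..}) \<and>
       (v has_vector_derivative v') (at t within {0..}) \<and>
       \<epsilon> *\<^sub>R x' = v t \<and>
       \<epsilon> *\<^sub>R v' = E (t, x t) - (1 / \<epsilon>) *\<^sub>R (v t)\<^sup>\<bottom>)"

definition scheme ::
  "(real \<times> (real^2) \<Rightarrow> real^2) \<Rightarrow> real \<Rightarrow> real \<Rightarrow> real^2 \<Rightarrow> real^2
    \<Rightarrow> (nat \<Rightarrow> real^2) \<Rightarrow> (nat \<Rightarrow> real^2) \<Rightarrow> bool"
  where "scheme E \<epsilon> \<Delta>t x0 v0 y v \<longleftrightarrow>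
    y 0 = x0 - \<epsilon> *\<^sub>R v0\<^sup>\<bottom> \<and> v 0 = v0 \<and>
    (\<forall>n. (1 / \<Delta>t) *\<^sub>R (v (Suc n) - v n)
            = (1 / \<epsilon>) *\<^sub>R E (real n * \<Delta>t, y n + \<epsilon> *\<^sub>R (v n)\<^sup>\<bottom>) - (1 / \<epsilon>\<^sup>2) *\<^sub>R (v (Suc n))\<^sup>\<bottom> \<and>
         (1 / \<Delta>t) *\<^sub>R (y (Suc n) - y n)
            = - (E (real n * \<Delta>t, y n + \<epsilon> *\<^sub>R (v (Suc n))\<^sup>\<bottom>))\<^sup>\<bottom>)"

end

theory Submission
  imports Defs
begin

text \<open>
  The proof separates the regularity of \<open>E\<close> from the comparison of the two trajectories.

  \<^bold>\<open>Regularity.\<close> Convolving \<open>E\<close> with a smooth kernel moves derivatives onto the kernel, and the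
  definition of the weak derivative moves them back onto \<open>E\<close>. The kernel is supported strictly after
  the point of evaluation, so it is a test function on \<open>t > 0\<close> even when the evaluation takes place
  at \<open>t = 0\<close> (\<open>mollified_field_exists\<close>). Every bound on a weak derivative thus becomes a bound on a
  classical one, uniformly in the kernel, and in the limit \<open>E\<close> is bounded, Lipschitz in time, and
  Lipschitz in space with the constant \<open>K\<^sub>x\<close> itself (\<open>W1_infinity_field\<close>, \<open>W2_infinity_field\<close>). The
  sharp constant matters because it stands in the exponent. Below, \<open>K\<close> is \<open>K\<^sub>x\<close> and \<open>B\<close> and \<open>M\<close> bound
  \<open>E\<close> and its derivatives. Wherever a derivative of \<open>E\<close> would be used, a mollified field at distance
  at most \<open>\<epsilon>\<^sup>2\<close> is used instead; this distance is of the order of the errors committed anyway.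

  \<^bold>\<open>Velocities.\<close> The trivial bound \<open>\<bar>v(t)\<bar> \<le> \<bar>v0\<bar> + B t / \<epsilon>\<close> is too weak. The drift velocity is
  \<open>-\<epsilon> E\<^sup>\<bottom>\<close>, and \<open>v + \<epsilon> E(t, y)\<^sup>\<bottom>\<close> is rotated at rate \<open>1 / \<epsilon>\<^sup>2\<close> and forced only by
  \<open>K \<bar>v\<bar> + O(\<epsilon>)\<close>, because \<open>y\<close> is slow. Neither the rotation nor the implicit step increases norms,
  so Gronwall gives \<open>\<bar>v\<bar> \<le> (\<bar>v0\<bar> + c \<epsilon> (1 + t)) exp (K t)\<close> for the flow and for the scheme
  (\<open>exact_velocity_bound\<close>, \<open>discrete_velocity_bound\<close>).

  \<^bold>\<open>First order.\<close> The flow satisfies \<open>y' = - E(t, y + \<epsilon> v\<^sup>\<bottom>)\<^sup>\<bottom>\<close>. Dropping \<open>\<epsilon> v\<^sup>\<bottom>\<close> both here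
  and in the scheme leaves the explicit Euler method, with an error \<open>O(\<Delta>t + \<epsilon>)\<close> and growth rate \<open>K\<close>
  (\<open>y_error_le_asymptotic\<close>). Keeping it and comparing the pairs \<open>(y, \<epsilon> v)\<close> gives local errors of
  order \<open>\<Delta>t\<^sup>2 / \<epsilon>\<^sup>3\<close>, amplified in each step by \<open>(1 + K \<Delta>t)\<^sup>2\<close>, hence the rate \<open>2 K\<close>
  (\<open>error_le_convergent\<close>). Together these are part (i).

  \<^bold>\<open>Second order.\<close> The leading effect of \<open>\<epsilon> v\<^sup>\<bottom>\<close> is the oscillating term \<open>\<epsilon> d\<^sub>xE v\<^sup>\<bottom>\<close>. Since
  \<open>v\<^sup>\<bottom> = \<epsilon> E - \<epsilon>\<^sup>2 v'\<close>, it is \<open>O(\<epsilon>\<^sup>2)\<close> up to a total derivative, and the corrected variable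
  \<open>y - \<epsilon>\<^sup>3 (d\<^sub>xE(t, y) v)\<^sup>\<bottom>\<close> moves with velocity \<open>- E(t, y)\<^sup>\<bottom> + O(\<epsilon>\<^sup>2)\<close>. The scheme inherits this:
  its implicit step reads \<open>\<Delta>t v\<^sub>n\<^sub>+\<^sub>1\<^sup>\<bottom> = \<epsilon> \<Delta>t E - \<epsilon>\<^sup>2 (v\<^sub>n\<^sub>+\<^sub>1 - v\<^sub>n)\<close>. This gives the bound
  \<open>\<Delta>t + \<epsilon>\<^sup>2\<close> of part (ii) (\<open>y_error_le_second_order\<close>); its other bound is already contained in
  \<open>error_le_convergent\<close>, because \<open>(1 + \<epsilon>\<^sup>2) (1 + \<bar>v0\<bar> + \<epsilon>) \<le> 2 (1 + \<epsilon>) (1 + \<bar>v0\<bar>\<^sup>2 + \<epsilon>\<^sup>2)\<close>.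
\<close>

section \<open>Smooth bump functions\<close>

lemma k_times_diff_const: "k_times_diff k (\<lambda>x. c)"
proof (induction k arbitrary: c)
  case (Suc k)
  then show ?case by simp
qed simp

lemma k_times_diff_SucD: "k_times_diff (Suc k) f \<Longrightarrow> k_times_diff k f"
proof (induction k arbitrary: f)
  case 0
  then show ?case by (simp add: differentiable_imp_continuous_on)
next
  case (Suc k)
  from Suc.prems have d: "f differentiable_on UNIV"
    and s: "\<And>v. k_times_diff (Suc k) (\<lambda>x. frechet_derivative f (at x) v)" by simp_all
  show ?case using d Suc.IH[OF s] by simp
qed

lemma k_times_diff_frechet_derivative:
  "k_times_diff (Suc k) f \<Longrightarrow> k_times_diff k (\<lambda>x. frechet_derivative f (at x) v)"
  by simp

lemma differentiable_on_UNIV_frechet: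
  "f differentiable_on UNIV \<Longrightarrow> (f has_derivative frechet_derivative f (at x)) (at x)"
  by (simp add: differentiable_on_def frechet_derivative_works)

text \<open>This rule reduces smoothness to a formula for the derivative: the library's
  \<open>frechet_derivative\<close> is a choice, and only uniqueness of derivatives identifies it.\<close>

lemma k_times_diff_SucI:
  assumes "\<And>x. (f has_derivative f' x) (at x)" and "\<And>v. k_times_diff k (\<lambda>x. f' x v)"
  shows "k_times_diff (Suc k) f"
proof -
  have "frechet_derivative f (at x) = f' x" for x
    using assms(1) frechet_derivative_at by metis
  then show ?thesis using assms by (auto simp: differentiable_on_def differentiable_def)
qed

lemma k_times_diff_add:
  "k_times_diff k f \<Longrightarrow> k_times_diff k g \<Longrightarrow> k_times_diff k (\<lambda>x. f x + g x)"
proof (induction k arbitrary: f g)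
  case 0
  then show ?case by (auto intro: continuous_intros)
next
  case (Suc k)
  note d = Suc.prems[unfolded k_times_diff.simps]
  show ?case
    by (rule k_times_diff_SucI, rule has_derivative_add[OF
          differentiable_on_UNIV_frechet[OF d(1)[THEN conjunct1]]
          differentiable_on_UNIV_frechet[OF d(2)[THEN conjunct1]]])
      (use d Suc.IH in auto)
qed

lemma k_times_diff_mult:
  "k_times_diff k f \<Longrightarrow> k_times_diff k g \<Longrightarrow> k_times_diff k (\<lambda>x. f x * g x)"
proof (induction k arbitrary: f g)
  case 0
  then show ?case by (auto intro: continuous_intros)
next
  case (Suc k)
  note d = Suc.prems[unfolded k_times_diff.simps]
  have fg: "k_times_diff k f" "k_times_diff k g" using Suc.prems k_times_diff_SucD by blast+
  show ?case
    by (rule k_times_diff_SucI, rule has_derivative_mult[OF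
          differentiable_on_UNIV_frechet[OF d(1)[THEN conjunct1]]
          differentiable_on_UNIV_frechet[OF d(2)[THEN conjunct1]]])
      (use d fg Suc.IH in \<open>auto intro!: k_times_diff_add\<close>)
qed

lemma k_times_diff_prod:
  assumes "finite A" "\<And>i. i \<in> A \<Longrightarrow> k_times_diff k (f i)"
  shows "k_times_diff k (\<lambda>x. \<Prod>i\<in>A. f i x)"
  using assms by (induction A) (auto simp: k_times_diff_const intro!: k_times_diff_mult)

text \<open>The tower \<open>F\<close> of successive derivatives makes the induction close: the directional derivative of
  \<open>F j (x \<bullet> b)\<close> is \<open>F (Suc j) (x \<bullet> b)\<close> times a constant.\<close>

lemma k_times_diff_compose_inner:
  fixes b :: "'a::euclidean_space" and F :: "nat \<Rightarrow> real \<Rightarrow> real"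
  assumes "\<And>j r. (F j has_real_derivative F (Suc j) r) (at r)"
  shows "k_times_diff k (\<lambda>x. F j (x \<bullet> b))"
proof (induction k arbitrary: j)
  case 0
  have "continuous_on UNIV (F j)"
    using assms by (auto simp: continuous_on_eq_continuous_at intro: DERIV_isCont)
  then show ?case
    by (auto intro!: continuous_on_compose2[of UNIV "F j"] continuous_intros)
next
  case (Suc k)
  have "((\<lambda>x. F j (x \<bullet> b)) has_derivative (\<lambda>v. F (Suc j) (x \<bullet> b) * (v \<bullet> b))) (at x)" for x
  proof -
    have "((\<lambda>x::'a. x \<bullet> b) has_derivative (\<lambda>v. v \<bullet> b)) (at x)"
      by (auto intro!: derivative_eq_intros)
    from has_derivative_compose[OF this has_field_derivative_imp_has_derivative[OF assms]]
    show ?thesis by simp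
  qed
  then show ?case
    by (rule k_times_diff_SucI) (intro k_times_diff_mult k_times_diff_const Suc)
qed

lemma k_times_diff_shift:
  "k_times_diff k f \<Longrightarrow> k_times_diff k (\<lambda>x. f (x - z))"
proof (induction k arbitrary: f)
  case 0
  then show ?case
    by (auto intro!: continuous_on_compose2[of UNIV f] continuous_intros)
next
  case (Suc k)
  note d = Suc.prems[unfolded k_times_diff.simps]
  have "((\<lambda>x. f (x - z)) has_derivative frechet_derivative f (at (x - z))) (at x)" for x
  proof -
    have "((\<lambda>x. x - z) has_derivative (\<lambda>v. v)) (at x)"
      by (auto intro!: derivative_eq_intros)
    from has_derivative_compose[OF this differentiable_on_UNIV_frechet[OF d[THEN conjunct1]]]
    show ?thesis .
  qed
  then show ?case
    by (rule k_times_diff_SucI) (rule Suc.IH, use d in blast)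
qed

text \<open>The family \<open>p(1/r) exp(-1/r)\<close>, extended by zero, is closed under differentiation. It contains the
  standard flat function \<open>exp(-1/r)\<close> for \<open>p = 1\<close>.\<close>

definition flat :: "real poly \<Rightarrow> real \<Rightarrow> real"
  where "flat p r = (if r > 0 then poly p (1 / r) * exp (- (1 / r)) else 0)"

lemma poly_exp_tendsto_0: "((\<lambda>u. poly p u * exp (- u)) \<longlongrightarrow> (0::real)) at_top"
proof -
  have "((\<lambda>u. \<Sum>i\<le>degree p. coeff p i * (u ^ i / exp u)) \<longlongrightarrow> (\<Sum>i\<le>degree p. coeff p i * 0)) at_top"
    by (intro tendsto_sum tendsto_mult tendsto_const tendsto_power_div_exp_0)
  then show ?thesis
    by (simp add: poly_altdef sum_distrib_right exp_minus field_simps sum_divide_distrib)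
qed

text \<open>At \<open>r = 0\<close> the right difference quotient is \<open>u p(u) exp(-u)\<close> with \<open>u = 1/r \<rightarrow> \<infinity>\<close>, and the
  exponential beats every polynomial.\<close>

lemma flat_has_derivative:
  "(flat p has_real_derivative flat ([:0, 0, 1:] * (p - pderiv p)) r) (at r)"
proof -
  consider "r < 0" | "r = 0" | "r > 0" by linarith
  then show ?thesis
  proof cases
    case 1
    have "((\<lambda>_. 0) has_real_derivative 0) (at r)" by simp
    moreover have "\<forall>\<^sub>F s in nhds r. flat p s = 0"
      using eventually_nhds_in_open[of "{..<0}" r] 1
      by (auto elim!: eventually_mono simp: flat_def)
    ultimately show ?thesis using 1
      by (auto simp: flat_def DERIV_cong_ev)
  next
    case 2
    have "((\<lambda>s. (1 / s) * (poly p (1 / s) * exp (- (1 / s)))) \<longlongrightarrow> (0::real)) (at_right 0)"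
    proof -
      have "((\<lambda>u. u * (poly p u * exp (- u))) \<longlongrightarrow> (0::real)) at_top"
        using poly_exp_tendsto_0[of "[:0,1:] * p"] by (simp add: mult.assoc)
      then show ?thesis
        by (rule filterlim_compose)
           (simp add: filterlim_inverse_at_top_right flip: inverse_eq_divide)
    qed
    then have "((\<lambda>s. (flat p s - flat p 0) / (s - 0)) \<longlongrightarrow> 0) (at_right 0)"
      by (rule Lim_transform_eventually)
         (auto simp: flat_def eventually_at_right_less intro: eventually_at_rightI[of 0 1])
    moreover have "((\<lambda>s. (flat p s - flat p 0) / (s - 0)) \<longlongrightarrow> 0) (at_left 0)"
      by (rule tendsto_eventually) (auto simp: flat_def intro: eventually_at_leftI[of "-1" 0])
    ultimately have "((\<lambda>s. (flat p s - flat p 0) / (s - 0)) \<longlongrightarrow> 0) (at 0)"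
      by (simp add: filterlim_split_at)
    then show ?thesis using 2 by (simp add: flat_def has_field_derivative_iff)
  next
    case 3
    have "((\<lambda>s. poly p (1 / s) * exp (- (1 / s))) has_real_derivative
        flat ([:0, 0, 1:] * (p - pderiv p)) r) (at r)"
      using 3 by (auto intro!: derivative_eq_intros DERIV_chain'[where g="poly p", OF _ poly_DERIV]
          simp: flat_def field_simps power2_eq_square)
    moreover have "\<forall>\<^sub>F s in nhds r. flat p s = poly p (1 / s) * exp (- (1 / s))"
      using eventually_nhds_in_open[of "{0<..}" r] 3
      by (auto elim!: eventually_mono simp: flat_def)
    ultimately show ?thesis
      by (subst DERIV_cong_ev[OF refl _ refl]) auto
  qed
qed

lemma smooth_flat_inner:
  fixes b :: "'a::euclidean_space"
  shows "k_times_diff k (\<lambda>x. flat p (x \<bullet> b))"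
proof -
  define F where "F j = flat (((\<lambda>q. [:0, 0, 1:] * (q - pderiv q)) ^^ j) p)" for j
  have "(F j has_real_derivative F (Suc j) r) (at r)" for j r
    unfolding F_def using flat_has_derivative by simp
  from k_times_diff_compose_inner[of F k 0 b, OF this] show ?thesis by (simp add: F_def)
qed

text \<open>A product over the coordinates of bumps on \<open>(\<delta>, 2\<delta>)\<close>, normalised. The support lies strictly on the
  positive side in every coordinate, in particular in time; this one-sidedness is what allows
  mollifying up to the initial time.\<close>

lemma mollifier_exists:
  fixes \<delta> :: real
  assumes "\<delta> > 0"
  obtains \<phi> :: "'a::euclidean_space \<Rightarrow> real"
  where "\<And>k. k_times_diff k \<phi>" "\<And>w. \<phi> w \<ge> 0"
    "\<And>w. \<phi> w \<noteq> 0 \<Longrightarrow> w \<in> cbox (\<delta> *\<^sub>R One) ((2 * \<delta>) *\<^sub>R One)"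
    "(\<phi> has_integral 1) UNIV"
proof -
  define \<eta> :: "'a \<Rightarrow> real" where
    "\<eta> w = (\<Prod>b\<in>Basis. flat 1 ((w - \<delta> *\<^sub>R One) \<bullet> b) * flat 1 ((w - (2 * \<delta>) *\<^sub>R One) \<bullet> (- b)))" for w
  have smooth: "k_times_diff k \<eta>" for k
    unfolding \<eta>_def
    by (intro k_times_diff_prod k_times_diff_mult smooth_flat_inner finite_Basis
        k_times_diff_shift[where f="\<lambda>x. flat 1 (x \<bullet> _)"])
  have nn: "\<eta> w \<ge> 0" for w
    unfolding \<eta>_def by (intro prod_nonneg) (auto simp: flat_def)
  have supp: "w \<in> cbox (\<delta> *\<^sub>R One) ((2 * \<delta>) *\<^sub>R One)" if "\<eta> w \<noteq> 0" for w
  proof -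
    have "\<delta> \<le> w \<bullet> b \<and> w \<bullet> b \<le> 2 * \<delta>" if "b \<in> Basis" for b
    proof -
      \<comment> \<open>a vanishing factor would make the whole product vanish\<close>
      have "flat 1 ((w - \<delta> *\<^sub>R One) \<bullet> b) * flat 1 ((w - (2 * \<delta>) *\<^sub>R One) \<bullet> (- b)) \<noteq> 0"
        using \<open>\<eta> w \<noteq> 0\<close> that unfolding \<eta>_def by auto
      then show ?thesis using that
        by (auto simp: flat_def inner_diff_left split: if_splits)
    qed
    then show ?thesis by (auto simp: mem_box)
  qed
  have cont: "continuous_on UNIV \<eta>" using smooth[of 0] by simp
  let ?B = "cbox (\<delta> *\<^sub>R One) ((2 * \<delta>) *\<^sub>R One) :: 'a set"
  obtain m where m: "(\<eta> has_integral m) ?B"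
    using integrable_continuous[OF continuous_on_subset[OF cont], of "\<delta> *\<^sub>R One" "(2*\<delta>) *\<^sub>R One"] by blast
  have mU: "(\<eta> has_integral m) UNIV"
    using has_integral_on_superset[OF m] supp by blast
  have "m \<ge> 0" using has_integral_nonneg[OF m] nn by blast
  moreover have "m \<noteq> 0"
  proof
    assume "m = 0"
    \<comment> \<open>The centre of the box, where every factor of \<open>\<eta>\<close> is positive.\<close>
    define w :: 'a where "w = (3/2 * \<delta>) *\<^sub>R One"
    have wB: "w \<in> box (\<delta> *\<^sub>R One) ((2 * \<delta>) *\<^sub>R One)" using assms by (auto simp: w_def mem_box)
    have "\<eta> w = 0"
    proof (rule has_integral_0_cbox_imp_0[where f=\<eta> and x=w, of "\<delta> *\<^sub>R One" "(2 * \<delta>) *\<^sub>R One"])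
      show "continuous_on ?B \<eta>" using cont continuous_on_subset by blast
      show "(\<eta> has_integral 0) ?B" using m \<open>m = 0\<close> by simp
      show "w \<in> ?B" using wB box_subset_cbox by blast
      show "box (\<delta> *\<^sub>R One) ((2 * \<delta>) *\<^sub>R One) \<noteq> ({}::'a set)" using wB by blast
    qed (use nn in auto)
    moreover have "\<eta> w > 0"
      unfolding \<eta>_def w_def
      by (intro prod_pos) (use assms in \<open>auto simp: flat_def inner_diff_left\<close>)
    ultimately show False by simp
  qed
  ultimately have "m > 0" by simp
  show ?thesis
  proof (rule that[of "\<lambda>w. (1 / m) * \<eta> w"])
    show "k_times_diff k (\<lambda>w. (1 / m) * \<eta> w)" for k
      by (intro k_times_diff_mult k_times_diff_const smooth)
    show "((\<lambda>w. (1 / m) * \<eta> w) has_integral 1) UNIV"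
      using has_integral_mult_right[OF mU, of "1 / m"] \<open>m > 0\<close> by simp
    show "w \<in> ?B" if "(1 / m) * \<eta> w \<noteq> 0" for w using supp that by auto
    show "(1 / m) * \<eta> w \<ge> 0" for w using nn[of w] \<open>m > 0\<close> by auto
  qed
qed

section \<open>Mollification and weak derivatives\<close>

lemma frechet_derivative_eq_0_outside:
  fixes \<psi> :: "'a::euclidean_space \<Rightarrow> real"
  assumes "\<And>w. \<psi> w \<noteq> 0 \<Longrightarrow> w \<in> cbox a b" and "w \<notin> cbox a b"
  shows "frechet_derivative \<psi> (at w) = (\<lambda>_. 0)"
proof -
  have "((\<lambda>_. 0) has_derivative (\<lambda>_. 0)) (at w)" by simp
  then have "(\<psi> has_derivative (\<lambda>_. 0)) (at w)"
    by (rule has_derivative_transform_within_open[of _ _ _ _ "- cbox a b"])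
      (use assms in \<open>auto simp: closed_cbox open_Compl\<close>)
  then show ?thesis using frechet_derivative_at by metis
qed

lemma frechet_derivative_support:
  fixes \<psi> :: "'a::euclidean_space \<Rightarrow> real"
  assumes "\<And>w. \<psi> w \<noteq> 0 \<Longrightarrow> w \<in> cbox a b" and "frechet_derivative \<psi> (at w) v \<noteq> 0"
  shows "w \<in> cbox a b"
proof (rule ccontr)
  assume "w \<notin> cbox a b"
  with assms(1) have "frechet_derivative \<psi> (at w) = (\<lambda>_. 0)"
    by (rule frechet_derivative_eq_0_outside)
  with assms(2) show False by simp
qed

lemma frechet_derivative_shift:
  assumes "f differentiable_on UNIV"
  shows "frechet_derivative (\<lambda>x. f (x - z)) (at w) = frechet_derivative f (at (w - z))"
proof -
  have "((\<lambda>x. x - z) has_derivative (\<lambda>v. v)) (at w)"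
    by (auto intro!: derivative_eq_intros)
  from has_derivative_compose[OF this differentiable_on_UNIV_frechet[OF assms]]
  show ?thesis using frechet_derivative_at by metis
qed

text \<open>The kernel is shifted but not reflected, so \<open>u\<close> is averaged over \<open>z + supp \<psi>\<close>.\<close>

definition mollify ::
  "('a::euclidean_space \<Rightarrow> real) \<Rightarrow> ('a \<Rightarrow> 'b::euclidean_space) \<Rightarrow> 'a \<Rightarrow> 'b"
  where "mollify \<psi> u z = integral UNIV (\<lambda>w. \<psi> (w - z) *\<^sub>R u w)"

text \<open>Differentiation under the integral sign. The minus sign comes from \<open>\<psi> (w - z)\<close>; it cancels against
  the minus sign of the weak derivative.\<close>

lemma mollify_has_derivative:
  fixes \<psi> :: "'a::euclidean_space \<Rightarrow> real" and u :: "'a \<Rightarrow> 'b::euclidean_space"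
  assumes \<psi>: "k_times_diff 1 \<psi>" and supp: "\<And>w. \<psi> w \<noteq> 0 \<Longrightarrow> w \<in> cbox a b"
    and u: "continuous_on UNIV u"
  shows "(mollify \<psi> u has_derivative
    (\<lambda>v. - mollify (\<lambda>w. frechet_derivative \<psi> (at w) v) u z)) (at z)"
proof -
  let ?D = "\<lambda>w. frechet_derivative \<psi> (at w)"
  have diff: "\<psi> differentiable_on UNIV" and contD: "\<And>v. continuous_on UNIV (\<lambda>w. ?D w v)"
    using \<psi> by simp_all
  have hd: "(\<psi> has_derivative ?D w) (at w)" for w
    using diff by (rule differentiable_on_UNIV_frechet)
  have linD: "bounded_linear (?D w)" for w using hd has_derivative_bounded_linear by blast
  have cont: "continuous_on UNIV \<psi>" using diff by (rule differentiable_imp_continuous_on)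
  have "bounded (\<Union>x\<in>ball z 1. \<Union>y\<in>cbox a b. {x + y})"
    by (intro bounded_sums bounded_ball bounded_cbox)
  then obtain c where c: "(\<Union>x\<in>ball z 1. \<Union>y\<in>cbox a b. {x + y}) \<subseteq> cbox (- c) c"
    using bounded_subset_cbox_symmetric by blast
  have box: "w \<in> cbox (- c) c" if "z' \<in> ball z 1" "w - z' \<in> cbox a b" for z' w
  proof -
    have "z' + (w - z') \<in> cbox (- c) c" using c that by blast
    then show ?thesis by simp
  qed
  \<comment> \<open>Near \<open>z\<close> all integrals live on one box, as the Leibniz rule for compact domains requires.\<close>
  have local_box: "mollify f u z' = integral (cbox (- c) c) (\<lambda>w. f (w - z') *\<^sub>R u w)"
    if "z' \<in> ball z 1" "\<And>w. f w \<noteq> 0 \<Longrightarrow> w \<in> cbox a b" for f z'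
    unfolding mollify_def
    by (subst integral_restrict_UNIV[symmetric])
      (rule integral_cong, use box[OF that(1)] that(2) in auto)
  define fx where "fx z' w = Blinfun (\<lambda>v. - (?D (w - z') v *\<^sub>R u w))" for z' w
  have fx: "blinfun_apply (fx z' w) = (\<lambda>v. - (?D (w - z') v *\<^sub>R u w))" for z' w
    unfolding fx_def
    by (rule bounded_linear_Blinfun_apply)
      (intro bounded_linear_minus bounded_linear_compose[OF bounded_linear_scaleR_left linD])
  have contfx: "continuous_on (ball z 1 \<times> cbox (- c) c) (\<lambda>(z', w). fx z' w)"
    unfolding split_beta
    by (rule continuous_on_blinfun_componentwise)
      (auto simp: fx intro!: continuous_intros continuous_on_compose2[OF contD]
        continuous_on_compose2[OF u])
  have deriv: "((\<lambda>z'. \<psi> (w - z') *\<^sub>R u w) has_derivative blinfun_apply (fx z' w))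
      (at z' within ball z 1)" for z' w
  proof -
    have "((\<lambda>z'. w - z') has_derivative (\<lambda>v. - v)) (at z' within ball z 1)"
      by (auto intro!: derivative_eq_intros)
    from has_derivative_compose[OF this hd]
    have "((\<lambda>z'. \<psi> (w - z')) has_derivative (\<lambda>v. ?D (w - z') (- v))) (at z' within ball z 1)" .
    from has_derivative_scaleR_left[OF this, of "u w"]
    show ?thesis unfolding fx using bounded_linear.linear[OF linD]
      by (simp add: linear_neg)
  qed
  have "((\<lambda>z'. integral (cbox (- c) c) (\<lambda>w. \<psi> (w - z') *\<^sub>R u w)) has_derivative
      blinfun_apply (integral (cbox (- c) c) (fx z))) (at z within ball z 1)"
  proof (rule leibniz_rule[where f="\<lambda>z' w. \<psi> (w - z') *\<^sub>R u w" and fx=fx and U="ball z 1"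
        and a="- c" and b=c and ?x0.0=z, OF deriv _ contfx])
    show "(\<lambda>w. \<psi> (w - z') *\<^sub>R u w) integrable_on cbox (- c) c" for z'
      by (intro integrable_continuous continuous_intros continuous_on_compose2[OF cont]
          continuous_on_subset[OF u]) auto
  qed auto
  then have "((\<lambda>z'. integral (cbox (- c) c) (\<lambda>w. \<psi> (w - z') *\<^sub>R u w)) has_derivative
      blinfun_apply (integral (cbox (- c) c) (fx z))) (at z)"
    by (simp add: at_within_open[of z "ball z 1"])
  then have md: "(mollify \<psi> u has_derivative blinfun_apply (integral (cbox (- c) c) (fx z))) (at z)"
    by (rule has_derivative_transform_within_open[of _ _ _ _ "ball z 1"])
      (use local_box[OF _ supp] in auto)
  have "blinfun_apply (integral (cbox (- c) c) (fx z)) v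
      = - mollify (\<lambda>w. ?D w v) u z" for v
  proof -
    have "continuous_on (cbox (- c) c) (fx z)"
      by (rule continuous_on_compose2[OF contfx, where f="\<lambda>w. (z, w)", simplified])
        (auto intro!: continuous_intros)
    then have "fx z integrable_on cbox (- c) c" by (rule integrable_continuous)
    then have "blinfun_apply (integral (cbox (- c) c) (fx z)) v
        = integral (cbox (- c) c) (\<lambda>w. - (?D (w - z) v *\<^sub>R u w))"
      by (simp add: blinfun_apply_integral fx)
    also have "\<dots> = - mollify (\<lambda>w. ?D w v) u z"
      using local_box[of z "\<lambda>w. ?D w v"] frechet_derivative_support[of \<psi>, OF supp] by simp
    finally show ?thesis .
  qed
  then have "blinfun_apply (integral (cbox (- c) c) (fx z))
      = (\<lambda>v. - mollify (\<lambda>w. ?D w v) u z)" by (rule ext)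
  with md show ?thesis by simp
qed

lemma mollify_eq_lebesgue_integral:
  fixes \<psi> :: "'a::euclidean_space \<Rightarrow> real" and u u' :: "'a \<Rightarrow> 'b::euclidean_space"
  assumes \<psi>: "continuous_on UNIV \<psi>" and supp: "\<And>w. \<psi> w \<noteq> 0 \<Longrightarrow> w \<in> cbox a b"
    and u: "continuous_on UNIV u" and S: "S \<in> sets lebesgue"
    and sub: "\<And>w. w - z \<in> cbox a b \<Longrightarrow> w \<in> S" and eq: "\<And>w. w \<in> S \<Longrightarrow> u w = u' w"
  shows "mollify \<psi> u z = (LINT w|lebesgue_on S. \<psi> (w - z) *\<^sub>R u' w)"
    and "integrable lebesgue (\<lambda>w. \<psi> (w - z) *\<^sub>R u w)"
proof -
  let ?f = "\<lambda>w. \<psi> (w - z) *\<^sub>R u w"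
  have box: "w \<in> cbox (a + z) (b + z)" if "w - z \<in> cbox a b" for w
    using that by (force simp: mem_box inner_diff_left inner_add_left algebra_simps)
  have "continuous_on (cbox (a + z) (b + z)) ?f"
    by (intro continuous_intros continuous_on_compose2[OF \<psi>] continuous_on_subset[OF u]) auto
  then have "?f absolutely_integrable_on cbox (a + z) (b + z)"
    by (rule absolutely_integrable_continuous)
  moreover have "(\<lambda>w. indicator (cbox (a + z) (b + z)) w *\<^sub>R ?f w) = ?f"
    using supp box by (auto simp: fun_eq_iff indicator_def)
  ultimately show int: "integrable lebesgue ?f"
    unfolding set_integrable_def by simp
  have "mollify \<psi> u z = (LINT w|lebesgue. ?f w)"
    unfolding mollify_def by (rule integral_lebesgue[OF int])
  also have "\<dots> = (LINT w|lebesgue. (if w \<in> S then \<psi> (w - z) *\<^sub>R u' w else 0))"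
    by (rule Bochner_Integration.integral_cong) (use supp sub eq in auto)
  also have "\<dots> = (LINT w|lebesgue_on S. \<psi> (w - z) *\<^sub>R u' w)"
    by (rule Lebesgue_Measure.integral_restrict_UNIV[OF S])
  finally show "mollify \<psi> u z = (LINT w|lebesgue_on S. \<psi> (w - z) *\<^sub>R u' w)" .
qed

lemma test_function_shift:
  fixes \<psi> :: "'a::euclidean_space \<Rightarrow> real"
  assumes \<psi>: "\<And>k. k_times_diff k \<psi>" and supp: "\<And>w. \<psi> w \<noteq> 0 \<Longrightarrow> w \<in> cbox a b"
    and sub: "\<And>w. w - z \<in> cbox a b \<Longrightarrow> w \<in> S"
  shows "test_function S (\<lambda>w. \<psi> (w - z))"
proof -
  let ?C = "closure {w. \<psi> (w - z) \<noteq> 0}"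
  have "{w. \<psi> (w - z) \<noteq> 0} \<subseteq> cbox (a + z) (b + z)"
    using supp by (force simp: mem_box inner_diff_left inner_add_left algebra_simps)
  then have C: "?C \<subseteq> cbox (a + z) (b + z)"
    by (rule closure_minimal) (rule closed_cbox)
  then have "compact ?C"
    by (meson bounded_cbox bounded_subset closed_closure compact_eq_bounded_closed)
  moreover have "?C \<subseteq> S"
  proof
    fix w assume "w \<in> ?C"
    then have "w - z \<in> cbox a b"
      using C by (force simp: mem_box inner_diff_left inner_add_left algebra_simps)
    then show "w \<in> S" by (rule sub)
  qed
  ultimately show ?thesis
    unfolding test_function_def using k_times_diff_shift[OF \<psi>] by blast
qed

text \<open>The defining identity of the weak derivative, tested with a shifted kernel.\<close>

lemma weak_derivative_integral_by_parts:
  fixes \<psi> :: "'a::euclidean_space \<Rightarrow> real"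
  assumes \<psi>: "\<And>k. k_times_diff k \<psi>" and supp: "\<And>w. \<psi> w \<noteq> 0 \<Longrightarrow> w \<in> cbox a b"
    and sub: "\<And>w. w - z \<in> cbox a b \<Longrightarrow> w \<in> S"
    and g: "weak_derivative S v u g"
  shows "(LINT w|lebesgue_on S. frechet_derivative \<psi> (at (w - z)) v *\<^sub>R u w)
    = - (LINT w|lebesgue_on S. \<psi> (w - z) *\<^sub>R g w)"
proof -
  have "\<psi> differentiable_on UNIV" using \<psi>[of 1] by simp
  then show ?thesis
    using g test_function_shift[of \<psi> a b z S, OF \<psi> supp sub] frechet_derivative_shift[of \<psi> z]
    unfolding weak_derivative_def by fastforce
qed

lemma mollifier_integral_shift:
  fixes \<phi> :: "'a::euclidean_space \<Rightarrow> real"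
  assumes "(\<phi> has_integral 1) UNIV" and supp: "\<And>w. \<phi> w \<noteq> 0 \<Longrightarrow> w \<in> cbox a b"
  shows "((\<lambda>w. \<phi> (w - z)) has_integral 1) UNIV"
proof -
  have "((\<lambda>x. if x \<in> cbox a b then \<phi> x else 0) has_integral 1) UNIV"
    by (rule has_integral_eq[OF _ assms(1)]) (use supp in auto)
  then have "(\<phi> has_integral 1) (cbox a b)" by (simp add: has_integral_restrict_UNIV)
  then have "((\<phi> \<circ> ((+) (- z))) has_integral 1) (cbox (a + z) (b + z))"
    by (subst has_integral_shift_cbox_iff) simp
  then have "((\<lambda>w. \<phi> (w - z)) has_integral 1) (cbox (a + z) (b + z))"
    by (simp add: o_def)
  then show ?thesis
    by (rule has_integral_on_superset)
      (use supp in \<open>force simp: mem_box inner_diff_left inner_add_left algebra_simps\<close>)+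
qed

text \<open>An average with a probability kernel does not exceed the essential bound. For vector-valued \<open>g\<close>
  this keeps the Euclidean norm sharp, which estimates by components would lose.\<close>

lemma weighted_mean_le_ess_bound:
  fixes \<phi> :: "'a::euclidean_space \<Rightarrow> real" and g :: "'a \<Rightarrow> 'b::euclidean_space"
  assumes \<phi>: "continuous_on UNIV \<phi>" "\<And>w. \<phi> w \<ge> 0" "(\<phi> has_integral 1) UNIV"
    and supp: "\<And>w. \<phi> w \<noteq> 0 \<Longrightarrow> w \<in> cbox a b"
    and S: "S \<in> sets lebesgue" and sub: "\<And>w. w - z \<in> cbox a b \<Longrightarrow> w \<in> S"
    and M: "AE w in lebesgue_on S. norm (g w) \<le> M" and "M \<ge> 0"
  shows "norm (LINT w|lebesgue_on S. \<phi> (w - z) *\<^sub>R g w) \<le> M"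
proof -
  have "continuous_on UNIV (\<lambda>_::'a. M)" by simp
  note m = mollify_eq_lebesgue_integral[OF \<phi>(1) _ this S sub refl, OF supp, of z]
  have int: "integrable (lebesgue_on S) (\<lambda>w. \<phi> (w - z) *\<^sub>R M)"
    using integrable_mult_indicator[OF S m(2)] S by (subst integrable_restrict_space) auto
  have "norm (LINT w|lebesgue_on S. \<phi> (w - z) *\<^sub>R g w)
      \<le> (LINT w|lebesgue_on S. norm (\<phi> (w - z) *\<^sub>R g w))" by (rule integral_norm_bound)
  also have "\<dots> \<le> (LINT w|lebesgue_on S. \<phi> (w - z) *\<^sub>R M)"
    by (rule integral_mono_AE'[OF int])
      (use M \<phi>(2) \<open>M \<ge> 0\<close> in \<open>auto elim!: eventually_mono intro: mult_left_mono\<close>)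
  also have "\<dots> = mollify \<phi> (\<lambda>_. M) z" using m(1) by simp
  also have "\<dots> = 1 *\<^sub>R M"
    unfolding mollify_def
    by (intro integral_unique has_integral_scaleR_left mollifier_integral_shift[OF \<phi>(3) supp])
  finally show ?thesis by simp
qed

lemma mollify_close:
  fixes \<phi> :: "'a::euclidean_space \<Rightarrow> real" and u :: "'a \<Rightarrow> 'b::euclidean_space"
  assumes \<phi>: "continuous_on UNIV \<phi>" "\<And>w. \<phi> w \<ge> 0" "(\<phi> has_integral 1) UNIV"
    and supp: "\<And>w. \<phi> w \<noteq> 0 \<Longrightarrow> w \<in> cbox a b"
    and u: "continuous_on UNIV u"
    and e: "\<And>w. w - z \<in> cbox a b \<Longrightarrow> norm (u w - u z) \<le> e"
  shows "norm (mollify \<phi> u z - u z) \<le> e"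
proof -
  note 1 = mollifier_integral_shift[OF \<phi>(3) supp, of z]
  have "integrable lebesgue (\<lambda>w. \<phi> (w - z) *\<^sub>R u w)"
    using mollify_eq_lebesgue_integral(2)[OF \<phi>(1) supp u, of UNIV z u] by simp
  then have "(\<lambda>w. \<phi> (w - z) *\<^sub>R u w) integrable_on UNIV"
    by (rule has_integral_integrable[OF has_integral_integral_lebesgue])
  then have m: "((\<lambda>w. \<phi> (w - z) *\<^sub>R u w) has_integral mollify \<phi> u z) UNIV"
    unfolding mollify_def by (rule integrable_integral)
  have "((\<lambda>w. \<phi> (w - z) *\<^sub>R u w - \<phi> (w - z) *\<^sub>R u z) has_integral mollify \<phi> u z - 1 *\<^sub>R u z) UNIV"
    by (intro has_integral_diff m has_integral_scaleR_left 1)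
  then have d: "((\<lambda>w. \<phi> (w - z) *\<^sub>R (u w - u z)) has_integral mollify \<phi> u z - u z) UNIV"
    by (simp add: scaleR_diff_right)
  have e1: "((\<lambda>w. \<phi> (w - z) *\<^sub>R e) has_integral 1 *\<^sub>R e) UNIV"
    by (intro has_integral_scaleR_left 1)
  have "norm (integral UNIV (\<lambda>w. \<phi> (w - z) *\<^sub>R (u w - u z)))
      \<le> integral UNIV (\<lambda>w. \<phi> (w - z) *\<^sub>R e)"
  proof (rule integral_norm_bound_integral)
    show "norm (\<phi> (w - z) *\<^sub>R (u w - u z)) \<le> \<phi> (w - z) *\<^sub>R e" for w
      using e[of w] supp[of "w - z"] \<phi>(2)[of "w - z"]
      by (cases "\<phi> (w - z) = 0") (auto intro: mult_left_mono)
  qed (use d e1 in blast)+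
  then show ?thesis unfolding integral_unique[OF d] integral_unique[OF e1] by simp
qed

lemma ess_boundedE:
  assumes "ess_bounded S u"
  obtains M where "M \<ge> 0" "AE z in lebesgue_on S. norm (u z) \<le> M"
    "u \<in> borel_measurable (lebesgue_on S)"
proof -
  obtain M where M: "AE z in lebesgue_on S. norm (u z) \<le> M"
    and u: "u \<in> borel_measurable (lebesgue_on S)"
    using assms unfolding ess_bounded_def by blast
  have "AE z in lebesgue_on S. norm (u z) \<le> \<bar>M\<bar>" using M by (auto elim!: eventually_mono)
  with u show ?thesis using that[of "\<bar>M\<bar>"] by simp
qed

lemma integrable_weight_ess_bounded:
  fixes \<phi> :: "'a::euclidean_space \<Rightarrow> real" and g :: "'a \<Rightarrow> 'b::euclidean_space"
  assumes \<phi>: "continuous_on UNIV \<phi>" and supp: "\<And>w. \<phi> w \<noteq> 0 \<Longrightarrow> w \<in> cbox a b"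
    and S: "S \<in> sets lebesgue" and sub: "\<And>w. w - z \<in> cbox a b \<Longrightarrow> w \<in> S"
    and g: "ess_bounded S g"
  shows "integrable (lebesgue_on S) (\<lambda>w. \<phi> (w - z) *\<^sub>R g w)"
proof -
  obtain M where M: "M \<ge> 0" "AE w in lebesgue_on S. norm (g w) \<le> M"
    and meas: "g \<in> borel_measurable (lebesgue_on S)" using ess_boundedE[OF g] by blast
  have "integrable lebesgue (\<lambda>w. \<phi> (w - z) *\<^sub>R M)"
    by (rule mollify_eq_lebesgue_integral(2)[of \<phi> a b "\<lambda>_. M" S z "\<lambda>_. M"])
      (use \<phi> supp S sub in simp_all)
  from integrable_mult_indicator[OF S this]
  have int: "integrable (lebesgue_on S) (\<lambda>w. \<phi> (w - z) *\<^sub>R M)"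
    using S by (subst integrable_restrict_space) auto
  have "continuous_on S (\<lambda>w. \<phi> (w - z))"
    by (intro continuous_on_compose2[OF \<phi>] continuous_intros) auto
  then have [measurable]: "(\<lambda>w. \<phi> (w - z)) \<in> borel_measurable (lebesgue_on S)"
    by (rule continuous_imp_measurable_on_sets_lebesgue) (rule S)
  note meas[measurable]
  show ?thesis
    by (rule Bochner_Integration.integrable_bound[OF int])
      (use M in \<open>auto elim!: eventually_mono simp: abs_mult intro: mult_left_mono\<close>)
qed

lemma linear_bound_of_Basis:
  fixes f :: "'a::euclidean_space \<Rightarrow> 'b::real_normed_vector"
    and M :: real
  assumes "linear f" "\<And>b. b \<in> Basis \<Longrightarrow> norm (f b) \<le> M"
  shows "norm (f d) \<le> DIM('a) * M * norm d"
proof -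
  have "f d = f (\<Sum>b\<in>Basis. (d \<bullet> b) *\<^sub>R b)" by (simp add: euclidean_representation)
  also have "\<dots> = (\<Sum>b\<in>Basis. (d \<bullet> b) *\<^sub>R f b)"
    using assms(1) by (simp add: linear_sum linear_scale)
  also have "norm \<dots> \<le> (\<Sum>b\<in>(Basis::'a set). M * norm d)"
  proof (rule sum_norm_le)
    fix b :: 'a assume b: "b \<in> Basis"
    have "\<bar>d \<bullet> b\<bar> * norm (f b) \<le> norm d * M"
      by (rule mult_mono) (use b assms(2) Basis_le_norm in auto)
    then show "norm ((d \<bullet> b) *\<^sub>R f b) \<le> M * norm d" by (simp add: mult.commute)
  qed
  finally show ?thesis by simp
qed

section \<open>The Lipschitz constant in space\<close>

text \<open>The essential supremum of a function that is not measurable is infinite by convention, so the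
  operator norm of a measurable differential must be shown to be measurable. It depends continuously,
  even Lipschitz continuously, on the two columns.\<close>

lemma onorm_matrix_continuous:
  "continuous_on UNIV (\<lambda>p :: 'b::euclidean_space \<times> 'b.
    onorm (\<lambda>u :: real^2. (u $ 1) *\<^sub>R fst p + (u $ 2) *\<^sub>R snd p))"
proof -
  define L :: "'b \<times> 'b \<Rightarrow> real^2 \<Rightarrow> 'b" where "L = (\<lambda>p u. (u $ 1) *\<^sub>R fst p + (u $ 2) *\<^sub>R snd p)"
  have bl: "bounded_linear (L p)" for p
    unfolding L_def
    by (intro bounded_linear_add bounded_linear_compose[OF bounded_linear_scaleR_left]
        bounded_linear_vec_nth)
  have le: "onorm (L p) \<le> onorm (L q) + 2 * norm (p - q)" for p q
  proof (rule onorm_bound)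
    fix u :: "real^2"
    have "norm (L p u) \<le> norm (L q u) + norm (L p u - L q u)"
      by (metis add.commute diff_add_cancel norm_triangle_ineq)
    moreover have "norm (L q u) \<le> onorm (L q) * norm u" by (rule onorm[OF bl])
    moreover have "norm (L p u - L q u) \<le> 2 * norm (p - q) * norm u"
    proof -
      have "L p u - L q u = (u $ 1) *\<^sub>R fst (p - q) + (u $ 2) *\<^sub>R snd (p - q)"
        by (simp add: L_def scaleR_diff_right)
      also have "norm \<dots> \<le> \<bar>u $ 1\<bar> * norm (fst (p - q)) + \<bar>u $ 2\<bar> * norm (snd (p - q))"
        by (metis norm_scaleR norm_triangle_ineq)
      also have "\<dots> \<le> norm u * norm (p - q) + norm u * norm (p - q)"
        using component_le_norm_cart[of u]
        by (intro add_mono mult_mono) (simp_all add: norm_prod_def del: fst_diff snd_diff)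
      finally show ?thesis by (simp add: mult_ac)
    qed
    ultimately show "norm (L p u) \<le> (onorm (L q) + 2 * norm (p - q)) * norm u"
      by (simp add: distrib_right)
  qed (use onorm_pos_le[OF bl] in auto)
  have "\<bar>onorm (L p) - onorm (L q)\<bar> \<le> 2 * norm (p - q)" for p q
    using le[of p q] le[of q p] norm_minus_commute[of p q] by linarith
  then have "2-lipschitz_on UNIV (\<lambda>p. onorm (L p))"
    by (intro lipschitz_onI) (simp_all add: dist_norm)
  then have "continuous_on UNIV (\<lambda>p. onorm (L p))" by (rule lipschitz_on_continuous_on)
  then show ?thesis by (simp add: L_def)
qed

lemma field_domain_lebesgue: "field_domain \<in> sets lebesgue"
  unfolding field_domain_def by (auto intro!: sets_completionI_sets borel_open open_Times)

text \<open>On a null space every essential supremum is the bottom element; positivity of the measure makes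
  the essential supremum of a nonnegative function nonnegative.\<close>

lemma field_domain_not_null: "emeasure (lebesgue_on field_domain) (space (lebesgue_on field_domain)) \<noteq> 0"
proof
  assume "emeasure (lebesgue_on field_domain) (space (lebesgue_on field_domain)) = 0"
  then have "emeasure lebesgue field_domain = 0"
    using field_domain_lebesgue by (simp add: emeasure_restrict_space)
  then have "field_domain \<in> null_sets lebesgue" using field_domain_lebesgue by auto
  then have "negligible field_domain" by (simp add: negligible_iff_null_sets)
  moreover have "open field_domain" unfolding field_domain_def by (intro open_Times) auto
  moreover have "field_domain \<noteq> {}" by (auto simp: field_domain_def)
  ultimately show False using open_not_negligible by blast
qed

lemma Basis_pair_real_vec:
  "(b :: real \<times> (real^2)) \<in> Basis \<longleftrightarrow> b = (1, 0) \<or> (\<exists>i\<in>Basis. b = (0, i))"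
  by (auto simp: Basis_prod_def)

lemma W_infinity_SucD: "W_infinity (Suc k) S u \<Longrightarrow> W_infinity k S u"
  by (induction k arbitrary: u) (simp, metis W_infinity.simps(2))

lemma weak_x_differential_exists:
  assumes "field_W_infinity 1 E"
  shows "\<exists>D. weak_x_differential E D"
proof -
  have "\<forall>i\<in>Basis. \<exists>g. weak_derivative field_domain (0, i) E g \<and> ess_bounded field_domain g"
    using assms by (auto simp: field_W_infinity_def Basis_pair_real_vec)
  then obtain g where g: "\<And>i. i \<in> Basis \<Longrightarrow> weak_derivative field_domain (0, i) E (g i)"
    "\<And>i. i \<in> Basis \<Longrightarrow> ess_bounded field_domain (g i)" by metis
  define D where "D z u = (\<Sum>i\<in>Basis. (u \<bullet> i) *\<^sub>R g i z)" for z u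
  have "linear (D z)" for z
    unfolding D_def
    by (intro linear_compose_sum ballI linearI) (auto simp: inner_add_left scaleR_add_left)
  moreover have "D z i = g i z" if "i \<in> Basis" for i z
    using that by (simp add: D_def inner_Basis if_distrib[of "\<lambda>c. c *\<^sub>R _"] cong: if_cong)
  ultimately have "weak_x_differential E D"
    unfolding weak_x_differential_def using g by (simp cong: if_cong)
  then show ?thesis by blast
qed

lemma onorm_weak_x_differential_measurable:
  assumes D: "weak_x_differential E D"
  shows "(\<lambda>z. onorm (D z)) \<in> borel_measurable (lebesgue_on field_domain)"
proof -
  have lin: "linear (D z)" for z using D unfolding weak_x_differential_def by blast
  have meas: "(\<lambda>z. D z (axis j 1)) \<in> borel_measurable (lebesgue_on field_domain)" for j
    using D by (auto simp: weak_x_differential_def ess_bounded_def axis_in_Basis_iff)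
  have eq: "D z = (\<lambda>u. (u $ 1) *\<^sub>R D z (axis 1 1) + (u $ 2) *\<^sub>R D z (axis 2 1))" for z
  proof
    fix u :: "real^2"
    have "D z ((u $ 1) *\<^sub>R axis 1 1 + (u $ 2) *\<^sub>R axis 2 1)
        = (u $ 1) *\<^sub>R D z (axis 1 1) + (u $ 2) *\<^sub>R D z (axis 2 1)"
      by (simp add: linear_add[OF lin] linear_scale[OF lin])
    moreover have "(u $ 1) *\<^sub>R axis 1 1 + (u $ 2) *\<^sub>R axis 2 1 = u"
      by (simp add: vec_eq_iff forall_2 axis_def)
    ultimately show "D z u = (u $ 1) *\<^sub>R D z (axis 1 1) + (u $ 2) *\<^sub>R D z (axis 2 1)"
      by simp
  qed
  have "(\<lambda>z. (D z (axis 1 1), D z (axis 2 1))) \<in> borel_measurable (lebesgue_on field_domain)"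
    by (rule borel_measurable_Pair[OF meas[of 1] meas[of 2]])
  from borel_measurable_continuous_on[OF onorm_matrix_continuous this]
  have "(\<lambda>z. onorm (\<lambda>u :: real^2. (u $ 1) *\<^sub>R D z (axis 1 1) + (u $ 2) *\<^sub>R D z (axis 2 1)))
      \<in> borel_measurable (lebesgue_on field_domain)" unfolding fst_conv snd_conv .
  then show ?thesis unfolding eq[symmetric] .
qed

text \<open>\<open>K\<^sub>x\<close> is defined through \<open>real_of_ereal\<close>, which sends infinite values to zero. The essential
  supremum is finite, hence \<open>K\<^sub>x\<close> really bounds the chosen weak differential.\<close>

lemma K\<^sub>x_essential_bound:
  assumes "field_W_infinity 1 E"
  obtains D where "weak_x_differential E D" "K\<^sub>x E \<ge> 0"
    "AE z in lebesgue_on field_domain. onorm (D z) \<le> K\<^sub>x E"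
proof -
  let ?M = "lebesgue_on field_domain"
  define D where "D = (SOME D. weak_x_differential E D)"
  have D: "weak_x_differential E D"
    unfolding D_def using weak_x_differential_exists[OF assms] by (rule someI_ex)
  have lin: "linear (D z)" for z using D unfolding weak_x_differential_def by blast
  have nn: "onorm (D z) \<ge> 0" for z using onorm_pos_le lin linear_conv_bounded_linear by blast
  define e where "e = esssup ?M (\<lambda>z. ereal (onorm (D z)))"
  have meas: "(\<lambda>z. ereal (onorm (D z))) \<in> borel_measurable ?M"
    using onorm_weak_x_differential_measurable[OF D] by measurable
  have "\<exists>C. AE z in ?M. onorm (D z) \<le> C"
  proof -
    have "\<forall>i\<in>Basis. \<exists>C. AE z in ?M. norm (D z i) \<le> C"
      using D by (auto simp: weak_x_differential_def ess_bounded_def)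
    then obtain C where C: "\<And>i. i \<in> Basis \<Longrightarrow> AE z in ?M. norm (D z i) \<le> C i" by metis
    define C' where "C' = (\<Sum>i\<in>Basis. \<bar>C i\<bar>)"
    have "AE z in ?M. \<forall>i\<in>Basis. norm (D z i) \<le> C i"
      by (rule AE_finite_allI) (use C in auto)
    then have "AE z in ?M. onorm (D z) \<le> DIM(real^2) * C'"
    proof eventually_elim
      case (elim z)
      have "norm (D z i) \<le> C'" if "i \<in> Basis" for i
        using elim that member_le_sum[of i Basis "\<lambda>i. \<bar>C i\<bar>"] unfolding C'_def by force
      moreover have "C' \<ge> 0" by (simp add: C'_def sum_nonneg)
      ultimately show ?case
        by (intro onorm_bound) (use linear_bound_of_Basis[OF lin[of z], of C'] in auto)
    qed
    then show ?thesis by blast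
  qed
  then obtain C where "AE z in ?M. onorm (D z) \<le> C" by blast
  then have "e \<le> ereal C" unfolding e_def by (intro esssup_I meas) auto
  moreover have "0 \<le> e"
  proof -
    have "0 = esssup ?M (\<lambda>z. 0 :: ereal)"
      using esssup_const[OF field_domain_not_null] by simp
    also have "\<dots> \<le> e" unfolding e_def by (rule esssup_mono) (use nn in auto)
    finally show ?thesis .
  qed
  ultimately obtain r where r: "e = ereal r" "r \<ge> 0" by (cases e) auto
  have K: "K\<^sub>x E = r" unfolding K\<^sub>x_def using r(1) by (simp add: e_def D_def)
  have "AE z in ?M. ereal (onorm (D z)) \<le> e" unfolding e_def by (rule esssup_AE)
  then have "AE z in ?M. onorm (D z) \<le> K\<^sub>x E" using r K by simp
  then show ?thesis using that[OF D] K r by simp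
qed

section \<open>Regularity of the electric field\<close>

text \<open>What the comparison of trajectories uses of \<open>E \<in> W\<^sup>1\<^sup>,\<^sup>\<infinity>\<close>. The approximation property replaces the
  chain rule for the Lipschitz function \<open>E\<close>, which need not be differentiable along a trajectory.\<close>

locale bounded_lipschitz_field =
  fixes E :: "real \<times> (real^2) \<Rightarrow> real^2" and B K :: real
  assumes K_nonneg: "0 \<le> K"
    and field_bound: "0 \<le> t \<Longrightarrow> norm (E (t, x)) \<le> B"
    and time_lipschitz: "0 \<le> s \<Longrightarrow> 0 \<le> t \<Longrightarrow> norm (E (s, x) - E (t, x)) \<le> B * \<bar>s - t\<bar>"
    and space_lipschitz: "0 \<le> t \<Longrightarrow> norm (E (t, x) - E (t, y)) \<le> K * norm (x - y)"
    and C1_approximation: "0 < \<delta> \<Longrightarrow>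
      \<exists>F F'. (\<forall>z. (F has_derivative F' z) (at z)) \<and>
        (\<forall>t\<ge>0. \<forall>x. norm (F (t, x) - E (t, x)) \<le> \<delta> \<and> norm (F (t, x)) \<le> B \<and>
          (\<forall>d. norm (F' (t, x) d) \<le> B * norm d))"

text \<open>What the comparison uses of \<open>E \<in> W\<^sup>2\<^sup>,\<^sup>\<infinity>\<close>. The spatial differential is differentiated column by
  column; along a trajectory it is applied to a velocity that varies in time, and the product rule is
  then available for each coordinate of that velocity.\<close>

locale bounded_C11_field = bounded_lipschitz_field +
  fixes M :: real
  assumes C11_approximation: "0 < \<delta> \<Longrightarrow>
      \<exists>F F' F''. (\<forall>z. (F has_derivative F' z) (at z)) \<and>
        (\<forall>i\<in>Basis. \<forall>z. ((\<lambda>z. F' z (0, i)) has_derivative F'' i z) (at z)) \<and>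
        (\<forall>t\<ge>0. \<forall>x. norm (F (t, x) - E (t, x)) \<le> \<delta> \<and>
          (\<forall>d. norm (F' (t, x) d) \<le> M * norm d) \<and>
          (\<forall>i\<in>Basis. \<forall>d. norm (F'' i (t, x) d) \<le> M * norm d))"

lemma inner_One_Basis: "b \<in> Basis \<Longrightarrow> One \<bullet> b = 1"
  using inner_sum_left_Basis[of b "\<lambda>_. 1"] by simp

text \<open>All consequences of mollification at scale \<open>\<delta>\<close>, with the kernel hidden. The field is extended to
  negative times by \<open>E (max 0 t, x)\<close>, so that the mollified field is smooth everywhere; the kernel
  looks only forward in time, so its values at \<open>t \<ge> 0\<close> come from \<open>E\<close> alone. Second derivatives are
  estimated by moving both derivatives onto the kernel and then back one at a time. The last
  property treats the spatial differential as one linear map, which yields its operator norm.\<close>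

lemma mollified_field_exists:
  fixes E :: "real \<times> (real^2) \<Rightarrow> real^2"
  assumes cont: "continuous_on ({0..} \<times> UNIV) E" and "\<delta> > 0"
  obtains F F' F'' where
    "\<And>z. (F has_derivative F' z) (at z)"
    "\<And>i z. ((\<lambda>z. F' z i) has_derivative F'' i z) (at z)"
    "\<And>z e. fst z \<ge> 0 \<Longrightarrow>
      (\<And>w. fst w \<ge> 0 \<Longrightarrow> norm (w - z) \<le> 6 * \<delta> \<Longrightarrow> norm (E w - E z) \<le> e) \<Longrightarrow>
      norm (F z - E z) \<le> e"
    "\<And>z C. fst z \<ge> 0 \<Longrightarrow> C \<ge> 0 \<Longrightarrow> AE w in lebesgue_on field_domain. norm (E w) \<le> C \<Longrightarrow>
      norm (F z) \<le> C"
    "\<And>z C v g. fst z \<ge> 0 \<Longrightarrow> C \<ge> 0 \<Longrightarrow> weak_derivative field_domain v E g \<Longrightarrow>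
      AE w in lebesgue_on field_domain. norm (g w) \<le> C \<Longrightarrow> norm (F' z v) \<le> C"
    "\<And>z C v g i h. fst z \<ge> 0 \<Longrightarrow> C \<ge> 0 \<Longrightarrow> weak_derivative field_domain v E g \<Longrightarrow>
      weak_derivative field_domain i g h \<Longrightarrow>
      AE w in lebesgue_on field_domain. norm (h w) \<le> C \<Longrightarrow> norm (F'' i z v) \<le> C"
    "\<And>z C D u. fst z \<ge> 0 \<Longrightarrow> C \<ge> 0 \<Longrightarrow> weak_x_differential E D \<Longrightarrow>
      AE w in lebesgue_on field_domain. onorm (D w) \<le> C \<Longrightarrow> norm (F' z (0, u)) \<le> C * norm u"
proof -
  define a b where "a = \<delta> *\<^sub>R (One :: real \<times> (real^2))" and "b = (2 * \<delta>) *\<^sub>R (One :: real \<times> (real^2))"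
  obtain \<phi> :: "real \<times> (real^2) \<Rightarrow> real" where smooth: "\<And>k. k_times_diff k \<phi>"
    and nonneg: "\<And>w. \<phi> w \<ge> 0" and supp: "\<And>w. \<phi> w \<noteq> 0 \<Longrightarrow> w \<in> cbox a b"
    and int1: "(\<phi> has_integral 1) UNIV"
    using mollifier_exists[OF \<open>\<delta> > 0\<close>] unfolding a_def b_def by metis
  let ?S = "field_domain"
  note S = field_domain_lebesgue
  \<comment> \<open>extension of the field by its initial values, continuous on the whole space\<close>
  define u where "u = (\<lambda>z. E (max 0 (fst z), snd z))"
  have u: "continuous_on UNIV u"
    unfolding u_def by (rule continuous_on_compose2[OF cont]) (auto intro!: continuous_intros)
  have eq: "u w = E w" if "w \<in> ?S" for w using that by (cases w) (auto simp: u_def field_domain_def)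
  have eq0: "u w = E w" if "fst w \<ge> 0" for w using that by (cases w) (auto simp: u_def)
  have sub: "w \<in> ?S" if "fst z \<ge> 0" "w - z \<in> cbox a b" for z w
  proof -
    have "(1, 0) \<in> (Basis :: (real \<times> (real^2)) set)" by (simp add: Basis_prod_def)
    then have "a \<bullet> (1, 0) \<le> (w - z) \<bullet> (1, 0)" using that(2) unfolding mem_box by blast
    then have "\<delta> \<le> (w - z) \<bullet> (1, 0)"
      unfolding a_def inner_scaleR_left inner_One_Basis[OF \<open>(1, 0) \<in> Basis\<close>] by simp
    then have "\<delta> \<le> fst w - fst z" by (simp add: inner_prod_def)
    then show ?thesis using that(1) \<open>\<delta> > 0\<close> by (cases w) (auto simp: field_domain_def)
  qed
  \<comment> \<open>\<open>6 = 3 \<cdot> 2\<close>: three coordinates, each at most \<open>2 \<delta>\<close>.\<close>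
  have near: "norm d \<le> 6 * \<delta>" if "d \<in> cbox a b" for d
  proof -
    have "norm d \<le> (\<Sum>b\<in>Basis. \<bar>d \<bullet> b\<bar>)" by (rule norm_le_l1)
    also have "\<dots> \<le> (\<Sum>b\<in>(Basis :: (real \<times> (real^2)) set). 2 * \<delta>)"
    proof (rule sum_mono)
      fix c :: "real \<times> (real^2)" assume c: "c \<in> Basis"
      have "a \<bullet> c \<le> d \<bullet> c" "d \<bullet> c \<le> b \<bullet> c" using that c unfolding mem_box by blast+
      then show "\<bar>d \<bullet> c\<bar> \<le> 2 * \<delta>"
        using \<open>\<delta> > 0\<close> unfolding a_def b_def inner_scaleR_left inner_One_Basis[OF c] by simp
    qed
    finally show ?thesis by simp
  qed
  have cont_\<phi>: "continuous_on UNIV \<phi>" using smooth[of 0] by simp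
  define dd where "dd v = (\<lambda>w. frechet_derivative \<phi> (at w) v)" for v
  define ddd where "ddd i v = (\<lambda>w. frechet_derivative (dd i) (at w) v)" for i v
  have smooth': "k_times_diff k (dd v)" for k v unfolding dd_def by (intro k_times_diff_frechet_derivative smooth)
  have smooth'': "k_times_diff k (ddd i v)" for k i v unfolding ddd_def by (intro k_times_diff_frechet_derivative smooth')
  have supp': "w \<in> cbox a b" if "dd v w \<noteq> 0" for v w
    using frechet_derivative_support[of \<phi>] supp that unfolding dd_def by blast
  have supp'': "w \<in> cbox a b" if "ddd i v w \<noteq> 0" for i v w
    using frechet_derivative_support[of "dd i"] supp' that unfolding ddd_def by blast
  define F where "F = mollify \<phi> u"
  define F' where "F' = (\<lambda>z v. - mollify (dd v) u z)"
  define F'' where "F'' = (\<lambda>i z v. mollify (ddd i v) u z)"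
  have F: "(F has_derivative F' z) (at z)" for z
    unfolding F_def F'_def dd_def
    by (rule mollify_has_derivative) (use smooth[of 1] supp u in blast)+
  have F': "((\<lambda>z. F' z i) has_derivative F'' i z) (at z)" for i z
  proof -
    have "(mollify (dd i) u has_derivative (\<lambda>v. - mollify (ddd i v) u z)) (at z)"
      unfolding ddd_def
      by (rule mollify_has_derivative) (use smooth'[of 1] supp' u in blast)+
    from has_derivative_minus[OF this] show ?thesis by (simp add: F'_def F''_def)
  qed
  have F'_eq: "F' z v = (LINT w|lebesgue_on ?S. \<phi> (w - z) *\<^sub>R g w)"
    if "fst z \<ge> 0" "weak_derivative ?S v E g" for z v g
  proof -
    have "mollify (dd v) u z = (LINT w|lebesgue_on ?S. dd v (w - z) *\<^sub>R E w)"
      by (rule mollify_eq_lebesgue_integral(1)[where a=a and b=b])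
        (use smooth'[of 0] supp' u S sub[OF that(1)] eq in auto)
    also have "\<dots> = - (LINT w|lebesgue_on ?S. \<phi> (w - z) *\<^sub>R g w)"
      unfolding dd_def
      by (rule weak_derivative_integral_by_parts[where a=a and b=b])
        (use smooth supp sub[OF that(1)] that(2) in auto)
    finally show ?thesis by (simp add: F'_def)
  qed
  have F''_eq: "F'' i z v = (LINT w|lebesgue_on ?S. \<phi> (w - z) *\<^sub>R h w)"
    if "fst z \<ge> 0" "weak_derivative ?S v E g" "weak_derivative ?S i g h" for z v i g h
  proof -
    have "F'' i z v = (LINT w|lebesgue_on ?S. ddd i v (w - z) *\<^sub>R E w)"
      unfolding F''_def by (rule mollify_eq_lebesgue_integral(1)[where a=a and b=b])
        (use smooth''[of 0] supp'' u S sub[OF that(1)] eq in auto)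
    also have "\<dots> = - (LINT w|lebesgue_on ?S. dd i (w - z) *\<^sub>R g w)"
      unfolding ddd_def
      by (rule weak_derivative_integral_by_parts[where a=a and b=b])
        (use smooth' supp' sub[OF that(1)] that(2) in auto)
    also have "(LINT w|lebesgue_on ?S. dd i (w - z) *\<^sub>R g w)
        = - (LINT w|lebesgue_on ?S. \<phi> (w - z) *\<^sub>R h w)"
      unfolding dd_def
      by (rule weak_derivative_integral_by_parts[where a=a and b=b])
        (use smooth supp sub[OF that(1)] that(3) in auto)
    finally show ?thesis by simp
  qed
  have mean: "norm (LINT w|lebesgue_on ?S. \<phi> (w - z) *\<^sub>R g w) \<le> C"
    if "fst z \<ge> 0" "C \<ge> 0" "AE w in lebesgue_on ?S. norm (g w) \<le> C"
    for z C and g :: "real \<times> (real^2) \<Rightarrow> real^2"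
    by (rule weighted_mean_le_ess_bound[OF cont_\<phi> nonneg int1, where a=a and b=b])
      (use supp S sub[OF that(1)] that in auto)
  show ?thesis
  proof (rule that[OF F F'])
    show "norm (F z - E z) \<le> e" if "fst z \<ge> 0"
      "\<And>w. fst w \<ge> 0 \<Longrightarrow> norm (w - z) \<le> 6 * \<delta> \<Longrightarrow> norm (E w - E z) \<le> e" for z e
    proof -
      have "norm (mollify \<phi> u z - u z) \<le> e"
      proof (rule mollify_close[OF cont_\<phi> nonneg int1, where a=a and b=b])
        fix w assume w: "w - z \<in> cbox a b"
        then have "w \<in> ?S" using sub that(1) by blast
        then have "fst w \<ge> 0" by (auto simp: field_domain_def)
        then show "norm (u w - u z) \<le> e"
          using that(2)[of w] near[OF w] that(1) eq0 by simp
      qed (use supp u in auto)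
      then show ?thesis using that(1) eq0 by (simp add: F_def)
    qed
    show "norm (F z) \<le> C" if "fst z \<ge> 0" "C \<ge> 0"
      "AE w in lebesgue_on ?S. norm (E w) \<le> C" for z C
    proof -
      have "F z = (LINT w|lebesgue_on ?S. \<phi> (w - z) *\<^sub>R E w)"
        unfolding F_def by (rule mollify_eq_lebesgue_integral(1)[where a=a and b=b])
          (use cont_\<phi> supp u S sub[OF that(1)] eq in auto)
      then show ?thesis using mean that by simp
    qed
    show "norm (F' z v) \<le> C" if "fst z \<ge> 0" "C \<ge> 0" "weak_derivative ?S v E g"
      "AE w in lebesgue_on ?S. norm (g w) \<le> C" for z C v g
      using F'_eq mean that by simp
    show "norm (F'' i z v) \<le> C" if "fst z \<ge> 0" "C \<ge> 0" "weak_derivative ?S v E g"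
      "weak_derivative ?S i g h" "AE w in lebesgue_on ?S. norm (h w) \<le> C" for z C v g i h
      using F''_eq[OF that(1,3,4)] mean that by simp
    show "norm (F' z (0, p)) \<le> C * norm p" if "fst z \<ge> 0" "C \<ge> 0" "weak_x_differential E D"
      "AE w in lebesgue_on ?S. onorm (D w) \<le> C" for z C D p
    proof -
      have linF: "linear (F' z)" using F has_derivative_linear by blast
      have linD: "linear (D w)" for w using that(3) unfolding weak_x_differential_def by blast
      have D: "weak_derivative ?S (0, i) E (\<lambda>w. D w i)" "ess_bounded ?S (\<lambda>w. D w i)"
        if "i \<in> Basis" for i
        using \<open>weak_x_differential E D\<close> that unfolding weak_x_differential_def by blast+
      have int: "integrable (lebesgue_on ?S) (\<lambda>w. \<phi> (w - z) *\<^sub>R D w i)" if "i \<in> Basis" for i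
        by (rule integrable_weight_ess_bounded[where a=a and b=b])
          (use cont_\<phi> supp S sub[OF \<open>fst z \<ge> 0\<close>] D(2)[OF that] in auto)
      have "(0, p) = (\<Sum>i\<in>Basis. (p \<bullet> i) *\<^sub>R (0 :: real, i))"
        by (simp add: prod_eq_iff fst_sum snd_sum euclidean_representation)
      then have "F' z (0, p) = (\<Sum>i\<in>Basis. (p \<bullet> i) *\<^sub>R F' z (0, i))"
        by (simp only: linear_sum[OF linF] linear_scale[OF linF])
      also have "\<dots> = (\<Sum>i\<in>Basis. LINT w|lebesgue_on ?S. (p \<bullet> i) *\<^sub>R (\<phi> (w - z) *\<^sub>R D w i))"
        using F'_eq[OF that(1) D(1)] int by (intro sum.cong) (auto simp del: scaleR_scaleR)
      also have "\<dots> = (LINT w|lebesgue_on ?S. (\<Sum>i\<in>Basis. (p \<bullet> i) *\<^sub>R (\<phi> (w - z) *\<^sub>R D w i)))"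
        by (rule Bochner_Integration.integral_sum[symmetric])
          (intro Bochner_Integration.integrable_scaleR_right int)
      also have "(\<lambda>w. \<Sum>i\<in>Basis. (p \<bullet> i) *\<^sub>R (\<phi> (w - z) *\<^sub>R D w i)) = (\<lambda>w. \<phi> (w - z) *\<^sub>R D w p)"
      proof
        fix w
        have "D w p = D w (\<Sum>i\<in>Basis. (p \<bullet> i) *\<^sub>R i)" by (simp add: euclidean_representation)
        also have "\<dots> = (\<Sum>i\<in>Basis. (p \<bullet> i) *\<^sub>R D w i)"
          using linD by (simp add: linear_sum linear_scale)
        finally show "(\<Sum>i\<in>Basis. (p \<bullet> i) *\<^sub>R (\<phi> (w - z) *\<^sub>R D w i)) = \<phi> (w - z) *\<^sub>R D w p"
          by (simp add: scaleR_sum_right mult.commute)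
      qed
      also have "norm (LINT w|lebesgue_on ?S. \<phi> (w - z) *\<^sub>R D w p) \<le> C * norm p"
      proof (rule mean)
        show "AE w in lebesgue_on ?S. norm (D w p) \<le> C * norm p"
          using that(4)
        proof eventually_elim
          case (elim w)
          have "norm (D w p) \<le> onorm (D w) * norm p"
            using linD by (intro onorm) (simp add: linear_conv_bounded_linear)
          also have "\<dots> \<le> C * norm p" using elim by (intro mult_right_mono) auto
          finally show ?case .
        qed
      qed (use that in auto)
      finally show ?thesis .
    qed
  qed
qed

text \<open>One mollification scale has to serve two points at once.\<close>

lemma continuous_on_common_radius:
  fixes E :: "'a::real_normed_vector \<Rightarrow> 'b::real_normed_vector"
  assumes "continuous_on S E" "finite A" "A \<subseteq> S" "e > 0"
  obtains d where "d > 0"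
    "\<And>z w. z \<in> A \<Longrightarrow> w \<in> S \<Longrightarrow> norm (w - z) \<le> d \<Longrightarrow> norm (E w - E z) \<le> e"
proof -
  have "\<exists>d>0. \<forall>z\<in>A. \<forall>w\<in>S. norm (w - z) \<le> d \<longrightarrow> norm (E w - E z) \<le> e"
    using assms(2,3)
  proof (induction A)
    case empty
    then show ?case by (auto intro: exI[of _ 1])
  next
    case (insert z A)
    then obtain d where d: "d > 0" "\<forall>z\<in>A. \<forall>w\<in>S. norm (w - z) \<le> d \<longrightarrow> norm (E w - E z) \<le> e"
      by auto
    obtain d' where d': "d' > 0" "\<forall>w\<in>S. dist w z < d' \<longrightarrow> dist (E w) (E z) < e"
      using assms(1) insert.prems \<open>e > 0\<close> unfolding continuous_on_iff by (metis insert_subset)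
    have "norm (E w - E z) \<le> e" if "w \<in> S" "norm (w - z) \<le> min d (d' / 2)" for w
      using d'(2)[rule_format, of w] that d'(1) by (auto simp: dist_norm)
    then show ?case using d d'(1)
      by (intro exI[of _ "min d (d' / 2)"]) auto
  qed
  then show ?thesis using that by blast
qed

lemma finite_common_bound:
  fixes P :: "'a \<Rightarrow> real \<Rightarrow> bool"
  assumes "finite A" "\<And>a. a \<in> A \<Longrightarrow> \<exists>C. P a C"
    and mono: "\<And>a C C'. P a C \<Longrightarrow> C \<le> C' \<Longrightarrow> P a C'"
  shows "\<exists>C\<ge>0. \<forall>a\<in>A. P a C"
  using assms(1,2)
proof (induction A)
  case empty
  then show ?case by auto
next
  case (insert a A)
  then obtain C C' where "C \<ge> 0" "\<forall>a\<in>A. P a C" "P a C'" by blast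
  then show ?case by (intro exI[of _ "max C C'"]) (auto intro: mono)
qed

lemma AE_norm_le_mono:
  "AE z in N. norm (g z) \<le> (C::real) \<Longrightarrow> C \<le> C' \<Longrightarrow> AE z in N. norm (g z) \<le> C'"
  by (auto elim!: eventually_mono)

lemma field_W_infinity_bounds:
  assumes "field_W_infinity 1 E"
  obtains C where "C \<ge> 0" "AE w in lebesgue_on field_domain. norm (E w) \<le> C"
    "\<And>v. v \<in> Basis \<Longrightarrow> \<exists>g. weak_derivative field_domain v E g \<and>
      (AE w in lebesgue_on field_domain. norm (g w) \<le> C)"
proof -
  have E: "ess_bounded field_domain E" using assms by (simp add: field_W_infinity_def)
  obtain C0 where C0: "C0 \<ge> 0" "AE w in lebesgue_on field_domain. norm (E w) \<le> C0"
    using ess_boundedE[OF E] by blast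
  have "\<exists>C\<ge>0. \<forall>v\<in>Basis. \<exists>g. weak_derivative field_domain v E g \<and>
      (AE w in lebesgue_on field_domain. norm (g w) \<le> C)"
  proof (rule finite_common_bound)
    fix v :: "real \<times> (real^2)" assume "v \<in> Basis"
    then show "\<exists>C g. weak_derivative field_domain v E g \<and>
        (AE w in lebesgue_on field_domain. norm (g w) \<le> C)"
      using assms unfolding field_W_infinity_def One_nat_def W_infinity.simps ess_bounded_def by blast
  next
    fix v :: "real \<times> (real^2)" and C C' :: real
    assume "\<exists>g. weak_derivative field_domain v E g \<and>
        (AE w in lebesgue_on field_domain. norm (g w) \<le> C)" "C \<le> C'"
    then show "\<exists>g. weak_derivative field_domain v E g \<and>
        (AE w in lebesgue_on field_domain. norm (g w) \<le> C')"
      using AE_norm_le_mono by blast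
  qed simp
  then obtain C where C: "C \<ge> 0" "\<And>v. v \<in> Basis \<Longrightarrow> \<exists>g. weak_derivative field_domain v E g \<and>
      (AE w in lebesgue_on field_domain. norm (g w) \<le> C)" by blast
  show ?thesis
  proof (rule that[of "max C0 C"])
    show "AE w in lebesgue_on field_domain. norm (E w) \<le> max C0 C"
      by (rule AE_norm_le_mono[OF C0(2)]) simp
    fix v :: "real \<times> (real^2)" assume "v \<in> Basis"
    then show "\<exists>g. weak_derivative field_domain v E g \<and>
      (AE w in lebesgue_on field_domain. norm (g w) \<le> max C0 C)"
      using C(2) AE_norm_le_mono max.cobounded2 by metis
  qed (use C0 in simp)
qed

lemma field_W2_infinity_bounds:
  assumes "field_W_infinity 2 E"
  obtains C where "C \<ge> 0"
    "\<And>v i. v \<in> Basis \<Longrightarrow> i \<in> Basis \<Longrightarrow>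
      \<exists>g h. weak_derivative field_domain v E g \<and> weak_derivative field_domain i g h \<and>
        (AE w in lebesgue_on field_domain. norm (h w) \<le> C)"
proof -
  have "\<exists>C\<ge>0. \<forall>p\<in>Basis \<times> Basis.
      \<exists>g h. weak_derivative field_domain (fst p) E g \<and> weak_derivative field_domain (snd p) g h \<and>
        (AE w in lebesgue_on field_domain. norm (h w) \<le> C)"
  proof (rule finite_common_bound)
    fix p :: "(real \<times> (real^2)) \<times> (real \<times> (real^2))" assume p: "p \<in> Basis \<times> Basis"
    obtain g where g: "weak_derivative field_domain (fst p) E g" "W_infinity 1 field_domain g"
      using assms p unfolding field_W_infinity_def numeral_2_eq_2 One_nat_def W_infinity.simps(2)[of "Suc 0"]
      by (metis mem_Times_iff)
    obtain h where "weak_derivative field_domain (snd p) g h" "ess_bounded field_domain h"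
      using g(2) p unfolding One_nat_def W_infinity.simps by (metis mem_Times_iff)
    with g(1) show "\<exists>C g h. weak_derivative field_domain (fst p) E g \<and>
        weak_derivative field_domain (snd p) g h \<and>
        (AE w in lebesgue_on field_domain. norm (h w) \<le> C)"
      unfolding ess_bounded_def by blast
  next
    fix p :: "(real \<times> (real^2)) \<times> (real \<times> (real^2))" and C C' :: real
    assume "\<exists>g h. weak_derivative field_domain (fst p) E g \<and> weak_derivative field_domain (snd p) g h \<and>
        (AE w in lebesgue_on field_domain. norm (h w) \<le> C)" "C \<le> C'"
    then show "\<exists>g h. weak_derivative field_domain (fst p) E g \<and> weak_derivative field_domain (snd p) g h \<and>
        (AE w in lebesgue_on field_domain. norm (h w) \<le> C')"
      using AE_norm_le_mono by blast
  qed simp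
  then show ?thesis using that by fastforce
qed

lemma C1_lipschitz_time:
  fixes F :: "real \<times> 'a::real_normed_vector \<Rightarrow> 'b::real_normed_vector"
  assumes "\<And>z. (F has_derivative F' z) (at z)"
    and "\<And>t d. t \<ge> 0 \<Longrightarrow> norm (F' (t, x) d) \<le> C * norm d" and "s \<ge> 0" "t \<ge> 0"
  shows "norm (F (s, x) - F (t, x)) \<le> C * \<bar>s - t\<bar>"
proof -
  have "norm (F (s, x) - F (t, x)) \<le> C * norm (s - t)"
  proof (rule differentiable_bound[of "{0..}" "\<lambda>s. F (s, x)" "\<lambda>s a. F' (s, x) (a, 0)"])
    fix r :: real assume r: "r \<in> {0..}"
    have "((\<lambda>s. (s, x)) has_derivative (\<lambda>a. (a, 0))) (at r within {0..})"
      by (auto intro!: derivative_eq_intros)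
    from has_derivative_compose[OF this assms(1)]
    show "((\<lambda>s. F (s, x)) has_derivative (\<lambda>a. F' (r, x) (a, 0))) (at r within {0..})" .
    show "onorm (\<lambda>a. F' (r, x) (a, 0)) \<le> C"
    proof (rule onorm_bound)
      show "norm (F' (r, x) (a, 0)) \<le> C * norm a" for a
        using assms(2)[of r "(a, 0)"] r by (simp add: norm_Pair)
      show "0 \<le> C" using assms(2)[of r "(1, 0)"] r
        by (simp add: norm_Pair) (meson norm_ge_zero order_trans)
    qed
  qed (use assms(3,4) in auto)
  then show ?thesis by simp
qed

lemma C1_lipschitz_space:
  fixes F :: "real \<times> 'a::real_normed_vector \<Rightarrow> 'b::real_normed_vector"
  assumes "\<And>z. (F has_derivative F' z) (at z)"
    and "\<And>x u. norm (F' (t, x) (0, u)) \<le> C * norm u" and "C \<ge> 0"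
  shows "norm (F (t, x) - F (t, y)) \<le> C * norm (x - y)"
proof (rule differentiable_bound[of UNIV "\<lambda>x. F (t, x)" "\<lambda>x u. F' (t, x) (0, u)"])
  fix p :: 'a
  have "((\<lambda>x. (t, x)) has_derivative (\<lambda>u. (0, u))) (at p)"
    by (auto intro!: derivative_eq_intros)
  from has_derivative_compose[OF this assms(1)]
  show "((\<lambda>x. F (t, x)) has_derivative (\<lambda>u. F' (t, p) (0, u))) (at p)" .
  show "onorm (\<lambda>u. F' (t, p) (0, u)) \<le> C"
    by (rule onorm_bound) (use assms in auto)
qed auto

lemma lipschitz_of_partial_lipschitz:
  fixes E :: "real \<times> 'a::real_normed_vector \<Rightarrow> 'b::real_normed_vector"
  assumes time: "\<And>s t x. s \<ge> 0 \<Longrightarrow> t \<ge> 0 \<Longrightarrow> norm (E (s, x) - E (t, x)) \<le> B * \<bar>s - t\<bar>"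
    and space: "\<And>t x y. t \<ge> 0 \<Longrightarrow> norm (E (t, x) - E (t, y)) \<le> K * norm (x - y)"
    and "B \<ge> 0" "K \<ge> 0" "fst w \<ge> 0" "fst z \<ge> 0"
  shows "norm (E w - E z) \<le> (B + K) * norm (w - z)"
proof -
  obtain s x t y where wz: "w = (s, x)" "z = (t, y)" by (cases w, cases z)
  have "norm (E w - E z) \<le> norm (E (s, x) - E (t, x)) + norm (E (t, x) - E (t, y))"
    using norm_triangle_ineq[of "E (s, x) - E (t, x)" "E (t, x) - E (t, y)"] wz by simp
  also have "\<dots> \<le> B * \<bar>s - t\<bar> + K * norm (x - y)"
    using time space assms(5,6) wz by (intro add_mono) auto
  also have "\<dots> \<le> B * norm (w - z) + K * norm (w - z)"
    using norm_fst_le[of "s - t" "x - y"] norm_snd_le[of "x - y" "s - t"] assms(3,4) wz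
    by (intro add_mono mult_left_mono) auto
  finally show ?thesis by (simp add: distrib_right)
qed

text \<open>The mollified fields satisfy the bounds, and they converge pointwise to the continuous field. Once
  \<open>E\<close> is known to be Lipschitz, the convergence is uniform, which gives the approximation property.\<close>

proposition W1_infinity_field:
  assumes E: "field_W_infinity 1 E"
  shows "\<exists>B. bounded_lipschitz_field E B (K\<^sub>x E)"
proof -
  obtain D where D: "weak_x_differential E D" "K\<^sub>x E \<ge> 0"
    "AE z in lebesgue_on field_domain. onorm (D z) \<le> K\<^sub>x E"
    using K\<^sub>x_essential_bound[OF E] .
  obtain C where C: "C \<ge> 0" "AE w in lebesgue_on field_domain. norm (E w) \<le> C"
    "\<And>v. v \<in> Basis \<Longrightarrow> \<exists>g. weak_derivative field_domain v E g \<and>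
      (AE w in lebesgue_on field_domain. norm (g w) \<le> C)"
    using field_W_infinity_bounds[OF E] by metis
  have cont: "continuous_on ({0..} \<times> UNIV) E" using E by (simp add: field_W_infinity_def)
  \<comment> \<open>three directional bounds combine to a bound on the full differential in dimension three\<close>
  define B where "B = 3 * C"
  have CB: "C \<le> B" "B \<ge> 0" using C(1) by (simp_all add: B_def)
  have approx: "\<exists>F F'. (\<forall>z. (F has_derivative F' z) (at z)) \<and>
      (\<forall>z e. fst z \<ge> 0 \<longrightarrow>
        (\<forall>w. fst w \<ge> 0 \<longrightarrow> norm (w - z) \<le> 6 * \<delta> \<longrightarrow> norm (E w - E z) \<le> e) \<longrightarrow>
        norm (F z - E z) \<le> e) \<and>
      (\<forall>t\<ge>0. \<forall>x. norm (F (t, x)) \<le> B \<and> (\<forall>d. norm (F' (t, x) d) \<le> B * norm d) \<and>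
        (\<forall>u. norm (F' (t, x) (0, u)) \<le> K\<^sub>x E * norm u))"
    if "\<delta> > 0" for \<delta>
  proof (rule mollified_field_exists[OF cont that], goal_cases)
    case (1 F F' F'')
    show ?case
    proof (intro exI[of _ F] exI[of _ F'] conjI allI impI)
      show "(F has_derivative F' z) (at z)" for z by (rule 1(1))
      show "norm (F z - E z) \<le> e" if "0 \<le> fst z"
        "\<forall>w. fst w \<ge> 0 \<longrightarrow> norm (w - z) \<le> 6 * \<delta> \<longrightarrow> norm (E w - E z) \<le> e" for z e
        using 1(3)[of z e] that by blast
      fix t :: real and x :: "real^2" assume t: "0 \<le> t"
      show "norm (F (t, x)) \<le> B" using 1(4)[of "(t, x)" C] C t CB by simp
      show "norm (F' (t, x) (0, u)) \<le> K\<^sub>x E * norm u" for u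
        using 1(7)[of "(t, x)" "K\<^sub>x E" D u] D t by simp
      have "linear (F' (t, x))" using 1(1) has_derivative_linear by blast
      then have "norm (F' (t, x) d) \<le> DIM(real \<times> (real^2)) * C * norm d" for d
      proof (rule linear_bound_of_Basis)
        fix b :: "real \<times> (real^2)" assume "b \<in> Basis"
        then obtain g where "weak_derivative field_domain b E g"
          "AE w in lebesgue_on field_domain. norm (g w) \<le> C" using C(3) by blast
        then show "norm (F' (t, x) b) \<le> C" using 1(5)[of "(t, x)" C b g] t C(1) by simp
      qed
      then show "norm (F' (t, x) d) \<le> B * norm d" for d by (simp add: B_def)
    qed
  qed
  have limit: "norm (E z1 - E z2) \<le> r"
    if z: "fst z1 \<ge> 0" "fst z2 \<ge> 0"
      and r: "\<And>(F :: real \<times> (real^2) \<Rightarrow> real^2) F'. (\<And>z. (F has_derivative F' z) (at z)) \<Longrightarrow>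
        (\<And>t x d. t \<ge> 0 \<Longrightarrow> norm (F' (t, x) d) \<le> B * norm d) \<Longrightarrow>
        (\<And>t x u. t \<ge> 0 \<Longrightarrow> norm (F' (t, x) (0, u)) \<le> K\<^sub>x E * norm u) \<Longrightarrow>
        norm (F z1 - F z2) \<le> r" for z1 z2 r
  proof (rule field_le_epsilon)
    fix e :: real assume "e > 0"
    then have "e / 2 > 0" by simp
    obtain d where d: "d > 0" "\<And>z w. z \<in> {z1, z2} \<Longrightarrow> w \<in> {0..} \<times> UNIV \<Longrightarrow> norm (w - z) \<le> d
        \<Longrightarrow> norm (E w - E z) \<le> e / 2"
      using continuous_on_common_radius[OF cont _ _ \<open>e / 2 > 0\<close>, of "{z1, z2}"] z
      by (auto simp: mem_Times_iff)
    have "d / 6 > 0" using d(1) by simp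
    from approx[OF this] obtain F F' where F: "\<And>z. (F has_derivative F' z) (at z)"
      and close: "\<And>z e. fst z \<ge> 0 \<Longrightarrow>
        (\<And>w. fst w \<ge> 0 \<Longrightarrow> norm (w - z) \<le> 6 * (d / 6) \<Longrightarrow> norm (E w - E z) \<le> e) \<Longrightarrow>
        norm (F z - E z) \<le> e"
      and F': "\<And>t x d. t \<ge> 0 \<Longrightarrow> norm (F' (t, x) d) \<le> B * norm d"
        "\<And>t x u. t \<ge> 0 \<Longrightarrow> norm (F' (t, x) (0, u)) \<le> K\<^sub>x E * norm u"
      by blast
    have "norm (F z - E z) \<le> e / 2" if "z \<in> {z1, z2}" for z
      by (rule close) (use that z d(2)[OF that] in \<open>auto simp: mem_Times_iff\<close>)
    then have "norm (F z1 - E z1) \<le> e / 2" "norm (F z2 - E z2) \<le> e / 2" by auto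
    moreover have "norm (F z1 - F z2) \<le> r" by (rule r[of F F']) (use F F' in blast)+
    moreover have "E z1 - E z2 = (F z1 - F z2) - (F z1 - E z1) + (F z2 - E z2)" by simp
    ultimately show "norm (E z1 - E z2) \<le> r + e"
      by (smt (verit) norm_triangle_ineq norm_triangle_ineq4 field_sum_of_halves)
  qed
  have time: "norm (E (s, x) - E (t, x)) \<le> B * \<bar>s - t\<bar>" if "s \<ge> 0" "t \<ge> 0" for s t x
  proof (rule limit, goal_cases)
    case (3 F F')
    show ?case by (rule C1_lipschitz_time[of F F']) (use 3 that in blast)+
  qed (use that in auto)
  have space: "norm (E (t, x) - E (t, y)) \<le> K\<^sub>x E * norm (x - y)" if "t \<ge> 0" for t x y
  proof (rule limit, goal_cases)
    case (3 F F')
    show ?case by (rule C1_lipschitz_space[of F F']) (use 3 that D(2) in blast)+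
  qed (use that in auto)
  have near: "norm (E w - E z) \<le> (B + K\<^sub>x E) * norm (w - z)" if "fst w \<ge> 0" "fst z \<ge> 0" for w z
    by (rule lipschitz_of_partial_lipschitz) (use that time space CB D(2) in auto)
  have approx': "\<exists>F F'. (\<forall>z. (F has_derivative F' z) (at z)) \<and>
      (\<forall>t\<ge>0. \<forall>x. norm (F (t, x) - E (t, x)) \<le> \<delta> \<and> norm (F (t, x)) \<le> B \<and>
        (\<forall>d. norm (F' (t, x) d) \<le> B * norm d))" if "\<delta> > 0" for \<delta>
  proof -
    define d where "d = \<delta> / (6 * (1 + B + K\<^sub>x E))"
    have pos: "1 + B + K\<^sub>x E > 0" using CB D(2) by simp
    then have "d > 0" using that by (simp add: d_def)
    have "6 * (\<delta> / (6 * c)) = \<delta> / c" for c by simp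
    then have d6: "6 * d = \<delta> / (1 + B + K\<^sub>x E)" unfolding d_def .
    from approx[OF \<open>d > 0\<close>] obtain F F' where F: "\<forall>z. (F has_derivative F' z) (at z)"
      and close: "\<And>z e. fst z \<ge> 0 \<Longrightarrow>
        (\<And>w. fst w \<ge> 0 \<Longrightarrow> norm (w - z) \<le> 6 * d \<Longrightarrow> norm (E w - E z) \<le> e) \<Longrightarrow>
        norm (F z - E z) \<le> e"
      and F': "\<And>t x. t \<ge> 0 \<Longrightarrow> norm (F (t, x)) \<le> B \<and> (\<forall>d. norm (F' (t, x) d) \<le> B * norm d)"
      by blast
    have "norm (F (t, x) - E (t, x)) \<le> \<delta>" if t: "t \<ge> 0" for t x
    proof (rule close)
      fix w :: "real \<times> (real^2)" assume w: "fst w \<ge> 0" "norm (w - (t, x)) \<le> 6 * d"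
      have "norm (E w - E (t, x)) \<le> (B + K\<^sub>x E) * norm (w - (t, x))"
        by (rule near) (use w t in auto)
      also have "\<dots> \<le> (1 + B + K\<^sub>x E) * (6 * d)"
        by (rule mult_mono) (use w pos CB D(2) in auto)
      also have "\<dots> = \<delta>" using pos by (simp add: d6)
      finally show "norm (E w - E (t, x)) \<le> \<delta>" .
    qed (use t in simp)
    with F F' show ?thesis by blast
  qed
  have bound: "norm (E (t, x)) \<le> B" if t: "t \<ge> 0" for t x
  proof (rule field_le_epsilon)
    fix e :: real assume "e > 0"
    from approx'[OF this] obtain F where "norm (F (t, x) - E (t, x)) \<le> e" "norm (F (t, x)) \<le> B"
      using t by blast
    then show "norm (E (t, x)) \<le> B + e"
      by (smt (verit) norm_minus_commute norm_triangle_sub)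
  qed
  have "bounded_lipschitz_field E B (K\<^sub>x E)"
    by unfold_locales (use D(2) bound time space approx' in auto)
  then show ?thesis by blast
qed

text \<open>The weak derivatives of order two bound the derivatives of the mollified spatial differential, in
  all directions of space-time.\<close>

proposition W2_infinity_field:
  assumes E: "field_W_infinity 2 E"
  shows "\<exists>B M. bounded_C11_field E B (K\<^sub>x E) M"
proof -
  have E1: "field_W_infinity 1 E"
    using E W_infinity_SucD[of 1] unfolding field_W_infinity_def numeral_2_eq_2 One_nat_def by blast
  obtain B where B: "bounded_lipschitz_field E B (K\<^sub>x E)" using W1_infinity_field[OF E1] by blast
  interpret bounded_lipschitz_field E B "K\<^sub>x E" by (rule B)
  have cont: "continuous_on ({0..} \<times> UNIV) E" using E by (simp add: field_W_infinity_def)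
  obtain C1 where C1: "C1 \<ge> 0" "\<And>v. v \<in> Basis \<Longrightarrow> \<exists>g. weak_derivative field_domain v E g \<and>
      (AE w in lebesgue_on field_domain. norm (g w) \<le> C1)"
    using field_W_infinity_bounds[OF E1] by metis
  obtain C2 where C2: "C2 \<ge> 0" "\<And>v i. v \<in> Basis \<Longrightarrow> i \<in> Basis \<Longrightarrow>
      \<exists>g h. weak_derivative field_domain v E g \<and> weak_derivative field_domain i g h \<and>
        (AE w in lebesgue_on field_domain. norm (h w) \<le> C2)"
    using field_W2_infinity_bounds[OF E] by metis
  define M where "M = 3 * (C1 + C2)"
  have B0: "B \<ge> 0" using field_bound[of 0 0] norm_ge_zero order_trans by blast
  have "\<exists>F F' F''. (\<forall>z. (F has_derivative F' z) (at z)) \<and>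
        (\<forall>i\<in>Basis. \<forall>z. ((\<lambda>z. F' z (0, i)) has_derivative F'' i z) (at z)) \<and>
        (\<forall>t\<ge>0. \<forall>x. norm (F (t, x) - E (t, x)) \<le> \<delta> \<and>
          (\<forall>d. norm (F' (t, x) d) \<le> M * norm d) \<and>
          (\<forall>i\<in>Basis. \<forall>d. norm (F'' i (t, x) d) \<le> M * norm d))" if "\<delta> > 0" for \<delta>
  proof -
    define d where "d = \<delta> / (6 * (1 + B + K\<^sub>x E))"
    have pos: "1 + B + K\<^sub>x E > 0" using B0 K_nonneg by simp
    then have "d > 0" using that by (simp add: d_def)
    have "6 * (\<delta> / (6 * c)) = \<delta> / c" for c by simp
    then have d6: "6 * d = \<delta> / (1 + B + K\<^sub>x E)" unfolding d_def .
    show ?thesis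
    proof (rule mollified_field_exists[OF cont \<open>d > 0\<close>], goal_cases)
      case (1 F F' F'')
      show ?case
      proof (intro exI[of _ F] exI[of _ F'] exI[of _ "\<lambda>i. F'' (0, i)"] conjI allI ballI impI)
        show "(F has_derivative F' z) (at z)" for z by (rule 1(1))
        show "((\<lambda>z. F' z (0, i)) has_derivative F'' (0, i) z) (at z)" for i z by (rule 1(2))
        fix t :: real and x :: "real^2" assume t: "0 \<le> t"
        show "norm (F (t, x) - E (t, x)) \<le> \<delta>"
        proof (rule 1(3))
          fix w :: "real \<times> (real^2)" assume w: "fst w \<ge> 0" "norm (w - (t, x)) \<le> 6 * d"
          have "norm (E w - E (t, x)) \<le> (B + K\<^sub>x E) * norm (w - (t, x))"
            by (rule lipschitz_of_partial_lipschitz)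
              (use w t time_lipschitz space_lipschitz B0 K_nonneg in auto)
          also have "\<dots> \<le> (1 + B + K\<^sub>x E) * (6 * d)"
            by (rule mult_mono) (use w pos B0 K_nonneg in auto)
          also have "\<dots> = \<delta>" using pos by (simp add: d6)
          finally show "norm (E w - E (t, x)) \<le> \<delta>" .
        qed (use t in simp)
        have "linear (F' (t, x))" using 1(1) has_derivative_linear by blast
        then have "norm (F' (t, x) p) \<le> DIM(real \<times> (real^2)) * C1 * norm p" for p
        proof (rule linear_bound_of_Basis)
          fix b :: "real \<times> (real^2)" assume "b \<in> Basis"
          then obtain g where "weak_derivative field_domain b E g"
            "AE w in lebesgue_on field_domain. norm (g w) \<le> C1" using C1(2) by blast
          then show "norm (F' (t, x) b) \<le> C1" using 1(5)[of "(t, x)" C1 b g] t C1(1) by simp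
        qed
        then have "norm (F' (t, x) p) \<le> 3 * C1 * norm p" for p by simp
        moreover have "3 * C1 * norm p \<le> M * norm p" for p :: "real \<times> (real^2)"
          using C2(1) by (intro mult_right_mono) (auto simp: M_def)
        ultimately show "norm (F' (t, x) p) \<le> M * norm p" for p using order_trans by blast
        fix i :: "real^2" assume i: "i \<in> Basis"
        have "linear (F'' (0, i) (t, x))" using 1(2) has_derivative_linear by blast
        then have "norm (F'' (0, i) (t, x) p) \<le> DIM(real \<times> (real^2)) * C2 * norm p" for p
        proof (rule linear_bound_of_Basis)
          fix b :: "real \<times> (real^2)" assume "b \<in> Basis"
          moreover have "(0, i) \<in> (Basis :: (real \<times> (real^2)) set)" using i by (simp add: Basis_prod_def)
          ultimately obtain g h where "weak_derivative field_domain b E g"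
            "weak_derivative field_domain (0, i) g h"
            "AE w in lebesgue_on field_domain. norm (h w) \<le> C2" using C2(2) by blast
          then show "norm (F'' (0, i) (t, x) b) \<le> C2"
            using 1(6)[of "(t, x)" C2 b g "(0, i)" h] t C2(1) by simp
        qed
        then have "norm (F'' (0, i) (t, x) p) \<le> 3 * C2 * norm p" for p by simp
        moreover have "3 * C2 * norm p \<le> M * norm p" for p :: "real \<times> (real^2)"
          using C1(1) by (intro mult_right_mono) (auto simp: M_def)
        ultimately show "norm (F'' (0, i) (t, x) p) \<le> M * norm p" for p using order_trans by blast
      qed
    qed
  qed
  then have "bounded_C11_field E B (K\<^sub>x E) M"
    by unfold_locales blast
  then show ?thesis by blast
qed

section \<open>The rotated plane and one step of the scheme\<close>

lemma perp_components [simp]: "perp a $ 1 = - (a $ 2)" "perp a $ 2 = a $ 1"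
  by (simp_all add: perp_def)

lemma linear_perp: "linear perp"
  by (rule linearI) (simp_all add: vec_eq_iff forall_2)

lemma bounded_linear_perp: "bounded_linear perp"
  using linear_perp by (simp add: linear_conv_bounded_linear)

lemma perp_add: "perp (a + b) = perp a + perp b" and perp_diff: "perp (a - b) = perp a - perp b"
  and perp_minus: "perp (- a) = - perp a" and perp_scaleR: "perp (r *\<^sub>R a) = r *\<^sub>R perp a"
  and perp_zero: "perp 0 = 0" and perp_perp: "perp (perp a) = - a"
  by (simp_all add: vec_eq_iff forall_2)

lemmas perp_simps = perp_add perp_diff perp_minus perp_scaleR perp_zero perp_perp

lemma norm_perp [simp]: "norm (perp a) = norm a"
  by (simp add: norm_eq_sqrt_inner inner_vec_def sum_2 add.commute)

lemma inner_perp_self [simp]: "a \<bullet> perp a = 0"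
  by (simp add: inner_vec_def sum_2)

text \<open>The implicit treatment of the rotation is a contraction for every step size, because \<open>a\<close> and
  \<open>a\<^sup>\<bottom>\<close> are orthogonal. This is the source of all bounds uniform in \<open>\<Delta>t / \<epsilon>\<^sup>2\<close>.\<close>

lemma norm_le_norm_add_perp: "norm a \<le> norm (a + r *\<^sub>R perp a)"
proof (cases "a = 0")
  case False
  have "norm a * norm a = a \<bullet> (a + r *\<^sub>R perp a)" by (simp add: inner_add_right dot_square_norm power2_eq_square)
  also have "\<dots> \<le> norm a * norm (a + r *\<^sub>R perp a)" by (rule norm_cauchy_schwarz)
  finally show ?thesis using False by simp
qed simp

text \<open>Since \<open>a\<^sup>\<bottom>\<^sup>\<bottom> = - a\<close>, the map \<open>a \<mapsto> a + r a\<^sup>\<bottom>\<close> is inverted by \<open>b \<mapsto> (b - r b\<^sup>\<bottom>) / (1 + r\<^sup>2)\<close>.\<close>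

lemma implicit_rotation_step_iff:
  "a + r *\<^sub>R perp a = b \<longleftrightarrow> a = (1 / (1 + r\<^sup>2)) *\<^sub>R (b - r *\<^sub>R perp b)"
proof -
  have r: "1 + r\<^sup>2 \<noteq> 0" by (smt (verit) zero_le_power2)
  have "(1 + r\<^sup>2) *\<^sub>R a = b - r *\<^sub>R perp b" if "a + r *\<^sub>R perp a = b"
    unfolding that[symmetric] by (simp add: perp_simps algebra_simps power2_eq_square)
  moreover have "a + r *\<^sub>R perp a = b" if "(1 + r\<^sup>2) *\<^sub>R a = b - r *\<^sub>R perp b"
  proof -
    have "(1 + r\<^sup>2) *\<^sub>R (a + r *\<^sub>R perp a) = (1 + r\<^sup>2) *\<^sub>R a + r *\<^sub>R perp ((1 + r\<^sup>2) *\<^sub>R a)"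
      by (simp add: perp_simps algebra_simps)
    also have "\<dots> = (1 + r\<^sup>2) *\<^sub>R b"
      unfolding that by (simp add: perp_simps algebra_simps power2_eq_square)
    finally show ?thesis using r by simp
  qed
  moreover have "k *\<^sub>R a = c \<longleftrightarrow> a = (1 / k) *\<^sub>R c" if "k \<noteq> 0" for k :: real and c
    using that by auto
  then have "(1 + r\<^sup>2) *\<^sub>R a = c \<longleftrightarrow> a = (1 / (1 + r\<^sup>2)) *\<^sub>R c" for c using r by blast
  ultimately show ?thesis by blast
qed

lemma scheme_step_iff:
  assumes "\<epsilon> > 0" "\<Delta>t > (0::real)"
  shows "(1 / \<Delta>t) *\<^sub>R (v' - v) = (1 / \<epsilon>) *\<^sub>R e - (1 / \<epsilon>\<^sup>2) *\<^sub>R perp v'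
      \<longleftrightarrow> v' + (\<Delta>t / \<epsilon>\<^sup>2) *\<^sub>R perp v' = v + (\<Delta>t / \<epsilon>) *\<^sub>R e"
    and "(1 / \<Delta>t) *\<^sub>R (y' - y) = - perp e \<longleftrightarrow> y' = y - \<Delta>t *\<^sub>R perp e"
proof -
  have eq: "(1 / \<Delta>t) *\<^sub>R a = b \<longleftrightarrow> a = \<Delta>t *\<^sub>R b" for a b :: "real^2" using assms by auto
  show "(1 / \<Delta>t) *\<^sub>R (v' - v) = (1 / \<epsilon>) *\<^sub>R e - (1 / \<epsilon>\<^sup>2) *\<^sub>R perp v'
      \<longleftrightarrow> v' + (\<Delta>t / \<epsilon>\<^sup>2) *\<^sub>R perp v' = v + (\<Delta>t / \<epsilon>) *\<^sub>R e"
    unfolding eq by (simp add: scaleR_diff_right) (auto simp: algebra_simps)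
  show "(1 / \<Delta>t) *\<^sub>R (y' - y) = - perp e \<longleftrightarrow> y' = y - \<Delta>t *\<^sub>R perp e"
    unfolding eq by (auto simp: algebra_simps)
qed

lemma unique_recursive_sequence:
  "\<exists>!f. f 0 = a \<and> (\<forall>n. f (Suc n) = g n (f n))"
proof
  show "rec_nat a g 0 = a \<and> (\<forall>n. rec_nat a g (Suc n) = g n (rec_nat a g n))" by simp
next
  fix f assume f: "f 0 = a \<and> (\<forall>n. f (Suc n) = g n (f n))"
  have "f n = rec_nat a g n" for n by (induction n) (use f in auto)
  then show "f = rec_nat a g" by (rule ext)
qed

lemma scheme_unique_solution:
  assumes "\<epsilon> > 0" "\<Delta>t > 0"
  shows "\<exists>!yv. scheme E \<epsilon> \<Delta>t x0 v0 (fst yv) (snd yv)"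
proof -
  define r where "r = \<Delta>t / \<epsilon>\<^sup>2"
  define V where "V n p = (let b = snd p + (\<Delta>t / \<epsilon>) *\<^sub>R E (real n * \<Delta>t, fst p + \<epsilon> *\<^sub>R perp (snd p))
    in (1 / (1 + r\<^sup>2)) *\<^sub>R (b - r *\<^sub>R perp b))" for n p
  define g where "g n p = (fst p - \<Delta>t *\<^sub>R perp (E (real n * \<Delta>t, fst p + \<epsilon> *\<^sub>R perp (V n p))), V n p)" for n p
  define a where "a = (x0 - \<epsilon> *\<^sub>R perp v0, v0)"
  have iff: "scheme E \<epsilon> \<Delta>t x0 v0 y v \<longleftrightarrow>
      (y 0, v 0) = a \<and> (\<forall>n. (y (Suc n), v (Suc n)) = g n (y n, v n))" for y v
    unfolding scheme_def scheme_step_iff[OF assms] implicit_rotation_step_iff[of _ "\<Delta>t / \<epsilon>\<^sup>2"]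
    by (auto simp: a_def g_def V_def r_def Let_def)
  obtain f where f: "f 0 = a" "\<And>n. f (Suc n) = g n (f n)"
    and unique: "\<And>h. h 0 = a \<Longrightarrow> (\<And>n. h (Suc n) = g n (h n)) \<Longrightarrow> h = f"
    using unique_recursive_sequence[of a g] by metis
  show ?thesis
  proof
    show "scheme E \<epsilon> \<Delta>t x0 v0 (fst (\<lambda>n. fst (f n), \<lambda>n. snd (f n))) (snd (\<lambda>n. fst (f n), \<lambda>n. snd (f n)))"
      using f by (simp add: iff)
  next
    fix yv assume "scheme E \<epsilon> \<Delta>t x0 v0 (fst yv) (snd yv)"
    then have "(\<lambda>n. (fst yv n, snd yv n)) = f" using unique[of "\<lambda>n. (fst yv n, snd yv n)"] by (simp add: iff)
    then have "fst yv n = fst (f n)" "snd yv n = snd (f n)" for n by (metis fst_conv snd_conv)+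
    then show "yv = (\<lambda>n. fst (f n), \<lambda>n. snd (f n))" by (simp add: prod_eq_iff fun_eq_iff)
  qed
qed

section \<open>Gronwall inequalities\<close>

text \<open>The form in which all local truncation errors are estimated: \<open>c\<close> is the frozen increment of the
  scheme, \<open>f'\<close> the true velocity.\<close>

lemma vector_derivative_bound:
  fixes f :: "real \<Rightarrow> 'a::real_normed_vector"
  assumes d: "\<And>s. a \<le> s \<Longrightarrow> s \<le> b \<Longrightarrow> (f has_vector_derivative f' s) (at s within {0..})"
    and bd: "\<And>s. a \<le> s \<Longrightarrow> s \<le> b \<Longrightarrow> norm (f' s - c) \<le> C" and ab: "0 \<le> a" "a \<le> b"
  shows "norm (f b - f a - (b - a) *\<^sub>R c) \<le> C * (b - a)"
proof -
  define g where "g s = f s - s *\<^sub>R c" for s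
  have "norm (g b - g a) \<le> C * norm (b - a)"
  proof (rule differentiable_bound[of "{a..b}" g "\<lambda>s h. h *\<^sub>R (f' s - c)"])
    fix s assume s: "s \<in> {a..b}"
    have "(g has_vector_derivative f' s - c) (at s within {0..})"
      unfolding g_def by (auto intro!: derivative_eq_intros d simp: s[simplified])
    then have "(g has_vector_derivative f' s - c) (at s within {a..b})"
      by (rule has_vector_derivative_within_subset) (use ab in auto)
    then show "(g has_derivative (\<lambda>h. h *\<^sub>R (f' s - c))) (at s within {a..b})"
      by (simp add: has_vector_derivative_def)
    have bs: "norm (f' s - c) \<le> C" using bd s by simp
    show "onorm (\<lambda>h. h *\<^sub>R (f' s - c)) \<le> C"
    proof (rule onorm_bound)
      show "norm (h *\<^sub>R (f' s - c)) \<le> C * norm h" for h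
        using mult_right_mono[OF bs abs_ge_zero[of h]] by (simp add: mult.commute)
    qed (use bs order_trans[OF norm_ge_zero] in blast)
  qed (use ab in auto)
  then show ?thesis using ab by (simp add: g_def algebra_simps)
qed

text \<open>Only the component of \<open>w'\<close> along \<open>w\<close> enters, so a rotation term in \<open>w'\<close>, however fast, is
  invisible. The norm is not differentiable at zero and is replaced by \<open>sqrt (\<bar>w\<bar>\<^sup>2 + \<eta>\<^sup>2)\<close>.\<close>

lemma gronwall_norm:
  fixes w :: "real \<Rightarrow> 'a::real_inner"
  assumes d: "\<And>s. s \<ge> 0 \<Longrightarrow> (w has_vector_derivative w' s) (at s within {0..})"
    and le: "\<And>s. s \<ge> 0 \<Longrightarrow> w s \<bullet> w' s \<le> norm (w s) * (K * norm (w s) + c)"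
    and "K \<ge> 0" "c \<ge> 0" "t \<ge> 0"
  shows "norm (w t) \<le> (norm (w 0) + c * t) * exp (K * t)"
proof (rule field_le_epsilon)
  fix e :: real assume "e > 0"
  \<comment> \<open>chosen so that the regularisation costs exactly \<open>e\<close> at time \<open>t\<close>\<close>
  define \<eta> where "\<eta> = e * exp (- K * t)"
  have \<eta>: "\<eta> > 0" using \<open>e > 0\<close> by (simp add: \<eta>_def)
  define g where "g s = sqrt (w s \<bullet> w s + \<eta>\<^sup>2)" for s
  define G where "G s = g s * exp (- K * s) - c * s" for s
  have pos: "w s \<bullet> w s + \<eta>\<^sup>2 > 0" for s using \<eta> by (simp add: add_nonneg_pos)
  have g_pos: "g s > 0" for s unfolding g_def using pos by simp
  have norm_le_g: "norm (w s) \<le> g s" for s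
    unfolding g_def norm_eq_sqrt_inner by (rule real_sqrt_le_mono) simp
  have dG: "(G has_real_derivative ((w s \<bullet> w' s / g s - K * g s) * exp (- K * s) - c)) (at s within {0..})"
    if "s \<ge> 0" for s
  proof -
    have "((\<lambda>s. w s \<bullet> w s) has_real_derivative (2 * (w s \<bullet> w' s))) (at s within {0..})"
      using d[OF that] unfolding has_vector_derivative_def has_field_derivative_def
      by (auto intro!: derivative_eq_intros simp: fun_eq_iff inner_commute)
    then have "(g has_real_derivative (w s \<bullet> w' s / g s)) (at s within {0..})"
      unfolding g_def using pos[of s]
      by (auto intro!: derivative_eq_intros simp: field_simps)
    then show ?thesis unfolding G_def
      by (auto intro!: derivative_eq_intros simp: algebra_simps)
  qed
  have dG_le: "(w s \<bullet> w' s / g s - K * g s) * exp (- K * s) - c \<le> 0" if "s \<ge> 0" for s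
  proof -
    have "w s \<bullet> w' s \<le> g s * (K * g s + c)"
      using le[OF that] norm_le_g[of s] g_pos[of s] assms(3,4)
      by (elim order_trans) (intro mult_mono add_mono mult_left_mono, auto)
    then have "w s \<bullet> w' s / g s - K * g s \<le> c"
      using g_pos[of s] by (simp add: field_simps)
    then have "(w s \<bullet> w' s / g s - K * g s) * exp (- K * s) \<le> c * exp (- K * s)"
      by (rule mult_right_mono) simp
    also have "\<dots> \<le> c * 1"
      using assms(3,4) that by (intro mult_left_mono) auto
    finally show ?thesis by simp
  qed
  have "G t \<le> G 0"
  proof (rule DERIV_nonpos_imp_decreasing_open[OF \<open>t \<ge> 0\<close>])
    fix s assume s: "0 < s" "s < t"
    have "at s within {0..} = at s" using s by (intro at_within_interior) auto
    then show "\<exists>y. (G has_real_derivative y) (at s) \<and> y \<le> 0" using dG[of s] dG_le[of s] s by auto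
  next
    have "continuous_on {0..} G"
      using dG by (intro DERIV_continuous_on[where D="\<lambda>s. (w s \<bullet> w' s / g s - K * g s) * exp (- K * s) - c"]) auto
    then show "continuous_on {0..t} G" by (rule continuous_on_subset) auto
  qed
  then have "g t * exp (- K * t) \<le> g 0 + c * t" by (simp add: G_def)
  then have "g t * exp (- K * t) * exp (K * t) \<le> (g 0 + c * t) * exp (K * t)"
    by (rule mult_right_mono) simp
  then have "g t \<le> (g 0 + c * t) * exp (K * t)" by (simp add: mult.assoc flip: exp_add)
  moreover have "g 0 \<le> norm (w 0) + \<eta>"
    unfolding g_def using sqrt_add_le_add_sqrt[of "w 0 \<bullet> w 0" "\<eta>\<^sup>2"] \<eta>
    by (simp add: norm_eq_sqrt_inner)
  ultimately have "norm (w t) \<le> (norm (w 0) + \<eta> + c * t) * exp (K * t)"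
    using norm_le_g[of t] by (smt (verit) exp_ge_zero mult_right_mono)
  also have "\<dots> = (norm (w 0) + c * t) * exp (K * t) + \<eta> * exp (K * t)" by (simp add: algebra_simps)
  also have "\<eta> * exp (K * t) = e" by (simp add: \<eta>_def mult.assoc flip: exp_add)
  finally show "norm (w t) \<le> (norm (w 0) + c * t) * exp (K * t) + e" .
qed

text \<open>The forcing grows at the same rate as the homogeneous solution. This is the situation below, where
  the local errors contain the velocity, and it produces a factor \<open>n\<close> in place of a faster rate.\<close>

lemma discrete_gronwall:
  fixes a :: "nat \<Rightarrow> real"
  assumes "\<And>n. n < N \<Longrightarrow> a (Suc n) \<le> q * a n + d * q ^ Suc n" and "q \<ge> 0"
  shows "n \<le> N \<Longrightarrow> a n \<le> (a 0 + real n * d) * q ^ n"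
proof (induction n)
  case (Suc n)
  have "a (Suc n) \<le> q * a n + d * q ^ Suc n" using assms(1) Suc.prems by simp
  also have "\<dots> \<le> q * ((a 0 + real n * d) * q ^ n) + d * q ^ Suc n"
    using Suc assms(2) by (intro add_right_mono mult_left_mono) auto
  finally show ?case by (simp add: algebra_simps)
qed simp

lemma one_plus_power_bounds:
  fixes T :: real
  assumes "T \<ge> 0"
  shows "(1 + T) ^ 3 \<le> 4 * (1 + T ^ 3)" "(1 + T) ^ 4 \<le> 8 * (1 + T ^ 4)"
proof -
  have "0 \<le> 3 * (1 - T)\<^sup>2 * (1 + T)" using assms by simp
  also have "\<dots> = 4 * (1 + T ^ 3) - (1 + T) ^ 3"
    by (simp add: algebra_simps power2_eq_square power3_eq_cube)
  finally show "(1 + T) ^ 3 \<le> 4 * (1 + T ^ 3)" by simp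
  have "0 \<le> (1 - T) ^ 4 + 6 * (1 - T\<^sup>2)\<^sup>2" by simp
  also have "\<dots> = 8 * (1 + T ^ 4) - (1 + T) ^ 4 - (1 - 1)"
    by (simp add: algebra_simps power2_eq_square power4_eq_xxxx)
  finally show "(1 + T) ^ 4 \<le> 8 * (1 + T ^ 4)" by simp
qed

section \<open>Velocity bounds\<close>

context bounded_lipschitz_field
begin

text \<open>A constant large enough for both velocity bounds.\<close>

definition c\<^sub>v :: real where "c\<^sub>v = 1 + 3 * B + B\<^sup>2 + 2 * K * B"

lemma B_nonneg: "B \<ge> 0"
  using field_bound[of 0 0] norm_ge_zero order_trans by blast

lemma c\<^sub>v_nonneg: "c\<^sub>v \<ge> 0" unfolding c\<^sub>v_def using B_nonneg K_nonneg by simp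

text \<open>The constants of the three final estimates depend on the field alone, not on the trajectories.\<close>

definition conv_const :: real where
  "conv_const = 3 * B + 2 * K * B + (2 * K + 1) * (1 + c\<^sub>v)"

definition asym_const :: real where
  "asym_const = B * (1 + K) + (2 * K + 2) * (1 + c\<^sub>v)"

lemma conv_const_nonneg: "conv_const \<ge> 0" and asym_const_nonneg: "asym_const \<ge> 0"
  using B_nonneg K_nonneg c\<^sub>v_nonneg by (simp_all add: conv_const_def asym_const_def)

end

locale scheme_and_flow = bounded_lipschitz_field +
  fixes \<epsilon> \<Delta>t :: real and x0 v0 :: "real^2" and yn vn :: "nat \<Rightarrow> real^2" and x v :: "real \<Rightarrow> real^2"
  assumes eps: "\<epsilon> > 0" and dt: "\<Delta>t > 0"
    and scheme: "scheme E \<epsilon> \<Delta>t x0 v0 yn vn" and exact: "exact_solution E \<epsilon> x0 v0 x v"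
begin

definition y :: "real \<Rightarrow> real^2" where "y t = x t - \<epsilon> *\<^sub>R perp (v t)"
definition t\<^sub>n :: "nat \<Rightarrow> real" where "t\<^sub>n n = real n * \<Delta>t"

text \<open>The amplification factor per step, \<open>exp (K \<Delta>t) \<ge> 1 + K \<Delta>t\<close>; its powers are the values of \<open>exp (K t)\<close>
  on the grid, so one factor measures growth for the flow and for the scheme.\<close>

definition q :: real where "q = exp (K * \<Delta>t)"

text \<open>The velocity bounds of the flow and of the scheme without their exponential factor.\<close>

definition V :: "real \<Rightarrow> real" where "V T = norm v0 + c\<^sub>v * \<epsilon> * (1 + T)"

lemma V_mono: "s \<le> t \<Longrightarrow> V s \<le> V t"
  unfolding V_def using c\<^sub>v_nonneg eps by (intro add_left_mono mult_left_mono) auto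

lemma V_nonneg: "T \<ge> 0 \<Longrightarrow> V T \<ge> 0"
  unfolding V_def using c\<^sub>v_nonneg eps by simp

lemma t\<^sub>n_nonneg [simp]: "t\<^sub>n n \<ge> 0" and t\<^sub>n_0 [simp]: "t\<^sub>n 0 = 0"
  and t\<^sub>n_Suc: "t\<^sub>n (Suc n) = t\<^sub>n n + \<Delta>t" and t\<^sub>n_mono: "m \<le> n \<Longrightarrow> t\<^sub>n m \<le> t\<^sub>n n"
  using dt by (auto simp: t\<^sub>n_def algebra_simps)

lemma q_pow: "q ^ n = exp (K * t\<^sub>n n)"
  by (simp add: q_def t\<^sub>n_def mult.left_commute flip: exp_of_nat_mult)

lemma q_ge: "1 + K * \<Delta>t \<le> q" unfolding q_def by (rule exp_ge_add_one_self)

lemma q_ge_1: "1 \<le> q" using q_ge K_nonneg dt by (smt (verit) mult_nonneg_nonneg)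

lemma q_pow_ge_1: "1 \<le> q ^ n" using q_ge_1 by (rule one_le_power)

lemma yn_0: "yn 0 = y 0" and vn_0: "vn 0 = v0" and v_0: "v 0 = v0"
  using scheme exact by (auto simp: scheme_def exact_solution_def y_def)

lemma yn_Suc: "yn (Suc n) = yn n - \<Delta>t *\<^sub>R perp (E (t\<^sub>n n, yn n + \<epsilon> *\<^sub>R perp (vn (Suc n))))"
  and vn_Suc: "vn (Suc n) + (\<Delta>t / \<epsilon>\<^sup>2) *\<^sub>R perp (vn (Suc n))
    = vn n + (\<Delta>t / \<epsilon>) *\<^sub>R E (t\<^sub>n n, yn n + \<epsilon> *\<^sub>R perp (vn n))"
  using scheme unfolding scheme_def scheme_step_iff[OF eps dt] t\<^sub>n_def by blast+

lemma x_eq: "x t = y t + \<epsilon> *\<^sub>R perp (v t)" by (simp add: y_def)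

lemma
  assumes "t \<ge> 0"
  shows x_deriv: "(x has_vector_derivative (1 / \<epsilon>) *\<^sub>R v t) (at t within {0..})"
    and v_deriv: "(v has_vector_derivative ((1 / \<epsilon>) *\<^sub>R E (t, x t) - (1 / \<epsilon>\<^sup>2) *\<^sub>R perp (v t))) (at t within {0..})"
    and y_deriv: "(y has_vector_derivative - perp (E (t, x t))) (at t within {0..})"
proof -
  obtain x' v' where x': "(x has_vector_derivative x') (at t within {0..})"
    and v': "(v has_vector_derivative v') (at t within {0..})"
    and eq: "\<epsilon> *\<^sub>R x' = v t" "\<epsilon> *\<^sub>R v' = E (t, x t) - (1 / \<epsilon>) *\<^sub>R perp (v t)"
    using exact assms unfolding exact_solution_def by blast
  have x'_eq: "x' = (1 / \<epsilon>) *\<^sub>R v t" unfolding eq(1)[symmetric] using eps by simp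
  have "v' = (1 / \<epsilon>) *\<^sub>R (\<epsilon> *\<^sub>R v')" using eps by simp
  then have v'_eq: "v' = (1 / \<epsilon>) *\<^sub>R E (t, x t) - (1 / \<epsilon>\<^sup>2) *\<^sub>R perp (v t)"
    unfolding eq(2) by (simp add: scaleR_diff_right power2_eq_square)
  show "(x has_vector_derivative (1 / \<epsilon>) *\<^sub>R v t) (at t within {0..})" using x' x'_eq by simp
  show "(v has_vector_derivative ((1 / \<epsilon>) *\<^sub>R E (t, x t) - (1 / \<epsilon>\<^sup>2) *\<^sub>R perp (v t))) (at t within {0..})"
    using v' v'_eq by simp
  have "(y has_vector_derivative x' - \<epsilon> *\<^sub>R perp v') (at t within {0..})"
    unfolding y_def
    by (intro has_vector_derivative_diff x'
        bounded_linear.has_vector_derivative[OF bounded_linear_scaleR_right]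
        bounded_linear.has_vector_derivative[OF bounded_linear_perp] v')
  moreover have "x' - \<epsilon> *\<^sub>R perp v' = - perp (E (t, x t))"
    unfolding x'_eq v'_eq using eps by (simp add: perp_simps algebra_simps power2_eq_square)
  ultimately show "(y has_vector_derivative - perp (E (t, x t))) (at t within {0..})" by simp
qed

lemma y_lipschitz: "0 \<le> a \<Longrightarrow> a \<le> b \<Longrightarrow> norm (y b - y a) \<le> B * (b - a)"
  using vector_derivative_bound[of a b y "\<lambda>t. - perp (E (t, x t))" 0 B] y_deriv field_bound by simp

lemma field_difference:
  assumes "0 \<le> s" "0 \<le> t"
  shows "norm (E (s, a) - E (t, b)) \<le> B * \<bar>s - t\<bar> + K * norm (a - b)"
  using norm_triangle_ineq[of "E (s, a) - E (t, a)" "E (t, a) - E (t, b)"]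
    time_lipschitz[OF assms, of a] space_lipschitz[OF assms(2), of a b] by simp

text \<open>Gronwall for \<open>v + \<epsilon> E(t, y)\<^sup>\<bottom>\<close>, with \<open>E\<close> mollified at distance \<open>\<epsilon>\<^sup>2\<close>: the forcing divides this
  error by \<open>\<epsilon>\<close>, which leaves the order \<open>\<epsilon>\<close> of the other forcing terms.\<close>

lemma exact_velocity_bound:
  assumes "t \<ge> 0"
  shows "norm (v t) \<le> V t * exp (K * t)"
proof -
  have "\<epsilon>\<^sup>2 > 0" using eps by simp
  from C1_approximation[OF this] obtain F F' where F: "\<And>z. (F has_derivative F' z) (at z)"
    and F_close: "\<And>t x. t \<ge> 0 \<Longrightarrow> norm (F (t, x) - E (t, x)) \<le> \<epsilon>\<^sup>2"
    and F_bound: "\<And>t x. t \<ge> 0 \<Longrightarrow> norm (F (t, x)) \<le> B"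
    and F'_bound: "\<And>t x d. t \<ge> 0 \<Longrightarrow> norm (F' (t, x) d) \<le> B * norm d"
    by blast
  define w where "w s = v s + \<epsilon> *\<^sub>R perp (F (s, y s))" for s
  define f where "f s = F' (s, y s) (1, - perp (E (s, x s)))" for s
  define w' where "w' s = (1 / \<epsilon>) *\<^sub>R (E (s, x s) - F (s, y s)) - (1 / \<epsilon>\<^sup>2) *\<^sub>R perp (w s) + \<epsilon> *\<^sub>R perp (f s)" for s
  define c where "c = \<epsilon> * (K * B + 1 + B + B\<^sup>2)"
  have v_le: "norm (v s) \<le> norm (w s) + \<epsilon> * B" and w_le: "norm (w s) \<le> norm (v s) + \<epsilon> * B"
    if "s \<ge> 0" for s
  proof -
    have "norm (\<epsilon> *\<^sub>R perp (F (s, y s))) \<le> \<epsilon> * B"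
      using F_bound[OF that] eps by simp
    then show "norm (v s) \<le> norm (w s) + \<epsilon> * B" "norm (w s) \<le> norm (v s) + \<epsilon> * B"
      unfolding w_def by (smt (verit) norm_triangle_ineq norm_triangle_ineq4 add_diff_cancel_right')+
  qed
  have "norm (w t) \<le> (norm (w 0) + c * t) * exp (K * t)"
  proof (rule gronwall_norm)
    fix s :: real assume s: "s \<ge> 0"
    have "((\<lambda>s. F (s, y s)) has_vector_derivative f s) (at s within {0..})"
    proof -
      have "((\<lambda>s. (s, y s)) has_vector_derivative (1, - perp (E (s, x s)))) (at s within {0..})"
        by (intro has_vector_derivative_Pair y_deriv s has_vector_derivative_id)
      from has_derivative_compose[OF this[unfolded has_vector_derivative_def] F]
      show ?thesis
        using has_derivative_linear[OF F, of "(s, y s)"]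
        unfolding has_vector_derivative_def f_def by (simp only: linear_scale)
    qed
    then have "(w has_vector_derivative
        ((1 / \<epsilon>) *\<^sub>R E (s, x s) - (1 / \<epsilon>\<^sup>2) *\<^sub>R perp (v s)) + \<epsilon> *\<^sub>R perp (f s)) (at s within {0..})"
      unfolding w_def
      by (intro has_vector_derivative_add v_deriv s
          bounded_linear.has_vector_derivative[OF bounded_linear_scaleR_right]
          bounded_linear.has_vector_derivative[OF bounded_linear_perp])
    moreover have "((1 / \<epsilon>) *\<^sub>R E (s, x s) - (1 / \<epsilon>\<^sup>2) *\<^sub>R perp (v s)) + \<epsilon> *\<^sub>R perp (f s) = w' s"
      unfolding w'_def w_def using eps by (simp add: perp_simps algebra_simps power2_eq_square)
    ultimately show "(w has_vector_derivative w' s) (at s within {0..})" by simp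
    have "norm (E (s, x s) - F (s, y s)) \<le> norm (E (s, x s) - E (s, y s)) + norm (F (s, y s) - E (s, y s))"
      by (smt (verit) norm_triangle_ineq4 diff_diff_eq2 diff_add_cancel)
    also have "\<dots> \<le> K * (\<epsilon> * norm (v s)) + \<epsilon>\<^sup>2"
      using space_lipschitz[OF s, of "x s" "y s"] F_close[OF s] eps
      by (intro add_mono) (auto simp: x_eq)
    finally have "norm (E (s, x s) - F (s, y s)) / \<epsilon> \<le> (K * (\<epsilon> * norm (v s)) + \<epsilon>\<^sup>2) / \<epsilon>"
      using eps by (intro divide_right_mono) auto
    also have "\<dots> = K * norm (v s) + \<epsilon>" using eps by (simp add: field_simps power2_eq_square)
    finally have 1: "norm ((1 / \<epsilon>) *\<^sub>R (E (s, x s) - F (s, y s))) \<le> K * norm (v s) + \<epsilon>"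
      using eps by simp
    have "norm (1 :: real, - perp (E (s, x s))) \<le> 1 + B"
      using norm_Pair_le[of "1::real" "- perp (E (s, x s))"] field_bound[OF s] by (smt (verit) norm_minus_cancel norm_one norm_perp)
    then have "norm (f s) \<le> B * (1 + B)"
      unfolding f_def using F'_bound[OF s] B_nonneg by (meson mult_left_mono order_trans)
    then have "\<epsilon> * norm (f s) \<le> \<epsilon> * (B * (1 + B))" using eps by (intro mult_left_mono) auto
    then have 2: "norm (\<epsilon> *\<^sub>R perp (f s)) \<le> \<epsilon> * (B + B\<^sup>2)"
      using eps by (simp add: distrib_left power2_eq_square)
    have "w s \<bullet> w' s = w s \<bullet> ((1 / \<epsilon>) *\<^sub>R (E (s, x s) - F (s, y s)) + \<epsilon> *\<^sub>R perp (f s))"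
      unfolding w'_def by (simp add: inner_diff_right inner_add_right)
    also have "\<dots> \<le> norm (w s) * norm ((1 / \<epsilon>) *\<^sub>R (E (s, x s) - F (s, y s)) + \<epsilon> *\<^sub>R perp (f s))"
      by (rule norm_cauchy_schwarz)
    also have "\<dots> \<le> norm (w s) * ((K * norm (v s) + \<epsilon>) + \<epsilon> * (B + B\<^sup>2))"
      by (intro mult_left_mono order_trans[OF norm_triangle_ineq add_mono[OF 1 2]]) simp
    also have "\<dots> \<le> norm (w s) * ((K * (norm (w s) + \<epsilon> * B) + \<epsilon>) + \<epsilon> * (B + B\<^sup>2))"
      using v_le[OF s] K_nonneg eps B_nonneg by (intro mult_left_mono add_mono) auto
    also have "\<dots> = norm (w s) * (K * norm (w s) + c)" by (simp add: c_def algebra_simps)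
    finally show "w s \<bullet> w' s \<le> norm (w s) * (K * norm (w s) + c)" .
  qed (use assms K_nonneg B_nonneg eps in \<open>auto simp: c_def\<close>)
  moreover have "norm (w 0) \<le> norm v0 + \<epsilon> * B" using w_le[of 0] v_0 by simp
  moreover have "norm (v t) \<le> norm (w t) + \<epsilon> * B * exp (K * t)"
  proof -
    have "\<epsilon> * B * 1 \<le> \<epsilon> * B * exp (K * t)"
      using assms K_nonneg eps B_nonneg by (intro mult_left_mono) auto
    then show ?thesis using v_le[OF assms] by simp
  qed
  ultimately have "norm (v t) \<le> (norm v0 + \<epsilon> * B + c * t) * exp (K * t) + \<epsilon> * B * exp (K * t)"
    by (smt (verit) exp_ge_zero mult_right_mono)
  also have "\<dots> = (norm v0 + 2 * \<epsilon> * B + c * t) * exp (K * t)" by (simp add: algebra_simps)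
  also have "\<dots> \<le> V t * exp (K * t)"
  proof (rule mult_right_mono)
    have "2 * B * \<epsilon> \<le> c\<^sub>v * \<epsilon>" "(K * B + 1 + B + B\<^sup>2) * (\<epsilon> * t) \<le> c\<^sub>v * (\<epsilon> * t)"
      using B_nonneg K_nonneg eps assms by (auto simp: c\<^sub>v_def intro!: mult_right_mono)
    then show "norm v0 + 2 * \<epsilon> * B + c * t \<le> V t"
      unfolding V_def c_def by (simp add: algebra_simps)
  qed simp
  finally show ?thesis .
qed

text \<open>The vector \<open>-\<epsilon> E\<^sup>\<bottom>\<close> is a fixed point of the velocity step with frozen field \<open>E\<close>, so the step acts
  on \<open>v + \<epsilon> E\<^sup>\<bottom>\<close> as a contraction up to the variation of \<open>E\<close> along the slow variable.\<close>

lemma discrete_velocity_bound: "norm (vn n) \<le> V (t\<^sub>n n) * q ^ n"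
proof -
  define w where "w n = norm (vn n + \<epsilon> *\<^sub>R perp (E (t\<^sub>n n, yn n)))" for n
  define c where "c = \<epsilon> * (B + 2 * K * B)"
  have v_le: "norm (vn n) \<le> w n + \<epsilon> * B" and w_le: "w n \<le> norm (vn n) + \<epsilon> * B" for n
  proof -
    have "norm (\<epsilon> *\<^sub>R perp (E (t\<^sub>n n, yn n))) \<le> \<epsilon> * B"
      using field_bound[of "t\<^sub>n n"] eps by simp
    then show "norm (vn n) \<le> w n + \<epsilon> * B" "w n \<le> norm (vn n) + \<epsilon> * B"
      unfolding w_def by (smt (verit) norm_triangle_ineq norm_triangle_ineq4 add_diff_cancel_right')+
  qed
  have c: "c \<ge> 0" using eps B_nonneg K_nonneg by (simp add: c_def)
  have step: "w (Suc n) \<le> q * w n + (c * \<Delta>t) * q ^ Suc n" for n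
  proof -
    let ?E = "E (t\<^sub>n n, yn n)" and ?Ex = "E (t\<^sub>n n, yn n + \<epsilon> *\<^sub>R perp (vn n))"
    let ?E' = "E (t\<^sub>n (Suc n), yn (Suc n))"
    let ?u = "vn (Suc n) + \<epsilon> *\<^sub>R perp ?E"
    have "norm ?u \<le> norm (?u + (\<Delta>t / \<epsilon>\<^sup>2) *\<^sub>R perp ?u)" by (rule norm_le_norm_add_perp)
    also have "?u + (\<Delta>t / \<epsilon>\<^sup>2) *\<^sub>R perp ?u
        = (vn (Suc n) + (\<Delta>t / \<epsilon>\<^sup>2) *\<^sub>R perp (vn (Suc n))) + \<epsilon> *\<^sub>R perp ?E - (\<Delta>t / \<epsilon>) *\<^sub>R ?E"
      using eps by (simp add: perp_simps algebra_simps power2_eq_square)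
    also have "\<dots> = (vn n + \<epsilon> *\<^sub>R perp ?E) + (\<Delta>t / \<epsilon>) *\<^sub>R (?Ex - ?E)"
      unfolding vn_Suc by (simp add: algebra_simps)
    also have "norm \<dots> \<le> w n + (\<Delta>t / \<epsilon>) * norm (?Ex - ?E)"
      unfolding w_def using dt eps by (intro order_trans[OF norm_triangle_ineq]) simp
    also have "\<dots> \<le> w n + (\<Delta>t / \<epsilon>) * (K * (\<epsilon> * norm (vn n)))"
      using space_lipschitz[of "t\<^sub>n n" "yn n + \<epsilon> *\<^sub>R perp (vn n)" "yn n"] dt eps
      by (intro add_left_mono mult_left_mono) auto
    also have "\<dots> = w n + K * \<Delta>t * norm (vn n)" using eps by (simp add: field_simps)
    also have "\<dots> \<le> w n + K * \<Delta>t * (w n + \<epsilon> * B)"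
      using v_le K_nonneg dt by (intro add_left_mono mult_left_mono) auto
    finally have 1: "norm ?u \<le> w n + K * \<Delta>t * (w n + \<epsilon> * B)" .
    have "norm (yn (Suc n) - yn n) \<le> \<Delta>t * B"
      unfolding yn_Suc using field_bound[of "t\<^sub>n n"] dt by simp
    then have "norm (?E' - ?E) \<le> B * \<Delta>t + K * (\<Delta>t * B)"
      using field_difference[of "t\<^sub>n (Suc n)" "t\<^sub>n n" "yn (Suc n)" "yn n"] dt
        mult_left_mono[OF _ K_nonneg] by (fastforce simp: t\<^sub>n_Suc)
    then have 2: "norm (\<epsilon> *\<^sub>R perp (?E' - ?E)) \<le> \<epsilon> * (B * \<Delta>t + K * (\<Delta>t * B))"
      using eps by simp
    have "w (Suc n) = norm (?u + \<epsilon> *\<^sub>R perp (?E' - ?E))"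
      unfolding w_def by (simp add: perp_simps algebra_simps)
    also have "\<dots> \<le> w n + K * \<Delta>t * (w n + \<epsilon> * B) + \<epsilon> * (B * \<Delta>t + K * (\<Delta>t * B))"
      by (rule order_trans[OF norm_triangle_ineq add_mono[OF 1 2]])
    also have "\<dots> = (1 + K * \<Delta>t) * w n + c * \<Delta>t * 1" by (simp add: c_def algebra_simps)
    also have "\<dots> \<le> q * w n + c * \<Delta>t * q ^ Suc n"
      using q_ge q_pow_ge_1[of "Suc n"] c dt
      by (intro add_mono mult_right_mono mult_left_mono) (auto simp: w_def)
    finally show ?thesis .
  qed
  have "w n \<le> (w 0 + real n * (c * \<Delta>t)) * q ^ n"
    by (rule discrete_gronwall[of n]) (use step q_ge_1 in auto)
  also have "\<dots> \<le> (norm v0 + \<epsilon> * B + c * t\<^sub>n n) * q ^ n"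
    using w_le[of 0] vn_0 q_ge_1 by (intro mult_right_mono) (auto simp: t\<^sub>n_def algebra_simps)
  finally have "norm (vn n) \<le> (norm v0 + \<epsilon> * B + c * t\<^sub>n n) * q ^ n + \<epsilon> * B * 1"
    using v_le[of n] by simp
  also have "\<dots> \<le> (norm v0 + \<epsilon> * B + c * t\<^sub>n n) * q ^ n + \<epsilon> * B * q ^ n"
    using q_pow_ge_1 eps B_nonneg by (intro add_left_mono mult_left_mono) auto
  also have "\<dots> = (norm v0 + 2 * \<epsilon> * B + c * t\<^sub>n n) * q ^ n" by (simp add: algebra_simps)
  also have "\<dots> \<le> V (t\<^sub>n n) * q ^ n"
  proof (rule mult_right_mono)
    have "2 * B * \<epsilon> \<le> c\<^sub>v * \<epsilon>" "(B + 2 * K * B) * (\<epsilon> * t\<^sub>n n) \<le> c\<^sub>v * (\<epsilon> * t\<^sub>n n)"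
      using B_nonneg K_nonneg eps by (auto simp: c\<^sub>v_def intro!: mult_right_mono)
    then show "norm v0 + 2 * \<epsilon> * B + c * t\<^sub>n n \<le> V (t\<^sub>n n)"
      unfolding V_def c_def by (simp add: algebra_simps)
  qed (use q_ge_1 in simp)
  finally show ?thesis .
qed

section \<open>First-order comparison of scheme and flow\<close>

lemma exact_speed_in_step:
  assumes "Suc n \<le> N" "t\<^sub>n n \<le> s" "s \<le> t\<^sub>n (Suc n)"
  shows "norm (v s) \<le> V (t\<^sub>n N) * q ^ Suc n"
proof -
  have s: "0 \<le> s" "s \<le> t\<^sub>n N" using assms t\<^sub>n_nonneg[of n] t\<^sub>n_mono[of "Suc n" N] by linarith+
  have "norm (v s) \<le> V s * exp (K * s)" by (rule exact_velocity_bound[OF s(1)])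
  also have "\<dots> \<le> V (t\<^sub>n N) * exp (K * t\<^sub>n (Suc n))"
    using assms(3) s K_nonneg by (intro mult_mono V_mono V_nonneg) (auto intro: mult_left_mono)
  finally show ?thesis by (simp only: q_pow)
qed

lemma discrete_speed_le:
  assumes "n \<le> N"
  shows "norm (vn n) \<le> V (t\<^sub>n N) * q ^ n"
proof -
  have "V (t\<^sub>n n) * q ^ n \<le> V (t\<^sub>n N) * q ^ n"
    using V_mono[OF t\<^sub>n_mono[OF assms]] q_ge_1 by (intro mult_right_mono) auto
  then show ?thesis using discrete_velocity_bound[of n] by linarith
qed

text \<open>Comparison of the flow over one step with an Euler step whose field is frozen at an arbitrary
  point \<open>p\<close>. The two error estimates below differ in the choice of \<open>p\<close>.\<close>

lemma exact_step:
  assumes "\<And>s. t\<^sub>n n \<le> s \<Longrightarrow> s \<le> t\<^sub>n (Suc n) \<Longrightarrow> norm (E (s, x s) - E (t\<^sub>n n, p)) \<le> C"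
  shows "norm (y (t\<^sub>n (Suc n)) - y (t\<^sub>n n) + \<Delta>t *\<^sub>R perp (E (t\<^sub>n n, p))) \<le> C * \<Delta>t"
proof -
  have "norm (y (t\<^sub>n (Suc n)) - y (t\<^sub>n n) - (t\<^sub>n (Suc n) - t\<^sub>n n) *\<^sub>R (- perp (E (t\<^sub>n n, p))))
      \<le> C * (t\<^sub>n (Suc n) - t\<^sub>n n)"
  proof (rule vector_derivative_bound)
    fix s assume s: "t\<^sub>n n \<le> s" "s \<le> t\<^sub>n (Suc n)"
    have "0 \<le> s" using s t\<^sub>n_nonneg[of n] by linarith
    then show "(y has_vector_derivative - perp (E (s, x s))) (at s within {0..})" by (rule y_deriv)
    have "- perp (E (s, x s)) - - perp (E (t\<^sub>n n, p)) = - perp (E (s, x s) - E (t\<^sub>n n, p))"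
      by (simp add: perp_simps)
    then show "norm (- perp (E (s, x s)) - - perp (E (t\<^sub>n n, p))) \<le> C"
      using assms[OF s] by simp
  qed (use t\<^sub>n_mono in auto)
  then show ?thesis by (simp add: t\<^sub>n_Suc)
qed

text \<open>Here \<open>p = y(t\<^sub>n)\<close>: the fast part of the position is dropped, at the price \<open>K \<epsilon> \<bar>v\<bar>\<close> in the flow and
  in the scheme.\<close>

lemma y_error_le_asymptotic:
  "norm (yn N - y (t\<^sub>n N))
    \<le> t\<^sub>n N * (B * (1 + K) * \<Delta>t + 2 * K * \<epsilon> * V (t\<^sub>n N)) * exp (K * t\<^sub>n N)"
proof -
  define d where "d = B * (1 + K) * \<Delta>t + 2 * K * \<epsilon> * V (t\<^sub>n N)"
  define e where "e n = norm (yn n - y (t\<^sub>n n))" for n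
  have step: "e (Suc n) \<le> q * e n + (\<Delta>t * d) * q ^ Suc n" if "n < N" for n
  proof -
    define t where "t = t\<^sub>n n"
    have t0: "t \<ge> 0" and t': "t\<^sub>n (Suc n) = t + \<Delta>t" by (simp_all add: t_def t\<^sub>n_Suc)
    define S where "S = V (t\<^sub>n N) * q ^ Suc n"
    have vS: "norm (v s) \<le> S" if "t \<le> s" "s \<le> t + \<Delta>t" for s
      using exact_speed_in_step[of n N s] \<open>n < N\<close> that t' by (simp add: S_def t_def)
    have vnS: "norm (vn (Suc n)) \<le> S"
      using discrete_speed_le[of "Suc n" N] \<open>n < N\<close> by (simp add: S_def)
    have "norm (y (t\<^sub>n (Suc n)) - y (t\<^sub>n n) + \<Delta>t *\<^sub>R perp (E (t\<^sub>n n, y t)))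
        \<le> (B * \<Delta>t + K * (B * \<Delta>t + \<epsilon> * S)) * \<Delta>t"
    proof (rule exact_step)
      fix s assume "t\<^sub>n n \<le> s" "s \<le> t\<^sub>n (Suc n)"
      then have s: "t \<le> s" "s \<le> t + \<Delta>t" by (simp_all add: t_def t\<^sub>n_Suc)
      have 1: "norm (y s - y t) \<le> B * \<Delta>t"
        using y_lipschitz[OF t0 s(1)] mult_left_mono[OF _ B_nonneg, of "s - t" \<Delta>t] s by linarith
      have 2: "norm (\<epsilon> *\<^sub>R perp (v s)) \<le> \<epsilon> * S" using vS[OF s] eps by simp
      have 3: "x s - y t = (y s - y t) + \<epsilon> *\<^sub>R perp (v s)" by (simp add: x_eq)
      have "norm (x s - y t) \<le> B * \<Delta>t + \<epsilon> * S"
        unfolding 3 by (rule norm_triangle_mono[OF 1 2])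
      then have "B * \<bar>s - t\<bar> + K * norm (x s - y t) \<le> B * \<Delta>t + K * (B * \<Delta>t + \<epsilon> * S)"
        using s B_nonneg K_nonneg by (intro add_mono mult_left_mono) auto
      then show "norm (E (s, x s) - E (t\<^sub>n n, y t)) \<le> B * \<Delta>t + K * (B * \<Delta>t + \<epsilon> * S)"
        using field_difference[of s t "x s" "y t"] s t0 by (simp add: t_def)
    qed
    then have 1: "norm (y (t\<^sub>n (Suc n)) - y t + \<Delta>t *\<^sub>R perp (E (t, y t)))
        \<le> (B * \<Delta>t + K * (B * \<Delta>t + \<epsilon> * S)) * \<Delta>t" by (simp add: t_def)
    have "norm (yn n + \<epsilon> *\<^sub>R perp (vn (Suc n)) - y t) \<le> e n + \<epsilon> * S"
    proof -
      have "yn n + \<epsilon> *\<^sub>R perp (vn (Suc n)) - y t = (yn n - y t) + \<epsilon> *\<^sub>R perp (vn (Suc n))" by simp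
      also have "norm \<dots> \<le> norm (yn n - y t) + norm (\<epsilon> *\<^sub>R perp (vn (Suc n)))" by (rule norm_triangle_ineq)
      also have "\<dots> \<le> e n + \<epsilon> * S" using vnS eps by (simp add: e_def t_def)
      finally show ?thesis .
    qed
    then have "norm (E (t, yn n + \<epsilon> *\<^sub>R perp (vn (Suc n))) - E (t, y t)) \<le> K * (e n + \<epsilon> * S)"
      using space_lipschitz[OF t0] mult_left_mono[OF _ K_nonneg] order_trans by blast
    then have 2: "norm (\<Delta>t *\<^sub>R perp (E (t, yn n + \<epsilon> *\<^sub>R perp (vn (Suc n))) - E (t, y t)))
        \<le> \<Delta>t * (K * (e n + \<epsilon> * S))"
      using dt by simp
    have "yn (Suc n) - y (t\<^sub>n (Suc n)) = (yn n - y t)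
        - \<Delta>t *\<^sub>R perp (E (t, yn n + \<epsilon> *\<^sub>R perp (vn (Suc n))) - E (t, y t))
        - (y (t\<^sub>n (Suc n)) - y t + \<Delta>t *\<^sub>R perp (E (t, y t)))"
      unfolding yn_Suc t_def by (simp add: perp_simps algebra_simps)
    also have "norm \<dots> \<le> (norm (yn n - y t) + \<Delta>t * (K * (e n + \<epsilon> * S)))
        + (B * \<Delta>t + K * (B * \<Delta>t + \<epsilon> * S)) * \<Delta>t"
      by (rule order_trans[OF norm_triangle_ineq4 add_mono[OF _ 1]])
        (rule order_trans[OF norm_triangle_ineq4 add_left_mono[OF 2]])
    finally have "e (Suc n) \<le> e n + \<Delta>t * (K * (e n + \<epsilon> * S))
        + (B * \<Delta>t + K * (B * \<Delta>t + \<epsilon> * S)) * \<Delta>t"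
      by (simp add: e_def t_def)
    also have "\<dots> = (1 + K * \<Delta>t) * e n + \<Delta>t * (B * (1 + K) * \<Delta>t * 1 + 2 * K * \<epsilon> * S)"
      by (simp add: algebra_simps)
    also have "\<dots> \<le> q * e n + \<Delta>t * (B * (1 + K) * \<Delta>t * q ^ Suc n + 2 * K * \<epsilon> * S)"
      using q_ge q_pow_ge_1[of "Suc n"] dt B_nonneg K_nonneg eps order_trans[OF norm_ge_zero vnS]
      by (intro add_mono mult_right_mono mult_left_mono) (auto simp: e_def)
    also have "\<dots> = q * e n + (\<Delta>t * d) * q ^ Suc n" by (simp add: S_def d_def algebra_simps)
    finally show ?thesis .
  qed
  have "e N \<le> (e 0 + real N * (\<Delta>t * d)) * q ^ N"
    by (rule discrete_gronwall[of N]) (use step q_ge_1 in auto)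
  moreover have "e 0 = 0" by (simp add: e_def yn_0)
  ultimately show ?thesis
    unfolding e_def d_def q_pow by (simp add: t\<^sub>n_def mult.assoc)
qed

text \<open>Here \<open>p = y(t\<^sub>n) + \<epsilon> v(t\<^sub>n\<^sub>+\<^sub>1)\<^sup>\<bottom>\<close>, the exact counterpart of the point at which the scheme evaluates
  the field. The velocity is updated first and then used in the update of \<open>y\<close>, which accounts for
  the square of the amplification factor. The local errors come from \<open>x' = v / \<epsilon>\<close> and
  \<open>v' = O(1 / \<epsilon> + \<bar>v\<bar> / \<epsilon>\<^sup>2)\<close>.\<close>

lemma error_le_convergent:
  "norm (yn N - y (t\<^sub>n N)) + \<epsilon> * norm (vn N - v (t\<^sub>n N))
    \<le> t\<^sub>n N * \<Delta>t * (2 * B + 2 * K * B + 2 * K * V (t\<^sub>n N) / \<epsilon> + B / \<epsilon>\<^sup>2 + V (t\<^sub>n N) / \<epsilon> ^ 3)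
      * exp (2 * K * t\<^sub>n N)"
proof -
  define VN where "VN = V (t\<^sub>n N)"
  have VN: "VN \<ge> 0" by (simp add: VN_def V_nonneg)
  define H where "H = 2 * B + 2 * K * B + 2 * K * VN / \<epsilon> + B / \<epsilon>\<^sup>2 + VN / \<epsilon> ^ 3"
  define e where "e n = norm (yn n - y (t\<^sub>n n))" for n
  define f where "f n = \<epsilon> * norm (vn n - v (t\<^sub>n n))" for n
  have step: "e (Suc n) + f (Suc n) \<le> q\<^sup>2 * (e n + f n) + (\<Delta>t\<^sup>2 * H) * (q\<^sup>2) ^ Suc n" if "n < N" for n
  proof -
    define t t' where "t = t\<^sub>n n" and "t' = t\<^sub>n (Suc n)"
    have t0: "t \<ge> 0" and t': "t' = t + \<Delta>t" by (simp_all add: t_def t'_def t\<^sub>n_Suc)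
    define P where "P = q ^ Suc n"
    have P: "P \<ge> 1" unfolding P_def by (rule q_pow_ge_1)
    define S where "S = VN * P"
    have S0: "S \<ge> 0" using VN P by (simp add: S_def)
    have vS: "norm (v s) \<le> S" if "t \<le> s" "s \<le> t'" for s
      using exact_speed_in_step[of n N s] \<open>n < N\<close> that by (simp add: S_def P_def t_def t'_def VN_def)
    \<comment> \<open>a bound for \<open>v'\<close> during the step\<close>
    define L where "L = B / \<epsilon> + S / \<epsilon>\<^sup>2"
    have L0: "L \<ge> 0" using B_nonneg S0 eps by (simp add: L_def)
    have v_lip: "norm (v s - v t') \<le> L * \<Delta>t" if s: "t \<le> s" "s \<le> t'" for s
    proof -
      have "norm (v t' - v s - (t' - s) *\<^sub>R 0) \<le> L * (t' - s)"
      proof (rule vector_derivative_bound)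
        fix r assume r: "s \<le> r" "r \<le> t'"
        then have r0: "0 \<le> r" using t0 s by linarith
        show "(v has_vector_derivative ((1 / \<epsilon>) *\<^sub>R E (r, x r) - (1 / \<epsilon>\<^sup>2) *\<^sub>R perp (v r))) (at r within {0..})"
          by (rule v_deriv[OF r0])
        have "norm ((1 / \<epsilon>) *\<^sub>R E (r, x r)) \<le> B / \<epsilon>"
          using field_bound[OF r0] eps by (simp add: divide_right_mono)
        moreover have "norm ((1 / \<epsilon>\<^sup>2) *\<^sub>R perp (v r)) \<le> S / \<epsilon>\<^sup>2"
          using vS[of r] r s eps by (simp add: divide_right_mono)
        ultimately show "norm ((1 / \<epsilon>) *\<^sub>R E (r, x r) - (1 / \<epsilon>\<^sup>2) *\<^sub>R perp (v r) - 0) \<le> L"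
          unfolding L_def diff_zero by (intro order_trans[OF norm_triangle_ineq4 add_mono])
      qed (use s t0 in auto)
      moreover have "L * (t' - s) \<le> L * \<Delta>t" using L0 s t' by (intro mult_left_mono) auto
      ultimately show ?thesis by (simp add: norm_minus_commute)
    qed
    have x_lip: "norm (x s - x t) \<le> S / \<epsilon> * \<Delta>t" if s: "t \<le> s" "s \<le> t'" for s
    proof -
      have "norm (x s - x t - (s - t) *\<^sub>R 0) \<le> S / \<epsilon> * (s - t)"
      proof (rule vector_derivative_bound)
        fix r assume r: "t \<le> r" "r \<le> s"
        then have r0: "0 \<le> r" using t0 by linarith
        show "(x has_vector_derivative (1 / \<epsilon>) *\<^sub>R v r) (at r within {0..})" by (rule x_deriv[OF r0])
        show "norm ((1 / \<epsilon>) *\<^sub>R v r - 0) \<le> S / \<epsilon>"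
          using vS[of r] r s eps by (simp add: divide_right_mono)
      qed (use s t0 in auto)
      moreover have "S / \<epsilon> * (s - t) \<le> S / \<epsilon> * \<Delta>t"
        using S0 eps s t' by (intro mult_left_mono) auto
      ultimately show ?thesis by simp
    qed
    define p where "p = y t + \<epsilon> *\<^sub>R perp (v t')"
    define Cy where "Cy = B * \<Delta>t + K * (B * \<Delta>t + \<epsilon> * (L * \<Delta>t))"
    define Cv where "Cv = (B * \<Delta>t + K * (S / \<epsilon> * \<Delta>t)) / \<epsilon> + L * \<Delta>t / \<epsilon>\<^sup>2"
    have "norm (y (t\<^sub>n (Suc n)) - y (t\<^sub>n n) + \<Delta>t *\<^sub>R perp (E (t\<^sub>n n, p))) \<le> Cy * \<Delta>t"
    proof (rule exact_step)
      fix s assume "t\<^sub>n n \<le> s" "s \<le> t\<^sub>n (Suc n)"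
      then have s: "t \<le> s" "s \<le> t'" by (simp_all add: t_def t'_def)
      have 1: "norm (y s - y t) \<le> B * \<Delta>t"
        using y_lipschitz[OF t0 s(1)] mult_left_mono[OF _ B_nonneg, of "s - t" \<Delta>t] s t' by linarith
      have 2: "norm (\<epsilon> *\<^sub>R perp (v s - v t')) \<le> \<epsilon> * (L * \<Delta>t)" using v_lip[OF s] eps by simp
      have 3: "x s - p = (y s - y t) + \<epsilon> *\<^sub>R perp (v s - v t')"
        by (simp add: x_eq p_def perp_simps algebra_simps)
      have "norm (x s - p) \<le> B * \<Delta>t + \<epsilon> * (L * \<Delta>t)"
        unfolding 3 by (rule norm_triangle_mono[OF 1 2])
      then have "B * \<bar>s - t\<bar> + K * norm (x s - p) \<le> Cy"
        unfolding Cy_def using s t' B_nonneg K_nonneg by (intro add_mono mult_left_mono) auto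
      then show "norm (E (s, x s) - E (t\<^sub>n n, p)) \<le> Cy"
        using field_difference[of s t "x s" p] s t0 by (simp add: t_def)
    qed
    then have y_defect: "norm (y t' - y t + \<Delta>t *\<^sub>R perp (E (t, p))) \<le> Cy * \<Delta>t"
      by (simp add: t_def t'_def)
    define b where "b = (1 / \<epsilon>) *\<^sub>R E (t, x t) - (1 / \<epsilon>\<^sup>2) *\<^sub>R perp (v t')"
    have "norm (v t' - v t - (t' - t) *\<^sub>R b) \<le> Cv * (t' - t)"
    proof (rule vector_derivative_bound)
      fix s assume s: "t \<le> s" "s \<le> t'"
      then have s0: "0 \<le> s" using t0 by linarith
      show "(v has_vector_derivative ((1 / \<epsilon>) *\<^sub>R E (s, x s) - (1 / \<epsilon>\<^sup>2) *\<^sub>R perp (v s))) (at s within {0..})"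
        by (rule v_deriv[OF s0])
      have "norm (E (s, x s) - E (t, x t)) \<le> B * \<bar>s - t\<bar> + K * norm (x s - x t)"
        by (rule field_difference[OF s0 t0])
      also have "\<dots> \<le> B * \<Delta>t + K * (S / \<epsilon> * \<Delta>t)"
        using s t' x_lip[OF s] B_nonneg K_nonneg by (intro add_mono mult_left_mono) auto
      finally have 1: "norm ((1 / \<epsilon>) *\<^sub>R (E (s, x s) - E (t, x t))) \<le> (B * \<Delta>t + K * (S / \<epsilon> * \<Delta>t)) / \<epsilon>"
        using eps by (simp add: divide_right_mono del: scaleR_diff_right)
      have 2: "norm ((1 / \<epsilon>\<^sup>2) *\<^sub>R perp (v s - v t')) \<le> L * \<Delta>t / \<epsilon>\<^sup>2"
        using v_lip[OF s] eps by (simp add: divide_right_mono)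
      have 3: "(1 / \<epsilon>) *\<^sub>R E (s, x s) - (1 / \<epsilon>\<^sup>2) *\<^sub>R perp (v s) - b
          = (1 / \<epsilon>) *\<^sub>R (E (s, x s) - E (t, x t)) - (1 / \<epsilon>\<^sup>2) *\<^sub>R perp (v s - v t')"
        by (simp add: b_def perp_simps scaleR_diff_right)
      show "norm ((1 / \<epsilon>) *\<^sub>R E (s, x s) - (1 / \<epsilon>\<^sup>2) *\<^sub>R perp (v s) - b) \<le> Cv"
        unfolding 3 Cv_def by (rule order_trans[OF norm_triangle_ineq4 add_mono[OF 1 2]])
    qed (use t0 t' dt in auto)
    then have v_defect: "norm (v t' - v t - \<Delta>t *\<^sub>R b) \<le> Cv * \<Delta>t" by (simp add: t')
    have f_step: "f (Suc n) \<le> f n + \<Delta>t * K * (e n + f n) + \<epsilon> * Cv * \<Delta>t"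
    proof -
      let ?r = "\<Delta>t / \<epsilon>\<^sup>2" and ?xn = "yn n + \<epsilon> *\<^sub>R perp (vn n)"
      let ?a = "vn (Suc n) - v t'"
      have "norm (?xn - x t) \<le> e n + f n"
      proof -
        have "?xn - x t = (yn n - y t) + \<epsilon> *\<^sub>R perp (vn n - v t)"
          by (simp add: x_eq perp_simps algebra_simps)
        also have "norm \<dots> \<le> norm (yn n - y t) + norm (\<epsilon> *\<^sub>R perp (vn n - v t))" by (rule norm_triangle_ineq)
        also have "\<dots> = e n + f n" using eps by (simp add: e_def f_def t_def)
        finally show ?thesis .
      qed
      then have "norm (E (t, ?xn) - E (t, x t)) \<le> K * (e n + f n)"
        using space_lipschitz[OF t0] mult_left_mono[OF _ K_nonneg] order_trans by blast
      then have 1: "norm ((\<Delta>t / \<epsilon>) *\<^sub>R (E (t, ?xn) - E (t, x t))) \<le> (\<Delta>t / \<epsilon>) * (K * (e n + f n))"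
        using dt eps by (simp add: mult_left_mono divide_right_mono del: scaleR_diff_right)
      have "norm ?a \<le> norm (?a + ?r *\<^sub>R perp ?a)" by (rule norm_le_norm_add_perp)
      also have "?a + ?r *\<^sub>R perp ?a
          = (vn (Suc n) + ?r *\<^sub>R perp (vn (Suc n))) - (v t' + ?r *\<^sub>R perp (v t'))"
        by (simp add: perp_simps algebra_simps)
      also have "\<dots> = (vn n + (\<Delta>t / \<epsilon>) *\<^sub>R E (t, ?xn)) - (v t' + ?r *\<^sub>R perp (v t'))"
        unfolding vn_Suc t_def ..
      also have "\<dots> = (vn n - v t) + (\<Delta>t / \<epsilon>) *\<^sub>R (E (t, ?xn) - E (t, x t)) - (v t' - v t - \<Delta>t *\<^sub>R b)"
        by (simp add: b_def algebra_simps)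
      also have "norm \<dots> \<le> norm ((vn n - v t) + (\<Delta>t / \<epsilon>) *\<^sub>R (E (t, ?xn) - E (t, x t))) + norm (v t' - v t - \<Delta>t *\<^sub>R b)"
        by (rule norm_triangle_ineq4)
      also have "\<dots> \<le> (norm (vn n - v t) + (\<Delta>t / \<epsilon>) * (K * (e n + f n))) + Cv * \<Delta>t"
        by (intro add_mono v_defect order_trans[OF norm_triangle_ineq add_left_mono[OF 1]])
      finally have "\<epsilon> * norm ?a \<le> \<epsilon> * ((norm (vn n - v t) + (\<Delta>t / \<epsilon>) * (K * (e n + f n))) + Cv * \<Delta>t)"
        using eps by (intro mult_left_mono) auto
      also have "\<dots> = f n + \<Delta>t * K * (e n + f n) + \<epsilon> * Cv * \<Delta>t"
        using eps by (simp add: f_def t_def field_simps)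
      finally show ?thesis by (simp add: f_def t'_def)
    qed
    have e_step: "e (Suc n) \<le> e n + \<Delta>t * K * (e n + f (Suc n)) + Cy * \<Delta>t"
    proof -
      let ?p = "yn n + \<epsilon> *\<^sub>R perp (vn (Suc n))"
      have "norm (?p - p) \<le> e n + f (Suc n)"
      proof -
        have "?p - p = (yn n - y t) + \<epsilon> *\<^sub>R perp (vn (Suc n) - v t')"
          by (simp add: p_def perp_simps algebra_simps)
        also have "norm \<dots> \<le> norm (yn n - y t) + norm (\<epsilon> *\<^sub>R perp (vn (Suc n) - v t'))" by (rule norm_triangle_ineq)
        also have "\<dots> = e n + f (Suc n)" using eps by (simp add: e_def f_def t_def t'_def)
        finally show ?thesis .
      qed
      then have "norm (E (t, ?p) - E (t, p)) \<le> K * (e n + f (Suc n))"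
        using space_lipschitz[OF t0] mult_left_mono[OF _ K_nonneg] order_trans by blast
      then have 1: "norm (\<Delta>t *\<^sub>R perp (E (t, ?p) - E (t, p))) \<le> \<Delta>t * K * (e n + f (Suc n))"
        using dt by simp
      have "yn (Suc n) - y t' = (yn n - y t) - \<Delta>t *\<^sub>R perp (E (t, ?p) - E (t, p))
          - (y t' - y t + \<Delta>t *\<^sub>R perp (E (t, p)))"
        unfolding yn_Suc t_def by (simp add: perp_simps algebra_simps)
      also have "norm \<dots> \<le> norm ((yn n - y t) - \<Delta>t *\<^sub>R perp (E (t, ?p) - E (t, p)))
          + norm (y t' - y t + \<Delta>t *\<^sub>R perp (E (t, p)))" by (rule norm_triangle_ineq4)
      also have "\<dots> \<le> (norm (yn n - y t) + \<Delta>t * K * (e n + f (Suc n))) + Cy * \<Delta>t"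
        by (intro add_mono y_defect order_trans[OF norm_triangle_ineq4 add_left_mono[OF 1]])
      finally show ?thesis by (simp add: e_def t_def t'_def)
    qed
    have kd: "K * \<Delta>t \<ge> 0" using K_nonneg dt by simp
    have ef: "e n \<ge> 0" "f n \<ge> 0" using eps by (simp_all add: e_def f_def)
    have "Cy * \<Delta>t + \<epsilon> * Cv * \<Delta>t
        = \<Delta>t\<^sup>2 * ((2 * B + 2 * K * B + B / \<epsilon>\<^sup>2) * 1 + (2 * K * VN / \<epsilon> + VN / \<epsilon> ^ 3) * P)"
      using eps by (simp add: Cy_def Cv_def L_def S_def field_simps power2_eq_square power3_eq_cube)
    also have "\<dots> \<le> \<Delta>t\<^sup>2 * ((2 * B + 2 * K * B + B / \<epsilon>\<^sup>2) * P + (2 * K * VN / \<epsilon> + VN / \<epsilon> ^ 3) * P)"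
      using P B_nonneg K_nonneg eps by (intro mult_left_mono add_right_mono) auto
    also have "\<dots> = \<Delta>t\<^sup>2 * H * P" by (simp add: H_def algebra_simps)
    finally have defect: "Cy * \<Delta>t + \<epsilon> * Cv * \<Delta>t \<le> \<Delta>t\<^sup>2 * H * P" .
    have CC: "Cy * \<Delta>t \<ge> 0" "\<epsilon> * Cv * \<Delta>t \<ge> 0"
      using B_nonneg K_nonneg eps dt L0 S0 by (auto simp: Cy_def Cv_def)
    have H0: "H \<ge> 0" using B_nonneg K_nonneg eps VN by (simp add: H_def)
    have "e (Suc n) + f (Suc n) \<le> (1 + K * \<Delta>t) * (e n + f (Suc n)) + Cy * \<Delta>t"
      using e_step by (simp add: algebra_simps)
    also have "\<dots> \<le> (1 + K * \<Delta>t) * (e n + (f n + \<Delta>t * K * (e n + f n) + \<epsilon> * Cv * \<Delta>t)) + Cy * \<Delta>t"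
      using f_step kd by (intro add_right_mono mult_left_mono add_left_mono) auto
    also have "\<dots> = (1 + K * \<Delta>t)\<^sup>2 * (e n + f n) + ((1 + K * \<Delta>t) * (\<epsilon> * Cv * \<Delta>t) + 1 * (Cy * \<Delta>t))"
      by (simp add: algebra_simps power2_eq_square)
    also have "\<dots> \<le> q\<^sup>2 * (e n + f n) + (q * (\<epsilon> * Cv * \<Delta>t) + q * (Cy * \<Delta>t))"
      using q_ge q_ge_1 kd ef CC by (intro add_mono mult_right_mono power_mono) auto
    also have "q * (\<epsilon> * Cv * \<Delta>t) + q * (Cy * \<Delta>t) = q * (Cy * \<Delta>t + \<epsilon> * Cv * \<Delta>t)" by (simp add: algebra_simps)
    also have "\<dots> \<le> q * (\<Delta>t\<^sup>2 * H * P)" using defect q_ge_1 by (intro mult_left_mono) auto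
    also have "\<dots> = \<Delta>t\<^sup>2 * H * q ^ Suc (Suc n)" by (simp add: P_def)
    \<comment> \<open>\<open>n + 2 \<le> 2 (n + 1)\<close>: the velocity in the local error grows at half the available rate\<close>
    also have "\<dots> \<le> \<Delta>t\<^sup>2 * H * (q\<^sup>2) ^ Suc n"
      unfolding power_mult[symmetric] using q_ge_1 H0
      by (intro mult_left_mono power_increasing) auto
    finally show ?thesis by simp
  qed
  have "e N + f N \<le> (e 0 + f 0 + real N * (\<Delta>t\<^sup>2 * H)) * (q\<^sup>2) ^ N"
    by (rule discrete_gronwall[of N "\<lambda>n. e n + f n"]) (use step in auto)
  moreover have "e 0 = 0" "f 0 = 0" by (simp_all add: e_def f_def yn_0 vn_0 v_0)
  moreover have "(q\<^sup>2) ^ N = exp (2 * K * t\<^sub>n N)"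
    using q_pow[of N] by (simp add: power2_eq_square power_mult_distrib mult.assoc flip: exp_add)
  ultimately have "e N + f N \<le> real N * (\<Delta>t\<^sup>2 * H) * exp (2 * K * t\<^sub>n N)" by simp
  also have "\<dots> = t\<^sub>n N * \<Delta>t * H * exp (2 * K * t\<^sub>n N)" by (simp add: t\<^sub>n_def power2_eq_square)
  finally show ?thesis unfolding e_def f_def H_def VN_def .
qed

lemma V_le:
  assumes "T \<ge> 0"
  shows "V T \<le> (1 + c\<^sub>v) * ((1 + T) * (1 + norm v0 + \<epsilon>))"
proof -
  have "norm v0 * 1 \<le> (1 + norm v0 + \<epsilon>) * (1 + T)"
    using assms eps by (intro mult_mono) auto
  moreover have "\<epsilon> * (1 + T) \<le> (1 + norm v0 + \<epsilon>) * (1 + T)"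
    using assms eps by (intro mult_right_mono) auto
  then have "c\<^sub>v * (\<epsilon> * (1 + T)) \<le> c\<^sub>v * ((1 + norm v0 + \<epsilon>) * (1 + T))"
    by (rule mult_left_mono[OF _ c\<^sub>v_nonneg])
  ultimately show ?thesis unfolding V_def by (simp add: algebra_simps)
qed

lemma exp_rate_le:
  assumes "T \<ge> 0"
  shows "exp (K * T) \<le> exp ((2 + K * \<Delta>t) * K * T)" "exp (2 * K * T) \<le> exp ((2 + K * \<Delta>t) * K * T)"
proof -
  have "0 \<le> K * T" using K_nonneg assms by simp
  moreover have "0 \<le> (K * \<Delta>t) * (K * T)" using K_nonneg assms dt by simp
  moreover have "(2 + K * \<Delta>t) * K * T = 2 * (K * T) + (K * \<Delta>t) * (K * T)" by (simp add: algebra_simps)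
  ultimately show "exp (K * T) \<le> exp ((2 + K * \<Delta>t) * K * T)"
    "exp (2 * K * T) \<le> exp ((2 + K * \<Delta>t) * K * T)" unfolding exp_le_cancel_iff by linarith+
qed

lemma total_error_le_convergent:
  shows "norm (yn N - y (t\<^sub>n N)) + \<epsilon> * norm (vn N - v (t\<^sub>n N))
    \<le> conv_const * (1 + t\<^sub>n N) ^ 2 * exp ((2 + K * \<Delta>t) * K * t\<^sub>n N) * (1 + norm v0 + \<epsilon>)
      * (\<Delta>t / \<epsilon> ^ 3 * (1 + \<epsilon>\<^sup>2))"
proof -
  define T where "T = t\<^sub>n N"
  define W where "W = 1 + norm v0 + \<epsilon>"
  define D where "D = (1 + T) * W * (1 + \<epsilon>\<^sup>2)"
  have T: "T \<ge> 0" by (simp add: T_def)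
  have W: "W \<ge> 1" "\<epsilon> \<le> W" using eps by (simp_all add: W_def)
  have W_le: "W \<le> (1 + T) * W" using T W mult_right_mono[of 1 "1 + T" W] by simp
  have \<epsilon>2: "\<epsilon>\<^sup>2 \<le> 1 + \<epsilon>\<^sup>2" by simp
  have \<epsilon>_le: "\<epsilon> \<le> (1 + T) * W" using W W_le by linarith
  have "\<epsilon> * \<epsilon>\<^sup>2 \<le> D" unfolding D_def using \<epsilon>_le W T by (intro mult_mono[of \<epsilon>]) auto
  then have 1: "(2 * B + 2 * K * B) * \<epsilon> ^ 3 \<le> (2 * B + 2 * K * B) * D"
    using B_nonneg K_nonneg by (intro mult_left_mono) (auto simp: power2_eq_square power3_eq_cube)
  have V_le': "V T \<le> (1 + c\<^sub>v) * ((1 + T) * W)" unfolding W_def by (rule V_le[OF T])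
  have "V T * \<epsilon>\<^sup>2 \<le> (1 + c\<^sub>v) * ((1 + T) * W) * (1 + \<epsilon>\<^sup>2)"
    using V_le' T V_nonneg[OF T] W c\<^sub>v_nonneg by (intro mult_mono) auto
  then have "V T * \<epsilon>\<^sup>2 \<le> (1 + c\<^sub>v) * D" by (simp add: D_def mult.assoc)
  then have 2: "2 * K * (V T * \<epsilon>\<^sup>2) \<le> 2 * K * ((1 + c\<^sub>v) * D)"
    using K_nonneg by (intro mult_left_mono) auto
  have "\<epsilon> * 1 \<le> D" unfolding D_def using \<epsilon>_le W T by (intro mult_mono[of \<epsilon>]) auto
  then have 3: "B * \<epsilon> \<le> B * D" using B_nonneg by (intro mult_left_mono) auto
  have "V T * 1 \<le> (1 + c\<^sub>v) * ((1 + T) * W) * (1 + \<epsilon>\<^sup>2)"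
    using V_le' T V_nonneg[OF T] W c\<^sub>v_nonneg by (intro mult_mono) auto
  then have 4: "V T \<le> (1 + c\<^sub>v) * D" by (simp add: D_def mult.assoc)
  have H: "2 * B + 2 * K * B + 2 * K * V T / \<epsilon> + B / \<epsilon>\<^sup>2 + V T / \<epsilon> ^ 3
      = ((2 * B + 2 * K * B) * \<epsilon> ^ 3 + 2 * K * (V T * \<epsilon>\<^sup>2) + B * \<epsilon> + V T) / \<epsilon> ^ 3"
    using eps by (simp add: field_simps power2_eq_square power3_eq_cube)
  have "(2 * B + 2 * K * B) * \<epsilon> ^ 3 + 2 * K * (V T * \<epsilon>\<^sup>2) + B * \<epsilon> + V T \<le> conv_const * D"
    using add_mono[OF add_mono[OF add_mono[OF 1 2] 3] 4] by (simp add: conv_const_def algebra_simps)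
  then have HC: "2 * B + 2 * K * B + 2 * K * V T / \<epsilon> + B / \<epsilon>\<^sup>2 + V T / \<epsilon> ^ 3 \<le> conv_const * D / \<epsilon> ^ 3"
    unfolding H using eps by (intro divide_right_mono) auto
  have C0: "conv_const \<ge> 0" using B_nonneg K_nonneg c\<^sub>v_nonneg by (simp add: conv_const_def)
  have D0: "D \<ge> 0" using T W by (simp add: D_def)
  have "norm (yn N - y T) + \<epsilon> * norm (vn N - v T)
      \<le> T * \<Delta>t * (2 * B + 2 * K * B + 2 * K * V T / \<epsilon> + B / \<epsilon>\<^sup>2 + V T / \<epsilon> ^ 3) * exp (2 * K * T)"
    unfolding T_def by (rule error_le_convergent)
  also have "\<dots> \<le> (1 + T) * \<Delta>t * (conv_const * D / \<epsilon> ^ 3) * exp ((2 + K * \<Delta>t) * K * T)"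
    using T dt eps HC exp_rate_le[OF T] C0 D0 B_nonneg K_nonneg V_nonneg[OF T]
    by (intro mult_mono) auto
  also have "\<dots> = conv_const * (1 + T)\<^sup>2 * exp ((2 + K * \<Delta>t) * K * T) * W * (\<Delta>t / \<epsilon> ^ 3 * (1 + \<epsilon>\<^sup>2))"
    by (simp add: D_def power2_eq_square)
  finally show ?thesis unfolding T_def W_def .
qed

lemma x_error_le_asymptotic:
  shows "norm (yn N + \<epsilon> *\<^sub>R perp (vn N) - x (t\<^sub>n N))
    \<le> asym_const * (1 + t\<^sub>n N) ^ 3 * exp ((2 + K * \<Delta>t) * K * t\<^sub>n N) * (1 + norm v0 + \<epsilon>) * (\<Delta>t + \<epsilon>)"
proof -
  define T where "T = t\<^sub>n N"
  define a where "a = 1 + T"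
  define W where "W = 1 + norm v0 + \<epsilon>"
  have T: "T \<ge> 0" by (simp add: T_def)
  have a: "a \<ge> 1" "T \<le> a" using T by (simp_all add: a_def)
  have W: "W \<ge> 1" using eps by (simp add: W_def)
  have a3: "a \<le> a ^ 3" using a by (simp add: self_le_power)
  have V: "V T \<le> (1 + c\<^sub>v) * (a * W)" unfolding a_def W_def by (rule V_le[OF T])
  have "norm (vn N) \<le> V T * exp (K * T)" "norm (v T) \<le> V T * exp (K * T)"
    using discrete_velocity_bound[of N] exact_velocity_bound[OF T] by (simp_all add: T_def q_pow)
  then have vv: "norm (\<epsilon> *\<^sub>R perp (vn N)) \<le> \<epsilon> * (V T * exp (K * T))"
    "norm (\<epsilon> *\<^sub>R perp (v T)) \<le> \<epsilon> * (V T * exp (K * T))" using eps by auto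
  have eq: "yn N + \<epsilon> *\<^sub>R perp (vn N) - x T = (yn N - y T) + (\<epsilon> *\<^sub>R perp (vn N) - \<epsilon> *\<^sub>R perp (v T))"
    by (simp add: x_eq)
  have "norm (yn N + \<epsilon> *\<^sub>R perp (vn N) - x T)
      \<le> T * (B * (1 + K) * \<Delta>t + 2 * K * \<epsilon> * V T) * exp (K * T)
        + (\<epsilon> * (V T * exp (K * T)) + \<epsilon> * (V T * exp (K * T)))"
    unfolding eq using y_error_le_asymptotic[of N, folded T_def]
    by (intro norm_triangle_mono order_trans[OF norm_triangle_ineq4 add_mono[OF vv]])
  also have "\<dots> = (T * (B * (1 + K)) * \<Delta>t + (2 * K * T + 2) * V T * \<epsilon>) * exp (K * T)"
    by (simp add: algebra_simps)
  also have "\<dots> \<le> (asym_const * (a ^ 3 * W) * (\<Delta>t + \<epsilon>)) * exp ((2 + K * \<Delta>t) * K * T)"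
  proof (rule mult_mono[OF _ exp_rate_le(1)[OF T]])
    have "T \<le> a ^ 3 * W" using a a3 W mult_mono[of T "a ^ 3" 1 W] by simp
    then have 1: "T * (B * (1 + K)) * \<Delta>t \<le> (a ^ 3 * W) * (B * (1 + K)) * \<Delta>t"
      using B_nonneg K_nonneg dt by (intro mult_right_mono) auto
    have "K * T \<le> K * a" using a K_nonneg by (intro mult_left_mono) auto
    then have "2 * K * T + 2 \<le> (2 * K + 2) * a" using a by (simp add: algebra_simps)
    then have "(2 * K * T + 2) * V T \<le> ((2 * K + 2) * a) * ((1 + c\<^sub>v) * (a * W))"
      using V V_nonneg[OF T] a K_nonneg T by (intro mult_mono) auto
    also have "\<dots> = (2 * K + 2) * (1 + c\<^sub>v) * (a\<^sup>2 * W)" by (simp add: power2_eq_square)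
    also have "\<dots> \<le> (2 * K + 2) * (1 + c\<^sub>v) * (a ^ 3 * W)"
      using a W K_nonneg c\<^sub>v_nonneg by (intro mult_left_mono mult_right_mono power_increasing) auto
    finally have 2: "(2 * K * T + 2) * V T * \<epsilon> \<le> (2 * K + 2) * (1 + c\<^sub>v) * (a ^ 3 * W) * \<epsilon>"
      using eps by (intro mult_right_mono) auto
    have "0 \<le> B * (1 + K) * (a ^ 3 * W) * \<epsilon>" "0 \<le> (2 * K + 2) * (1 + c\<^sub>v) * (a ^ 3 * W) * \<Delta>t"
      using B_nonneg K_nonneg a W eps dt c\<^sub>v_nonneg by auto
    with 1 2 show "T * (B * (1 + K)) * \<Delta>t + (2 * K * T + 2) * V T * \<epsilon> \<le> asym_const * (a ^ 3 * W) * (\<Delta>t + \<epsilon>)"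
      by (simp add: asym_const_def algebra_simps)
    show "0 \<le> asym_const * (a ^ 3 * W) * (\<Delta>t + \<epsilon>)"
      using B_nonneg K_nonneg a W eps dt c\<^sub>v_nonneg by (simp add: asym_const_def)
  qed auto
  finally show ?thesis unfolding T_def a_def W_def by (simp add: mult_ac)
qed

lemma x_error_bound:
  shows "norm (yn N + \<epsilon> *\<^sub>R perp (vn N) - x (t\<^sub>n N))
    \<le> 4 * (asym_const + conv_const) * (1 + t\<^sub>n N ^ 3) * exp ((2 + K * \<Delta>t) * K * t\<^sub>n N) * (1 + norm v0 + \<epsilon>)
      * min (\<Delta>t / \<epsilon> ^ 3 * (1 + \<epsilon>\<^sup>2)) (\<Delta>t + \<epsilon>)"
proof -
  define T where "T = t\<^sub>n N"
  define X where "X = exp ((2 + K * \<Delta>t) * K * T) * (1 + norm v0 + \<epsilon>)"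
  define C where "C = 4 * (asym_const + conv_const)"
  have T: "T \<ge> 0" by (simp add: T_def)
  have X0: "X \<ge> 0" using eps by (simp add: X_def)
  have T3: "(1 + T) ^ 3 \<le> 4 * (1 + T ^ 3)" using one_plus_power_bounds[OF T] by simp
  have "(1 + T) ^ 2 \<le> (1 + T) ^ 3" using T by (intro power_increasing) auto
  then have T2: "(1 + T) ^ 2 \<le> 4 * (1 + T ^ 3)" using T3 by simp
  have T30: "1 + T ^ 3 \<ge> 0" using T by simp
  have le: "C' * r * (X * b) \<le> C * (1 + T ^ 3) * (X * b)"
    if "r \<le> 4 * (1 + T ^ 3)" "b \<ge> 0" "C' \<ge> 0" "4 * C' \<le> C" for C' r b
  proof (rule mult_right_mono)
    have "C' * r \<le> C' * (4 * (1 + T ^ 3))" using that by (intro mult_left_mono) auto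
    also have "\<dots> = 4 * C' * (1 + T ^ 3)" by simp
    also have "\<dots> \<le> C * (1 + T ^ 3)" by (rule mult_right_mono[OF that(4) T30])
    finally show "C' * r \<le> C * (1 + T ^ 3)" .
  qed (use that X0 in simp)
  have "norm (yn N + \<epsilon> *\<^sub>R perp (vn N) - x T) \<le> asym_const * (1 + T) ^ 3 * (X * (\<Delta>t + \<epsilon>))"
    using x_error_le_asymptotic[of N] unfolding T_def X_def by (simp only: mult.assoc)
  also have "\<dots> \<le> C * (1 + T ^ 3) * (X * (\<Delta>t + \<epsilon>))"
    using T3 eps dt asym_const_nonneg conv_const_nonneg by (intro le) (auto simp: C_def)
  finally have asym: "norm (yn N + \<epsilon> *\<^sub>R perp (vn N) - x T) \<le> C * (1 + T ^ 3) * (X * (\<Delta>t + \<epsilon>))" .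
  have eq: "yn N + \<epsilon> *\<^sub>R perp (vn N) - x T = (yn N - y T) + \<epsilon> *\<^sub>R perp (vn N - v T)"
    by (simp add: x_eq perp_simps algebra_simps)
  have "norm (yn N + \<epsilon> *\<^sub>R perp (vn N) - x T) \<le> norm (yn N - y T) + \<epsilon> * norm (vn N - v T)"
    unfolding eq using norm_triangle_ineq[of "yn N - y T" "\<epsilon> *\<^sub>R perp (vn N - v T)"] eps by simp
  also have "\<dots> \<le> conv_const * (1 + T) ^ 2 * (X * (\<Delta>t / \<epsilon> ^ 3 * (1 + \<epsilon>\<^sup>2)))"
    using total_error_le_convergent[of N] unfolding T_def X_def by (simp only: mult.assoc)
  also have "\<dots> \<le> C * (1 + T ^ 3) * (X * (\<Delta>t / \<epsilon> ^ 3 * (1 + \<epsilon>\<^sup>2)))"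
    using T2 eps dt asym_const_nonneg conv_const_nonneg by (intro le) (auto simp: C_def)
  finally have "norm (yn N + \<epsilon> *\<^sub>R perp (vn N) - x T)
    \<le> C * (1 + T ^ 3) * (X * min (\<Delta>t / \<epsilon> ^ 3 * (1 + \<epsilon>\<^sup>2)) (\<Delta>t + \<epsilon>))"
    using asym by (simp add: min_def)
  then show ?thesis unfolding T_def X_def C_def by (simp only: mult.assoc)
qed

end

lemma (in bounded_lipschitz_field) scheme_x_error:
  "\<exists>C. \<forall>\<epsilon>>0. \<forall>\<Delta>t>0. \<forall>x0 v0 yn vn x v.
    scheme E \<epsilon> \<Delta>t x0 v0 yn vn \<longrightarrow> exact_solution E \<epsilon> x0 v0 x v \<longrightarrow>
    (\<forall>n. let t = real n * \<Delta>t in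
      norm ((yn n + \<epsilon> *\<^sub>R perp (vn n)) - x t)
        \<le> C * (1 + t ^ 3) * exp ((2 + K * \<Delta>t) * K * t) * (1 + norm v0 + \<epsilon>)
            * min (\<Delta>t / \<epsilon> ^ 3 * (1 + \<epsilon>\<^sup>2)) (\<Delta>t + \<epsilon>))"
proof (rule exI, intro allI impI)
  fix \<epsilon> \<Delta>t :: real and x0 v0 yn vn x v n
  assume "\<epsilon> > 0" "\<Delta>t > 0" "scheme E \<epsilon> \<Delta>t x0 v0 yn vn" "exact_solution E \<epsilon> x0 v0 x v"
  then interpret scheme_and_flow E B K \<epsilon> \<Delta>t x0 v0 yn vn x v by unfold_locales
  show "let t = real n * \<Delta>t in
      norm ((yn n + \<epsilon> *\<^sub>R perp (vn n)) - x t)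
        \<le> 4 * (asym_const + conv_const) * (1 + t ^ 3) * exp ((2 + K * \<Delta>t) * K * t) * (1 + norm v0 + \<epsilon>)
            * min (\<Delta>t / \<epsilon> ^ 3 * (1 + \<epsilon>\<^sup>2)) (\<Delta>t + \<epsilon>)"
    unfolding Let_def using x_error_bound[of n] unfolding t\<^sub>n_def .
qed

section \<open>Second-order comparison\<close>

context bounded_C11_field
begin

lemma M_nonneg: "M \<ge> 0"
proof -
  from C11_approximation[OF zero_less_one] obtain F' :: "real \<times> (real^2) \<Rightarrow> real \<times> (real^2) \<Rightarrow> real^2"
    where "\<And>t x d. t \<ge> 0 \<Longrightarrow> norm (F' (t, x) d) \<le> M * norm d"
    by blast
  from order_trans[OF norm_ge_zero this[of 0 0 "(1, 0)"]] show ?thesis by (simp add: norm_Pair)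
qed

definition second_const :: real where
  "second_const = B * (1 + K) + (4 * K * M * (1 + c\<^sub>v) + 4 + 12 * M * (1 + c\<^sub>v)\<^sup>2 + 2 * M * B
    + 8 * M * (1 + B) * (1 + c\<^sub>v)) + 4 * M * (1 + c\<^sub>v)"

lemma second_const_nonneg: "second_const \<ge> 0"
  using B_nonneg K_nonneg c\<^sub>v_nonneg M_nonneg by (simp add: second_const_def)

end

locale C11_scheme_and_flow = scheme_and_flow + bounded_C11_field
begin

text \<open>Both the corrected flow \<open>P\<close> and the corrected scheme \<open>Pn\<close> are Euler-like with field
  \<open>- E(t, y)\<^sup>\<bottom>\<close> up to \<open>O(\<epsilon>\<^sup>2)\<close>, and they start from the same point. The differential \<open>A\<close> belongs to a
  mollified field \<open>F\<close> at distance \<open>\<epsilon>\<^sup>2\<close>, so that it can be differentiated along the trajectory.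
  The correction \<open>\<epsilon>\<^sup>3 (A v)\<^sup>\<bottom>\<close> is itself negligible. The remainder is quadratic in the velocity, which
  is why the rate doubles to \<open>2 K\<close>.\<close>

lemma y_error_le_second_order:
  "norm (yn N - y (t\<^sub>n N))
    \<le> (t\<^sub>n N * (B * (1 + K) * \<Delta>t + \<epsilon>\<^sup>2 * (2 * K * M * \<epsilon> * V (t\<^sub>n N) + 4 + 4 * M * (V (t\<^sub>n N))\<^sup>2
          + 2 * M * B + 4 * M * (1 + B) * \<epsilon> * V (t\<^sub>n N)))
       + 2 * \<epsilon> ^ 3 * M * V (t\<^sub>n N)) * exp (2 * K * t\<^sub>n N)"
proof -
  have "\<epsilon>\<^sup>2 > 0" using eps by simp
  from C11_approximation[OF this] obtain F F' F'' where F: "\<And>z. (F has_derivative F' z) (at z)"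
    and F': "\<And>i z. i \<in> Basis \<Longrightarrow> ((\<lambda>z. F' z (0, i)) has_derivative F'' i z) (at z)"
    and F_close: "\<And>t x. t \<ge> 0 \<Longrightarrow> norm (F (t, x) - E (t, x)) \<le> \<epsilon>\<^sup>2"
    and F'_bound: "\<And>t x d. t \<ge> 0 \<Longrightarrow> norm (F' (t, x) d) \<le> M * norm d"
    and F''_bound: "\<And>t x i d. t \<ge> 0 \<Longrightarrow> i \<in> Basis \<Longrightarrow> norm (F'' i (t, x) d) \<le> M * norm d"
    by blast
  have M0: "M \<ge> 0" by (rule M_nonneg)
  have linF': "linear (F' z)" for z using F has_derivative_linear by blast
  define A where "A z u = F' z (0, u)" for z u
  have A_add: "A z (a + b) = A z a + A z b" and A_diff: "A z (a - b) = A z a - A z b"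
    and A_scale: "A z (r *\<^sub>R a) = r *\<^sub>R A z a" for z a b r
    using linear_add[OF linF', of z "(0, a)" "(0, b)"] linear_diff[OF linF', of z "(0, a)" "(0, b)"]
      linear_scale[OF linF', of z r "(0, a)"] by (simp_all add: A_def)
  have A_bound: "norm (A (t, p) u) \<le> M * norm u" if "t \<ge> 0" for t p u
    using F'_bound[OF that, of p "(0, u)"] by (simp add: A_def norm_Pair)
  have A_Basis: "A z u = (\<Sum>i\<in>Basis. (u \<bullet> i) *\<^sub>R A z i)" for z u
  proof -
    have "linear (A z)" by (rule linearI) (simp_all add: A_add A_scale)
    then have "A z (\<Sum>i\<in>Basis. (u \<bullet> i) *\<^sub>R i) = (\<Sum>i\<in>Basis. (u \<bullet> i) *\<^sub>R A z i)"
      by (simp add: linear_sum linear_scale)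
    then show ?thesis by (simp add: euclidean_representation)
  qed
  have Basis_sum: "norm (\<Sum>i\<in>Basis. (u \<bullet> i) *\<^sub>R a i) \<le> 2 * C * norm u"
    if "\<And>i. i \<in> Basis \<Longrightarrow> norm (a i) \<le> C" for u :: "real^2" and a :: "real^2 \<Rightarrow> real^2" and C
  proof -
    have "norm (\<Sum>i\<in>Basis. (u \<bullet> i) *\<^sub>R a i) \<le> (\<Sum>i\<in>(Basis :: (real^2) set). norm u * C)"
    proof (rule sum_norm_le)
      fix i :: "real^2" assume i: "i \<in> Basis"
      show "norm ((u \<bullet> i) *\<^sub>R a i) \<le> norm u * C"
        using that[OF i] Basis_le_norm[OF i, of u] by (simp add: mult_mono)
    qed
    then show ?thesis by (simp add: mult_ac)
  qed
  have A_lipschitz: "norm (A (s, p) u - A (t, r) u) \<le> 2 * (M * (\<bar>s - t\<bar> + norm (p - r))) * norm u"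
    if "s \<ge> 0" "t \<ge> 0" for s t p r u
  proof -
    have "norm (A (s, p) i - A (t, r) i) \<le> M * (\<bar>s - t\<bar> + norm (p - r))" if i: "i \<in> Basis" for i
    proof -
      have "norm (A (s, p) i - A (t, r) i) \<le> M * norm ((s, p) - (t, r))"
        unfolding A_def
      proof (rule differentiable_bound[of "{0..} \<times> UNIV" "\<lambda>z. F' z (0, i)" "F'' i"])
        fix z :: "real \<times> (real^2)" assume z: "z \<in> {0..} \<times> UNIV"
        show "((\<lambda>z. F' z (0, i)) has_derivative F'' i z) (at z within {0..} \<times> UNIV)"
          using F'[OF i] by (rule has_derivative_at_withinI)
        show "onorm (F'' i z) \<le> M"
          using z F''_bound[OF _ i] M0 by (intro onorm_bound) auto
      qed (use \<open>s \<ge> 0\<close> \<open>t \<ge> 0\<close> in \<open>auto intro!: convex_Times\<close>)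
      also have "\<dots> \<le> M * (\<bar>s - t\<bar> + norm (p - r))"
        using norm_Pair_le[of "s - t" "p - r"] M0 by (intro mult_left_mono) auto
      finally show ?thesis .
    qed
    from Basis_sum[OF this, where u=u]
    have "norm (\<Sum>i\<in>Basis. (u \<bullet> i) *\<^sub>R (A (s, p) i - A (t, r) i))
        \<le> 2 * (M * (\<bar>s - t\<bar> + norm (p - r))) * norm u" by simp
    then show ?thesis
      unfolding A_Basis[of _ u] by (simp add: sum_subtractf scaleR_diff_right)
  qed
  have taylor: "norm (E (t, p + h) - (E (t, p) + A (t, p) h)) \<le> 2 * \<epsilon>\<^sup>2 + 2 * M * (norm h)\<^sup>2"
    if t: "t \<ge> 0" for t p h
  proof -
    define f where "f s = F (t, p + s *\<^sub>R h)" for s :: real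
    have "norm (f 1 - f 0 - (1 - 0) *\<^sub>R A (t, p) h) \<le> 2 * M * (norm h)\<^sup>2 * (1 - 0)"
    proof (rule vector_derivative_bound)
      fix s :: real assume s: "0 \<le> s" "s \<le> 1"
      have "((\<lambda>s. (t, p + s *\<^sub>R h)) has_derivative (\<lambda>a. (0, a *\<^sub>R h))) (at s within {0..})"
        by (auto intro!: derivative_eq_intros)
      from has_derivative_compose[OF this F]
      have "(f has_derivative (\<lambda>a. F' (t, p + s *\<^sub>R h) (0, a *\<^sub>R h))) (at s within {0..})"
        unfolding f_def .
      then show "(f has_vector_derivative A (t, p + s *\<^sub>R h) h) (at s within {0..})"
        unfolding has_vector_derivative_def by (simp add: A_scale flip: A_def)
      have "norm (A (t, p + s *\<^sub>R h) h - A (t, p) h) \<le> 2 * (M * (s * norm h)) * norm h"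
        using A_lipschitz[OF t t, of "p + s *\<^sub>R h" h p] s by simp
      also have "\<dots> = s * (2 * M * (norm h)\<^sup>2)" by (simp add: power2_eq_square)
      also have "\<dots> \<le> 1 * (2 * M * (norm h)\<^sup>2)" using s M0 by (intro mult_right_mono) auto
      finally show "norm (A (t, p + s *\<^sub>R h) h - A (t, p) h) \<le> 2 * M * (norm h)\<^sup>2" by simp
    qed auto
    then have 1: "norm (F (t, p + h) - F (t, p) - A (t, p) h) \<le> 2 * M * (norm h)\<^sup>2" by (simp add: f_def)
    have "E (t, p + h) - (E (t, p) + A (t, p) h) = (F (t, p + h) - F (t, p) - A (t, p) h)
        - (F (t, p + h) - E (t, p + h)) + (F (t, p) - E (t, p))" by simp
    also have "norm \<dots> \<le> (2 * M * (norm h)\<^sup>2 + \<epsilon>\<^sup>2) + \<epsilon>\<^sup>2"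
      by (intro order_trans[OF norm_triangle_ineq] add_mono F_close[OF t]
          order_trans[OF norm_triangle_ineq4] 1)
    finally show ?thesis by simp
  qed
  define VN where "VN = V (t\<^sub>n N)"
  have VN: "VN \<ge> 0" by (simp add: VN_def V_nonneg)
  define P where "P s = y s - \<epsilon> ^ 3 *\<^sub>R perp (A (s, y s) (v s))" for s
  define Pn where "Pn n = yn n - \<epsilon> ^ 3 *\<^sub>R perp (A (t\<^sub>n n, yn n) (vn n))" for n
  define p where "p n = norm (Pn n - P (t\<^sub>n n))" for n
  define e where "e n = norm (yn n - y (t\<^sub>n n))" for n
  have correction: "norm (\<epsilon> ^ 3 *\<^sub>R perp (A (t, r) u)) \<le> \<epsilon> ^ 3 * M * C"
    if "t \<ge> 0" "norm u \<le> C" for t r u C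
    using A_bound[OF that(1), of r u] mult_left_mono[OF that(2) M0] eps
    by (simp add: mult_left_mono)
  have e_le_p: "e n \<le> p n + 2 * \<epsilon> ^ 3 * M * (VN * q ^ n)" if n: "n \<le> N" for n
  proof -
    have vn: "norm (vn n) \<le> VN * q ^ n" using discrete_speed_le[OF n] by (simp add: VN_def)
    have "V (t\<^sub>n n) * q ^ n \<le> VN * q ^ n"
      unfolding VN_def using V_mono[OF t\<^sub>n_mono[OF n]] q_ge_1 by (intro mult_right_mono) auto
    then have v: "norm (v (t\<^sub>n n)) \<le> VN * q ^ n"
      using exact_velocity_bound[OF t\<^sub>n_nonneg, of n] unfolding q_pow by linarith
    have "yn n - y (t\<^sub>n n) = (Pn n - P (t\<^sub>n n)) + (\<epsilon> ^ 3 *\<^sub>R perp (A (t\<^sub>n n, yn n) (vn n))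
        - \<epsilon> ^ 3 *\<^sub>R perp (A (t\<^sub>n n, y (t\<^sub>n n)) (v (t\<^sub>n n))))"
      by (simp add: P_def Pn_def)
    also have "norm \<dots> \<le> p n + (\<epsilon> ^ 3 * M * (VN * q ^ n) + \<epsilon> ^ 3 * M * (VN * q ^ n))"
      unfolding p_def using vn v
      by (intro order_trans[OF norm_triangle_ineq] add_mono order_refl
          order_trans[OF norm_triangle_ineq4] correction) auto
    finally show "e n \<le> p n + 2 * \<epsilon> ^ 3 * M * (VN * q ^ n)" by (simp add: e_def mult_ac)
  qed
  define R where "R = \<epsilon>\<^sup>2 * (2 + 2 * M * VN\<^sup>2 + M * B + 2 * M * (1 + B) * \<epsilon> * VN)"
  define d where "d = B * (1 + K) * \<Delta>t + 2 * K * \<epsilon> ^ 3 * M * VN + 2 * R"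
  have R0: "R \<ge> 0" using M0 B_nonneg eps VN by (simp add: R_def)
  have remainder: "\<epsilon>\<^sup>2 * M * B + 2 * \<epsilon> ^ 3 * (M * (1 + B)) * S + (2 * \<epsilon>\<^sup>2 + 2 * M * (\<epsilon> * S)\<^sup>2) \<le> R * Q\<^sup>2"
    if S: "S = VN * Q" and Q: "Q \<ge> 1" for S Q
  proof -
    have QQ: "1 \<le> Q\<^sup>2" "Q \<le> Q\<^sup>2" using Q by (simp_all add: self_le_power one_le_power)
    have "\<epsilon>\<^sup>2 * M * B + 2 * \<epsilon> ^ 3 * (M * (1 + B)) * S + (2 * \<epsilon>\<^sup>2 + 2 * M * (\<epsilon> * S)\<^sup>2)
        = \<epsilon>\<^sup>2 * ((2 + M * B) * 1 + 2 * M * VN\<^sup>2 * Q\<^sup>2 + 2 * M * (1 + B) * \<epsilon> * VN * Q)"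
      by (simp add: S algebra_simps power2_eq_square power3_eq_cube)
    also have "\<dots> \<le> \<epsilon>\<^sup>2 * ((2 + M * B) * Q\<^sup>2 + 2 * M * VN\<^sup>2 * Q\<^sup>2 + 2 * M * (1 + B) * \<epsilon> * VN * Q\<^sup>2)"
      using QQ M0 B_nonneg eps VN by (intro mult_left_mono add_mono) auto
    also have "\<dots> = R * Q\<^sup>2" by (simp add: R_def algebra_simps)
    finally show ?thesis .
  qed
  have step: "p (Suc n) \<le> q\<^sup>2 * p n + (\<Delta>t * d) * (q\<^sup>2) ^ Suc n" if "n < N" for n
  proof -
    define t t' where "t = t\<^sub>n n" and "t' = t\<^sub>n (Suc n)"
    have t0: "t \<ge> 0" "t' \<ge> 0" by (simp_all add: t_def t'_def)
    have t': "t' = t + \<Delta>t" by (simp add: t_def t'_def t\<^sub>n_Suc)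
    define Q where "Q = q ^ Suc n"
    have Q: "Q \<ge> 1" unfolding Q_def by (rule q_pow_ge_1)
    define S where "S = VN * Q"
    have S0: "S \<ge> 0" using VN Q by (simp add: S_def)
    have vS: "norm (v s) \<le> S" if "t \<le> s" "s \<le> t'" for s
      using exact_speed_in_step[of n N s] \<open>n < N\<close> that by (simp add: S_def Q_def t_def t'_def VN_def)
    have vnS: "norm (vn (Suc n)) \<le> S"
      using discrete_speed_le[of "Suc n" N] \<open>n < N\<close> by (simp add: S_def Q_def VN_def)
    \<comment> \<open>\<open>RQ\<close> bounds the deviation of either corrected velocity from \<open>- E(t, y)\<^sup>\<bottom>\<close> during the step\<close>
    define RQ where "RQ = R * Q\<^sup>2"
    note rem = remainder[OF S_def Q, folded RQ_def]
    have exact: "norm (P t' - P t - (t' - t) *\<^sub>R (- perp (E (t, y t)))) \<le> (B * (1 + K) * \<Delta>t + RQ) * (t' - t)"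
    proof (rule vector_derivative_bound)
      fix s assume s: "t \<le> s" "s \<le> t'"
      then have s0: "0 \<le> s" using t0 by linarith
      define v' where "v' = (1 / \<epsilon>) *\<^sub>R E (s, x s) - (1 / \<epsilon>\<^sup>2) *\<^sub>R perp (v s)"
      define A' where "A' = (\<Sum>i\<in>Basis. (v s \<bullet> i) *\<^sub>R F'' i (s, y s) (1, - perp (E (s, x s))))"
      define P' where "P' = - perp (E (s, x s)) - \<epsilon> ^ 3 *\<^sub>R perp (A (s, y s) v' + A')"
      have dA: "((\<lambda>s. A (s, y s) i) has_vector_derivative F'' i (s, y s) (1, - perp (E (s, x s)))) (at s within {0..})"
        if i: "i \<in> Basis" for i
      proof -
        have "((\<lambda>s. (s, y s)) has_vector_derivative (1, - perp (E (s, x s)))) (at s within {0..})"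
          by (intro has_vector_derivative_Pair y_deriv s0 has_vector_derivative_id)
        from has_derivative_compose[OF this[unfolded has_vector_derivative_def] F'[OF i]]
        show ?thesis
          using has_derivative_linear[OF F'[OF i], of "(s, y s)"]
          unfolding has_vector_derivative_def A_def by (simp only: linear_scale)
      qed
      have "((\<lambda>s. v s \<bullet> i) has_real_derivative v' \<bullet> i) (at s within {0..})" for i
        using bounded_linear.has_vector_derivative[OF bounded_linear_inner_left v_deriv[OF s0], of i]
        by (simp add: has_real_derivative_iff_has_vector_derivative v'_def)
      then have "((\<lambda>s. (v s \<bullet> i) *\<^sub>R A (s, y s) i) has_vector_derivative
          ((v s \<bullet> i) *\<^sub>R F'' i (s, y s) (1, - perp (E (s, x s))) + (v' \<bullet> i) *\<^sub>R A (s, y s) i)) (at s within {0..})"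
        if "i \<in> Basis" for i
        by (intro has_vector_derivative_scaleR dA that)
      then have "((\<lambda>s. \<Sum>i\<in>Basis. (v s \<bullet> i) *\<^sub>R A (s, y s) i) has_vector_derivative
          (\<Sum>i\<in>Basis. (v s \<bullet> i) *\<^sub>R F'' i (s, y s) (1, - perp (E (s, x s))) + (v' \<bullet> i) *\<^sub>R A (s, y s) i)) (at s within {0..})"
        by (intro has_vector_derivative_sum)
      then have "((\<lambda>s. A (s, y s) (v s)) has_vector_derivative A' + A (s, y s) v') (at s within {0..})"
        by (simp only: A'_def sum.distrib A_Basis[of "(_, y _)" "v _", symmetric] A_Basis[of "(s, y s)" v', symmetric])
      then have dP: "(P has_vector_derivative - perp (E (s, x s)) - \<epsilon> ^ 3 *\<^sub>R perp (A' + A (s, y s) v')) (at s within {0..})"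
        unfolding P_def
        by (intro has_vector_derivative_diff y_deriv s0
          bounded_linear.has_vector_derivative[OF bounded_linear_scaleR_right]
          bounded_linear.has_vector_derivative[OF bounded_linear_perp])
      then show "(P has_vector_derivative P') (at s within {0..})" by (simp add: P'_def add.commute)
      have pd: "norm (1 :: real, - perp (E (s, x s))) \<le> 1 + B"
        using norm_Pair_le[of "1::real" "- perp (E (s, x s))"] field_bound[OF s0, of "x s"] by simp
      have "norm A' \<le> 2 * (M * (1 + B)) * norm (v s)"
        unfolding A'_def
        by (intro Basis_sum order_trans[OF F''_bound[OF s0] mult_left_mono[OF pd M0]])
      also have "\<dots> \<le> 2 * (M * (1 + B)) * S"
        using vS[OF s] M0 B_nonneg by (intro mult_left_mono) auto
      finally have "norm (\<epsilon> ^ 3 *\<^sub>R perp A') \<le> \<epsilon> ^ 3 * (2 * (M * (1 + B)) * S)"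
        using eps by (simp add: mult_left_mono)
      then have 1: "norm (\<epsilon> ^ 3 *\<^sub>R perp A') \<le> 2 * \<epsilon> ^ 3 * (M * (1 + B)) * S" by (simp add: algebra_simps)
      have "norm (A (s, y s) (E (s, x s))) \<le> M * B"
        using A_bound[OF s0, of "y s" "E (s, x s)"] mult_left_mono[OF field_bound[OF s0, of "x s"] M0] by linarith
      then have 2: "norm (\<epsilon>\<^sup>2 *\<^sub>R perp (A (s, y s) (E (s, x s)))) \<le> \<epsilon>\<^sup>2 * M * B"
        by (simp add: mult.assoc mult_left_mono)
      have "norm (\<epsilon> *\<^sub>R perp (v s)) \<le> \<epsilon> * S" using vS[OF s] eps by simp
      then have "2 * M * (norm (\<epsilon> *\<^sub>R perp (v s)))\<^sup>2 \<le> 2 * M * (\<epsilon> * S)\<^sup>2"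
        using M0 by (intro mult_left_mono power_mono) auto
      then have 3: "norm (perp (E (s, x s) - (E (s, y s) + A (s, y s) (\<epsilon> *\<^sub>R perp (v s))))) \<le> 2 * \<epsilon>\<^sup>2 + 2 * M * (\<epsilon> * S)\<^sup>2"
        using taylor[OF s0, of "y s" "\<epsilon> *\<^sub>R perp (v s)"] by (simp add: x_eq)
      have "norm (y s - y t) \<le> B * \<Delta>t"
        using y_lipschitz[OF t0(1) s(1)] mult_left_mono[OF _ B_nonneg, of "s - t" \<Delta>t] s t' by linarith
      then have "B * \<bar>s - t\<bar> + K * norm (y s - y t) \<le> B * \<Delta>t + K * (B * \<Delta>t)"
        using s t' B_nonneg K_nonneg by (intro add_mono mult_left_mono) auto
      then have 4: "norm (perp (E (s, y s) - E (t, y t))) \<le> B * (1 + K) * \<Delta>t"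
        using field_difference[OF s0 t0(1), of "y s" "y t"] by (simp add: algebra_simps)
      \<comment> \<open>the equation for \<open>v'\<close>, solved for the rotated velocity: the correction absorbs the oscillating term\<close>
      have "\<epsilon> ^ 3 *\<^sub>R A (s, y s) v' = \<epsilon>\<^sup>2 *\<^sub>R A (s, y s) (E (s, x s)) - A (s, y s) (\<epsilon> *\<^sub>R perp (v s))"
        unfolding v'_def A_diff A_scale using eps
        by (simp add: scaleR_diff_right power2_eq_square power3_eq_cube)
      then have "P' - - perp (E (t, y t)) = - (\<epsilon>\<^sup>2 *\<^sub>R perp (A (s, y s) (E (s, x s)))
          + \<epsilon> ^ 3 *\<^sub>R perp A' + perp (E (s, x s) - (E (s, y s) + A (s, y s) (\<epsilon> *\<^sub>R perp (v s))))
          + perp (E (s, y s) - E (t, y t)))"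
        unfolding P'_def by (simp add: perp_simps scaleR_add_right flip: perp_scaleR)
      also have "norm \<dots> \<le> \<epsilon>\<^sup>2 * M * B + 2 * \<epsilon> ^ 3 * (M * (1 + B)) * S
          + (2 * \<epsilon>\<^sup>2 + 2 * M * (\<epsilon> * S)\<^sup>2) + B * (1 + K) * \<Delta>t"
        unfolding norm_minus_cancel by (intro norm_triangle_mono 1 2 3 4)
      finally show "norm (P' - - perp (E (t, y t))) \<le> B * (1 + K) * \<Delta>t + RQ"
        using rem by linarith
    qed (use t0 t' dt in auto)
    have discrete: "norm (Pn (Suc n) - Pn n + \<Delta>t *\<^sub>R perp (E (t, yn n))) \<le> RQ * \<Delta>t"
    proof -
      let ?v = "vn (Suc n)" and ?Ex = "E (t, yn n + \<epsilon> *\<^sub>R perp (vn n))"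
      let ?h = "\<epsilon> *\<^sub>R perp (vn (Suc n))"
      let ?A = "A (t, yn n)" and ?A' = "A (t', yn (Suc n))"
      have dy: "norm (yn (Suc n) - yn n) \<le> B * \<Delta>t"
        unfolding yn_Suc using field_bound[of "t\<^sub>n n"] dt by (simp add: mult.commute)
      have "norm (?A' ?v - ?A ?v) \<le> 2 * (M * (\<bar>t' - t\<bar> + norm (yn (Suc n) - yn n))) * norm ?v"
        by (rule A_lipschitz[OF t0(2,1)])
      also have "\<dots> \<le> 2 * (M * (\<Delta>t + B * \<Delta>t)) * S"
        using dy vnS t' dt M0 B_nonneg S0 by (intro mult_mono mult_left_mono add_mono) auto
      also have "\<dots> = \<Delta>t * (2 * (M * (1 + B)) * S)" by (simp add: algebra_simps)
      finally have "norm (\<epsilon> ^ 3 *\<^sub>R perp (?A' ?v - ?A ?v)) \<le> \<epsilon> ^ 3 * (\<Delta>t * (2 * (M * (1 + B)) * S))"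
        using eps by (simp add: mult_left_mono)
      then have 1: "norm (\<epsilon> ^ 3 *\<^sub>R perp (?A' ?v - ?A ?v)) \<le> \<Delta>t * (2 * \<epsilon> ^ 3 * (M * (1 + B)) * S)"
        by (simp add: algebra_simps)
      have "norm (?A ?Ex) \<le> M * B"
        using A_bound[OF t0(1), of "yn n" ?Ex] mult_left_mono[OF field_bound[OF t0(1)] M0] order_trans by blast
      then have "\<epsilon>\<^sup>2 * norm (?A ?Ex) \<le> \<epsilon>\<^sup>2 * M * B" by (simp add: mult.assoc mult_left_mono)
      then have 2: "norm (\<Delta>t *\<^sub>R \<epsilon>\<^sup>2 *\<^sub>R perp (?A ?Ex)) \<le> \<Delta>t * (\<epsilon>\<^sup>2 * M * B)"
        using dt by simp
      have "norm ?h \<le> \<epsilon> * S" using vnS eps by simp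
      then have "2 * M * (norm ?h)\<^sup>2 \<le> 2 * M * (\<epsilon> * S)\<^sup>2"
        using M0 by (intro mult_left_mono power_mono) auto
      then have "norm (E (t, yn n + ?h) - (E (t, yn n) + ?A ?h)) \<le> 2 * \<epsilon>\<^sup>2 + 2 * M * (\<epsilon> * S)\<^sup>2"
        using taylor[OF t0(1), of "yn n" ?h] by linarith
      then have 3: "norm (\<Delta>t *\<^sub>R perp (E (t, yn n + ?h) - (E (t, yn n) + ?A ?h))) \<le> \<Delta>t * (2 * \<epsilon>\<^sup>2 + 2 * M * (\<epsilon> * S)\<^sup>2)"
        using dt by simp
      \<comment> \<open>the discrete counterpart: the implicit step, solved for the rotated new velocity\<close>
      have "\<Delta>t *\<^sub>R perp ?v = \<epsilon>\<^sup>2 *\<^sub>R ((\<Delta>t / \<epsilon>\<^sup>2) *\<^sub>R perp ?v)" using eps by simp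
      also have "(\<Delta>t / \<epsilon>\<^sup>2) *\<^sub>R perp ?v = vn n + (\<Delta>t / \<epsilon>) *\<^sub>R ?Ex - ?v"
        using vn_Suc[of n] unfolding t_def by (simp add: algebra_simps)
      finally have v_step: "\<Delta>t *\<^sub>R perp ?v = \<epsilon>\<^sup>2 *\<^sub>R (vn n + (\<Delta>t / \<epsilon>) *\<^sub>R ?Ex - ?v)" .
      have "\<epsilon> *\<^sub>R (\<Delta>t *\<^sub>R perp ?v) = (\<epsilon>\<^sup>2 * \<Delta>t) *\<^sub>R ?Ex - \<epsilon> ^ 3 *\<^sub>R (?v - vn n)"
        unfolding v_step using eps by (simp add: algebra_simps power2_eq_square power3_eq_cube)
      moreover have "\<Delta>t *\<^sub>R ?A ?h = ?A (\<epsilon> *\<^sub>R (\<Delta>t *\<^sub>R perp ?v))" by (simp add: A_scale mult.commute)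
      ultimately have Ah: "\<Delta>t *\<^sub>R ?A ?h = (\<epsilon>\<^sup>2 * \<Delta>t) *\<^sub>R ?A ?Ex - \<epsilon> ^ 3 *\<^sub>R (?A ?v - ?A (vn n))"
        by (simp add: A_scale A_diff)
      have "\<Delta>t *\<^sub>R E (t, yn n + ?h)
          = \<Delta>t *\<^sub>R (E (t, yn n + ?h) - (E (t, yn n) + ?A ?h)) + \<Delta>t *\<^sub>R E (t, yn n)
            + ((\<epsilon>\<^sup>2 * \<Delta>t) *\<^sub>R ?A ?Ex - \<epsilon> ^ 3 *\<^sub>R (?A ?v - ?A (vn n)))"
        unfolding Ah[symmetric] by (simp add: scaleR_diff_right scaleR_add_right)
      from arg_cong[OF this, of perp]
      have Eh: "\<Delta>t *\<^sub>R perp (E (t, yn n + ?h))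
          = \<Delta>t *\<^sub>R perp (E (t, yn n + ?h) - (E (t, yn n) + ?A ?h)) + \<Delta>t *\<^sub>R perp (E (t, yn n))
            + ((\<epsilon>\<^sup>2 * \<Delta>t) *\<^sub>R perp (?A ?Ex) - \<epsilon> ^ 3 *\<^sub>R perp (?A ?v - ?A (vn n)))"
        by (simp only: perp_add perp_diff perp_scaleR)
      have "Pn (Suc n) - Pn n + \<Delta>t *\<^sub>R perp (E (t, yn n))
          = - \<Delta>t *\<^sub>R perp (E (t, yn n + ?h)) + \<Delta>t *\<^sub>R perp (E (t, yn n))
            - \<epsilon> ^ 3 *\<^sub>R perp (?A' ?v) + \<epsilon> ^ 3 *\<^sub>R perp (?A (vn n))"
        unfolding Pn_def using yn_Suc[of n] by (simp add: t_def t'_def)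
      also have "\<dots> = - (\<Delta>t *\<^sub>R \<epsilon>\<^sup>2 *\<^sub>R perp (?A ?Ex) + \<epsilon> ^ 3 *\<^sub>R perp (?A' ?v - ?A ?v)
          + \<Delta>t *\<^sub>R perp (E (t, yn n + ?h) - (E (t, yn n) + ?A ?h)))"
        unfolding scaleR_minus_left Eh by (simp add: perp_diff scaleR_diff_right mult.commute)
      also have "norm \<dots> \<le> \<Delta>t * (\<epsilon>\<^sup>2 * M * B) + \<Delta>t * (2 * \<epsilon> ^ 3 * (M * (1 + B)) * S)
          + \<Delta>t * (2 * \<epsilon>\<^sup>2 + 2 * M * (\<epsilon> * S)\<^sup>2)"
        unfolding norm_minus_cancel by (intro norm_triangle_mono 1 2 3)
      also have "\<dots> = \<Delta>t * (\<epsilon>\<^sup>2 * M * B + 2 * \<epsilon> ^ 3 * (M * (1 + B)) * S + (2 * \<epsilon>\<^sup>2 + 2 * M * (\<epsilon> * S)\<^sup>2))"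
        by (simp add: algebra_simps)
      also have "\<dots> \<le> \<Delta>t * RQ" using rem dt by (intro mult_left_mono) auto
      finally show ?thesis by (simp add: mult.commute)
    qed
    have "norm (E (t, yn n) - E (t, y t)) \<le> K * e n"
      using space_lipschitz[OF t0(1), of "yn n" "y t"] by (simp add: e_def t_def)
    then have diff: "norm (\<Delta>t *\<^sub>R perp (E (t, yn n) - E (t, y t))) \<le> \<Delta>t * (K * e n)" using dt by simp
    have ee: "e n \<le> p n + 2 * \<epsilon> ^ 3 * M * (VN * Q)"
    proof -
      have "VN * q ^ n \<le> VN * Q" unfolding Q_def using q_ge_1 VN
        by (intro mult_left_mono power_increasing) auto
      then have "2 * \<epsilon> ^ 3 * M * (VN * q ^ n) \<le> 2 * \<epsilon> ^ 3 * M * (VN * Q)"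
        by (rule mult_left_mono) (use M0 eps in simp)
      then show ?thesis using e_le_p[of n] \<open>n < N\<close> by simp
    qed
    have "Pn (Suc n) - P t' = (Pn n - P t) + (Pn (Suc n) - Pn n + \<Delta>t *\<^sub>R perp (E (t, yn n)))
        + (- (P t' - P t - (t' - t) *\<^sub>R (- perp (E (t, y t)))))
        + (- (\<Delta>t *\<^sub>R perp (E (t, yn n) - E (t, y t))))"
      by (simp add: t' perp_simps algebra_simps)
    also have "norm \<dots> \<le> norm (Pn n - P t) + RQ * \<Delta>t + (B * (1 + K) * \<Delta>t + RQ) * (t' - t) + \<Delta>t * (K * e n)"
      by (intro norm_triangle_mono order_refl discrete exact diff norm_minus_cancel[THEN eq_refl, THEN order_trans])
    finally have "p (Suc n) \<le> p n + RQ * \<Delta>t + (B * (1 + K) * \<Delta>t + RQ) * \<Delta>t + \<Delta>t * (K * e n)"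
      by (simp add: p_def t_def t'_def t\<^sub>n_Suc)
    also have "\<dots> \<le> p n + RQ * \<Delta>t + (B * (1 + K) * \<Delta>t + RQ) * \<Delta>t
        + \<Delta>t * (K * (p n + 2 * \<epsilon> ^ 3 * M * (VN * Q)))"
      using ee dt K_nonneg by (intro add_left_mono mult_left_mono) auto
    also have "\<dots> = (1 + K * \<Delta>t) * p n
        + \<Delta>t * (B * (1 + K) * \<Delta>t * 1 + 2 * K * \<epsilon> ^ 3 * M * VN * Q + 2 * R * Q\<^sup>2)"
      by (simp add: RQ_def algebra_simps)
    also have "\<dots> \<le> q\<^sup>2 * p n
        + \<Delta>t * (B * (1 + K) * \<Delta>t * Q\<^sup>2 + 2 * K * \<epsilon> ^ 3 * M * VN * Q\<^sup>2 + 2 * R * Q\<^sup>2)"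
    proof -
      have "q \<le> q\<^sup>2" using q_ge_1 by (simp add: self_le_power)
      moreover have "1 \<le> Q\<^sup>2" "Q \<le> Q\<^sup>2" using Q by (simp_all add: self_le_power one_le_power)
      ultimately show ?thesis
        using q_ge dt B_nonneg K_nonneg M0 eps VN R0
        by (intro add_mono mult_right_mono mult_left_mono) (auto simp: p_def)
    qed
    also have "\<dots> = q\<^sup>2 * p n + (\<Delta>t * d) * (q\<^sup>2) ^ Suc n"
    proof -
      have "Q\<^sup>2 = (q\<^sup>2) ^ Suc n" unfolding Q_def by (simp only: power_mult[symmetric] mult.commute)
      then show ?thesis by (simp only: d_def distrib_right distrib_left mult.assoc)
    qed
    finally show ?thesis .
  qed
  have "p N \<le> (p 0 + real N * (\<Delta>t * d)) * (q\<^sup>2) ^ N"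
    by (rule discrete_gronwall[of N]) (use step in auto)
  moreover have "p 0 = 0" by (simp add: p_def P_def Pn_def yn_0 vn_0 v_0)
  moreover have q2: "(q\<^sup>2) ^ N = exp (2 * K * t\<^sub>n N)"
    using q_pow[of N] by (simp add: power2_eq_square power_mult_distrib mult.assoc flip: exp_add)
  ultimately have pN: "p N \<le> t\<^sub>n N * d * exp (2 * K * t\<^sub>n N)"
    by (simp add: t\<^sub>n_def mult.assoc)
  have "2 * \<epsilon> ^ 3 * M * VN * q ^ N \<le> 2 * \<epsilon> ^ 3 * M * VN * exp (2 * K * t\<^sub>n N)"
    unfolding q_pow using M0 eps VN K_nonneg by (intro mult_left_mono) auto
  then have "e N \<le> (t\<^sub>n N * d + 2 * \<epsilon> ^ 3 * M * VN) * exp (2 * K * t\<^sub>n N)"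
    using e_le_p[of N] pN by (simp add: distrib_right mult.assoc)
  also have "d = B * (1 + K) * \<Delta>t + \<epsilon>\<^sup>2 * (2 * K * M * \<epsilon> * VN + 4 + 4 * M * VN\<^sup>2
          + 2 * M * B + 4 * M * (1 + B) * \<epsilon> * VN)"
    by (simp add: d_def R_def algebra_simps power2_eq_square power3_eq_cube)
  finally show ?thesis unfolding e_def VN_def .
qed

lemma y_error_le_asymptotic_second_order:
  shows "norm (yn N - y (t\<^sub>n N))
    \<le> second_const * (1 + t\<^sub>n N) ^ 3 * exp ((2 + K * \<Delta>t) * K * t\<^sub>n N) * (1 + (norm v0)\<^sup>2 + \<epsilon>\<^sup>2) * (\<Delta>t + \<epsilon>\<^sup>2)"
proof -
  define T where "T = t\<^sub>n N"
  define a where "a = 1 + T"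
  define W W2 where "W = 1 + norm v0 + \<epsilon>" and "W2 = 1 + (norm v0)\<^sup>2 + \<epsilon>\<^sup>2"
  define c where "c = 1 + c\<^sub>v"
  define k where "k = 4 * K * M * c + 4 + 12 * M * c\<^sup>2 + 2 * M * B + 8 * M * (1 + B) * c"
  have T: "T \<ge> 0" by (simp add: T_def)
  have a: "a \<ge> 1" "T \<le> a" using T by (simp_all add: a_def)
  have W2: "W2 \<ge> 1" by (simp add: W2_def)
  have c: "c \<ge> 1" using c\<^sub>v_nonneg by (simp add: c_def)
  have M: "M \<ge> 0" by (rule M_nonneg)
  have W: "W \<ge> 0" using eps by (simp add: W_def)
  have sq: "2 * (\<epsilon> * norm v0) \<le> \<epsilon>\<^sup>2 + (norm v0)\<^sup>2" "2 * \<epsilon> \<le> 1 + \<epsilon>\<^sup>2" "2 * norm v0 \<le> 1 + (norm v0)\<^sup>2"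
    using sum_squares_bound[of \<epsilon> "norm v0"] sum_squares_bound[of 1 \<epsilon>] sum_squares_bound[of 1 "norm v0"] by simp_all
  have "\<epsilon> * W = \<epsilon> + \<epsilon> * norm v0 + \<epsilon>\<^sup>2" by (simp add: W_def algebra_simps power2_eq_square)
  moreover have "0 \<le> (norm v0)\<^sup>2" "0 \<le> \<epsilon>\<^sup>2" by simp_all
  ultimately have \<epsilon>W: "\<epsilon> * W \<le> 2 * W2" using sq unfolding W2_def by argo
  have "W\<^sup>2 = 1 + (norm v0)\<^sup>2 + \<epsilon>\<^sup>2 + 2 * \<epsilon> + 2 * norm v0 + 2 * (\<epsilon> * norm v0)"
    by (simp add: W_def algebra_simps power2_eq_square)
  then have WW: "W\<^sup>2 \<le> 3 * W2" using sq unfolding W2_def by argo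
  have V: "V T \<le> c * (a * W)" unfolding a_def W_def c_def by (rule V_le[OF T])
  have V0: "V T \<ge> 0" by (rule V_nonneg[OF T])
  have a2: "a \<le> a\<^sup>2" "1 \<le> a\<^sup>2" using a by (simp_all add: self_le_power one_le_power)
  have "\<epsilon> * V T \<le> \<epsilon> * (c * (a * W))" using V eps by (intro mult_left_mono) auto
  also have "\<dots> = (c * a) * (\<epsilon> * W)" by simp
  also have "\<dots> \<le> (c * a) * (2 * W2)" using \<epsilon>W c a by (intro mult_left_mono) auto
  finally have \<epsilon>V1: "\<epsilon> * V T \<le> 2 * c * (a * W2)" by simp
  also have "\<dots> \<le> 2 * c * (a\<^sup>2 * W2)" using a2 c W2 by (intro mult_left_mono mult_right_mono) auto
  finally have \<epsilon>V: "\<epsilon> * V T \<le> 2 * c * (a\<^sup>2 * W2)" .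
  have "(V T)\<^sup>2 \<le> (c * (a * W))\<^sup>2" using V V0 by (intro power_mono)
  also have "\<dots> = c\<^sup>2 * a\<^sup>2 * W\<^sup>2" by (simp add: power_mult_distrib)
  also have "\<dots> \<le> c\<^sup>2 * a\<^sup>2 * (3 * W2)" using WW by (intro mult_left_mono) auto
  finally have VV: "(V T)\<^sup>2 \<le> 3 * c\<^sup>2 * (a\<^sup>2 * W2)" by simp
  have aW2: "1 \<le> a\<^sup>2 * W2" using a2 W2 mult_mono[of 1 "a\<^sup>2" 1 W2] by simp
  have X: "2 * K * M * (\<epsilon> * V T) + 4 + 4 * M * (V T)\<^sup>2 + 2 * M * B + 4 * M * (1 + B) * (\<epsilon> * V T)
      \<le> k * (a\<^sup>2 * W2)"
  proof -
    have "2 * K * M * (\<epsilon> * V T) \<le> 2 * K * M * (2 * c * (a\<^sup>2 * W2))"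
      using \<epsilon>V K_nonneg M by (intro mult_left_mono) auto
    moreover have "4 * M * (V T)\<^sup>2 \<le> 4 * M * (3 * c\<^sup>2 * (a\<^sup>2 * W2))"
      using VV M by (intro mult_left_mono) auto
    moreover have "4 * M * (1 + B) * (\<epsilon> * V T) \<le> 4 * M * (1 + B) * (2 * c * (a\<^sup>2 * W2))"
      using \<epsilon>V B_nonneg M by (intro mult_left_mono) auto
    moreover have "2 * M * B * 1 \<le> 2 * M * B * (a\<^sup>2 * W2)"
      using aW2 B_nonneg M by (intro mult_left_mono) auto
    ultimately have "2 * K * M * (\<epsilon> * V T) + 4 + 4 * M * (V T)\<^sup>2 + 2 * M * B + 4 * M * (1 + B) * (\<epsilon> * V T)
        \<le> 2 * K * M * (2 * c * (a\<^sup>2 * W2)) + 4 * (a\<^sup>2 * W2) + 4 * M * (3 * c\<^sup>2 * (a\<^sup>2 * W2))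
          + 2 * M * B * (a\<^sup>2 * W2) + 4 * M * (1 + B) * (2 * c * (a\<^sup>2 * W2))"
      using aW2 by linarith
    also have "\<dots> = k * (a\<^sup>2 * W2)" unfolding k_def by (simp only: distrib_right mult.assoc) simp
    finally show ?thesis .
  qed
  have k0: "k \<ge> 0" using K_nonneg M B_nonneg c by (simp add: k_def)
  have "norm (yn N - y T) \<le> (T * (B * (1 + K) * \<Delta>t + \<epsilon>\<^sup>2 * (2 * K * M * \<epsilon> * V T + 4 + 4 * M * (V T)\<^sup>2
          + 2 * M * B + 4 * M * (1 + B) * \<epsilon> * V T)) + 2 * \<epsilon> ^ 3 * M * V T) * exp (2 * K * T)"
    unfolding T_def by (rule y_error_le_second_order)
  also have "\<dots> = (T * (B * (1 + K)) * \<Delta>t + \<epsilon>\<^sup>2 * (T * (2 * K * M * (\<epsilon> * V T) + 4 + 4 * M * (V T)\<^sup>2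
          + 2 * M * B + 4 * M * (1 + B) * (\<epsilon> * V T)) + 2 * M * (\<epsilon> * V T))) * exp (2 * K * T)"
    by (simp add: algebra_simps power2_eq_square power3_eq_cube)
  also have "\<dots> \<le> (second_const * (a ^ 3 * W2) * (\<Delta>t + \<epsilon>\<^sup>2)) * exp ((2 + K * \<Delta>t) * K * T)"
  proof (rule mult_mono[OF _ exp_rate_le(2)[OF T]])
    have a3: "a \<le> a ^ 3" using a by (simp add: self_le_power)
    have a3_eq: "a * (a\<^sup>2 * W2) = a ^ 3 * W2" by (simp add: power2_eq_square power3_eq_cube)
    have "T \<le> a ^ 3 * W2" using a a3 W2 mult_mono[of T "a ^ 3" 1 W2] by simp
    then have 1: "T * (B * (1 + K)) * \<Delta>t \<le> (a ^ 3 * W2) * (B * (1 + K)) * \<Delta>t"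
      using B_nonneg K_nonneg dt by (intro mult_right_mono) auto
    have "T * (2 * K * M * (\<epsilon> * V T) + 4 + 4 * M * (V T)\<^sup>2 + 2 * M * B + 4 * M * (1 + B) * (\<epsilon> * V T))
        \<le> a * (k * (a\<^sup>2 * W2))"
      using X a T K_nonneg M eps V0 B_nonneg by (intro mult_mono) auto
    also have "\<dots> = k * (a ^ 3 * W2)" using a3_eq by simp
    finally have 2: "T * (2 * K * M * (\<epsilon> * V T) + 4 + 4 * M * (V T)\<^sup>2 + 2 * M * B + 4 * M * (1 + B) * (\<epsilon> * V T))
        \<le> k * (a ^ 3 * W2)" .
    have "2 * M * (\<epsilon> * V T) \<le> 2 * M * (2 * c * (a * W2))" using \<epsilon>V1 M by (intro mult_left_mono) auto
    also have "\<dots> \<le> 2 * M * (2 * c * (a ^ 3 * W2))"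
      using a3 M c W2 by (intro mult_left_mono mult_right_mono) auto
    finally have 3: "2 * M * (\<epsilon> * V T) \<le> 4 * M * c * (a ^ 3 * W2)" by simp
    have 4: "\<epsilon>\<^sup>2 * (T * (2 * K * M * (\<epsilon> * V T) + 4 + 4 * M * (V T)\<^sup>2 + 2 * M * B + 4 * M * (1 + B) * (\<epsilon> * V T))
        + 2 * M * (\<epsilon> * V T)) \<le> \<epsilon>\<^sup>2 * (k * (a ^ 3 * W2) + 4 * M * c * (a ^ 3 * W2))"
      using add_mono[OF 2 3] by (rule mult_left_mono) simp
    have "0 \<le> B * (1 + K) * (a ^ 3 * W2) * \<epsilon>\<^sup>2" "0 \<le> (k + 4 * M * c) * (a ^ 3 * W2) * \<Delta>t"
      using B_nonneg K_nonneg a W2 eps dt k0 M c by auto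
    moreover have "second_const = B * (1 + K) + (k + 4 * M * c)" by (simp add: second_const_def k_def c_def)
    then have "second_const * (a ^ 3 * W2) * (\<Delta>t + \<epsilon>\<^sup>2) = (a ^ 3 * W2) * (B * (1 + K)) * \<Delta>t
        + \<epsilon>\<^sup>2 * (k * (a ^ 3 * W2) + 4 * M * c * (a ^ 3 * W2))
        + B * (1 + K) * (a ^ 3 * W2) * \<epsilon>\<^sup>2 + (k + 4 * M * c) * (a ^ 3 * W2) * \<Delta>t"
      by (simp only:) (simp add: algebra_simps)
    ultimately show "T * (B * (1 + K)) * \<Delta>t + \<epsilon>\<^sup>2 * (T * (2 * K * M * (\<epsilon> * V T) + 4 + 4 * M * (V T)\<^sup>2
          + 2 * M * B + 4 * M * (1 + B) * (\<epsilon> * V T)) + 2 * M * (\<epsilon> * V T)) \<le> second_const * (a ^ 3 * W2) * (\<Delta>t + \<epsilon>\<^sup>2)"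
      using 1 4 by linarith
    show "0 \<le> second_const * (a ^ 3 * W2) * (\<Delta>t + \<epsilon>\<^sup>2)"
      using \<open>second_const = B * (1 + K) + (k + 4 * M * c)\<close> B_nonneg K_nonneg a W2 dt k0 M c by simp
  qed auto
  finally show ?thesis unfolding T_def a_def W2_def by (simp add: mult_ac)
qed

text \<open>The two entries of the minimum; the conversion of the weight \<open>1 + \<bar>v0\<bar> + \<epsilon>\<close> of the coupled estimate
  into \<open>1 + \<bar>v0\<bar>\<^sup>2 + \<epsilon>\<^sup>2\<close> costs the power of \<open>\<epsilon>\<close> by which the two first entries differ.\<close>

lemma y_error_bound:
  shows "norm (yn N - y (t\<^sub>n N))
    \<le> 8 * (second_const + 2 * conv_const) * (1 + t\<^sub>n N ^ 4) * exp ((2 + K * \<Delta>t) * K * t\<^sub>n N) * (1 + (norm v0)\<^sup>2 + \<epsilon>\<^sup>2)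
      * min (\<Delta>t / \<epsilon> ^ 3 * (1 + \<epsilon>)) (\<Delta>t + \<epsilon>\<^sup>2)"
proof -
  define T where "T = t\<^sub>n N"
  define Y where "Y = exp ((2 + K * \<Delta>t) * K * T)"
  define W2 where "W2 = 1 + (norm v0)\<^sup>2 + \<epsilon>\<^sup>2"
  define X where "X = Y * W2"
  define C where "C = 8 * (second_const + 2 * conv_const)"
  have T: "T \<ge> 0" by (simp add: T_def)
  have X0: "X \<ge> 0" by (simp add: X_def Y_def W2_def)
  have T4: "(1 + T) ^ 4 \<le> 8 * (1 + T ^ 4)" using one_plus_power_bounds[OF T] by simp
  have "(1 + T) ^ 3 \<le> (1 + T) ^ 4" "(1 + T) ^ 2 \<le> (1 + T) ^ 4" using T by (auto intro!: power_increasing)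
  then have T3: "(1 + T) ^ 3 \<le> 8 * (1 + T ^ 4)" "(1 + T) ^ 2 \<le> 8 * (1 + T ^ 4)" using T4 by simp_all
  have T40: "1 + T ^ 4 \<ge> 0" using T by simp
  have le: "C' * r * (X * b) \<le> C * (1 + T ^ 4) * (X * b)"
    if "r \<le> 8 * (1 + T ^ 4)" "b \<ge> 0" "C' \<ge> 0" "8 * C' \<le> C" for C' r b
  proof (rule mult_right_mono)
    have "C' * r \<le> C' * (8 * (1 + T ^ 4))" using that by (intro mult_left_mono) auto
    also have "\<dots> = 8 * C' * (1 + T ^ 4)" by simp
    also have "\<dots> \<le> C * (1 + T ^ 4)" by (rule mult_right_mono[OF that(4) T40])
    finally show "C' * r \<le> C * (1 + T ^ 4)" .
  qed (use that X0 in simp)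
  have "norm (yn N - y T) \<le> second_const * (1 + T) ^ 3 * (X * (\<Delta>t + \<epsilon>\<^sup>2))"
    using y_error_le_asymptotic_second_order[of N] unfolding T_def X_def Y_def W2_def 
    by (simp only: mult.assoc)
  also have "\<dots> \<le> C * (1 + T ^ 4) * (X * (\<Delta>t + \<epsilon>\<^sup>2))"
    using T3 dt second_const_nonneg conv_const_nonneg by (intro le) (auto simp: C_def)
  finally have asym: "norm (yn N - y T) \<le> C * (1 + T ^ 4) * (X * (\<Delta>t + \<epsilon>\<^sup>2))" .
  have weight: "(1 + norm v0 + \<epsilon>) * (1 + \<epsilon>\<^sup>2) \<le> 2 * (W2 * (1 + \<epsilon>))"
  proof -
    have "0 \<le> (1 - norm v0)\<^sup>2 + 1 + 3 * (norm v0)\<^sup>2 + 2 * \<epsilon> + 2 * \<epsilon>\<^sup>2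
        + \<epsilon> * ((norm v0 - \<epsilon>)\<^sup>2 + 3 * (norm v0)\<^sup>2 + \<epsilon>\<^sup>2)"
      using eps by simp
    then show ?thesis
      using eps by (simp add: W2_def algebra_simps power2_eq_square power3_eq_cube)
  qed
  have "norm (yn N - y T) \<le> norm (yn N - y T) + \<epsilon> * norm (vn N - v T)" using eps by simp
  also have "\<dots> \<le> conv_const * (1 + T) ^ 2 * Y * (1 + norm v0 + \<epsilon>) * (\<Delta>t / \<epsilon> ^ 3 * (1 + \<epsilon>\<^sup>2))"
    using total_error_le_convergent[of N] unfolding T_def Y_def  .
  also have "\<dots> = conv_const * (1 + T) ^ 2 * Y * (\<Delta>t / \<epsilon> ^ 3) * ((1 + norm v0 + \<epsilon>) * (1 + \<epsilon>\<^sup>2))" by simp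
  also have "\<dots> \<le> conv_const * (1 + T) ^ 2 * Y * (\<Delta>t / \<epsilon> ^ 3) * (2 * (W2 * (1 + \<epsilon>)))"
    using weight second_const_nonneg conv_const_nonneg T dt eps by (intro mult_left_mono) (auto simp: Y_def)
  also have "\<dots> = (2 * conv_const) * (1 + T) ^ 2 * (X * (\<Delta>t / \<epsilon> ^ 3 * (1 + \<epsilon>)))" by (simp add: X_def)
  also have "\<dots> \<le> C * (1 + T ^ 4) * (X * (\<Delta>t / \<epsilon> ^ 3 * (1 + \<epsilon>)))"
    using T3 eps dt second_const_nonneg conv_const_nonneg by (intro le) (auto simp: C_def)
  finally have "norm (yn N - y T) \<le> C * (1 + T ^ 4) * (X * min (\<Delta>t / \<epsilon> ^ 3 * (1 + \<epsilon>)) (\<Delta>t + \<epsilon>\<^sup>2))"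
    using asym by (simp add: min_def)
  then show ?thesis unfolding T_def X_def Y_def W2_def C_def by (simp only: mult.assoc)
qed

end

lemma (in bounded_C11_field) scheme_y_error:
  "\<exists>C. \<forall>\<epsilon>>0. \<forall>\<Delta>t>0. \<forall>x0 v0 yn vn x v.
    scheme E \<epsilon> \<Delta>t x0 v0 yn vn \<longrightarrow> exact_solution E \<epsilon> x0 v0 x v \<longrightarrow>
    (\<forall>n. let t = real n * \<Delta>t in
      norm (yn n - (x t - \<epsilon> *\<^sub>R perp (v t)))
        \<le> C * (1 + t ^ 4) * exp ((2 + K * \<Delta>t) * K * t) * (1 + (norm v0)\<^sup>2 + \<epsilon>\<^sup>2)
            * min (\<Delta>t / \<epsilon> ^ 3 * (1 + \<epsilon>)) (\<Delta>t + \<epsilon>\<^sup>2))"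
proof (rule exI, intro allI impI)
  fix \<epsilon> \<Delta>t :: real and x0 v0 yn vn x v n
  assume "\<epsilon> > 0" "\<Delta>t > 0" "scheme E \<epsilon> \<Delta>t x0 v0 yn vn" "exact_solution E \<epsilon> x0 v0 x v"
  then interpret C11_scheme_and_flow E B K \<epsilon> \<Delta>t x0 v0 yn vn x v M by unfold_locales
  show "let t = real n * \<Delta>t in
      norm (yn n - (x t - \<epsilon> *\<^sub>R perp (v t)))
        \<le> 8 * (second_const + 2 * conv_const) * (1 + t ^ 4) * exp ((2 + K * \<Delta>t) * K * t) * (1 + (norm v0)\<^sup>2 + \<epsilon>\<^sup>2)
            * min (\<Delta>t / \<epsilon> ^ 3 * (1 + \<epsilon>)) (\<Delta>t + \<epsilon>\<^sup>2)"
    unfolding Let_def using y_error_bound[of n] unfolding t\<^sub>n_def y_def .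
qed

section \<open>Error estimates for the scheme\<close>

theorem theorem4p1:
  fixes E :: "real \<times> (real^2) \<Rightarrow> real^2"
  shows
    "(\<forall>\<epsilon>>0. \<forall>\<Delta>t>0. \<forall>x0 v0. \<exists>!yv. scheme E \<epsilon> \<Delta>t x0 v0 (fst yv) (snd yv)) \<and>
     (field_W_infinity 1 E \<longrightarrow>
       (\<exists>C. \<forall>\<epsilon>>0. \<forall>\<Delta>t>0. \<forall>x0 v0 yn vn x v.
          scheme E \<epsilon> \<Delta>t x0 v0 yn vn \<longrightarrow> exact_solution E \<epsilon> x0 v0 x v \<longrightarrow>
          (\<forall>n. let t = real n * \<Delta>t in
            norm ((yn n + \<epsilon> *\<^sub>R (vn n)\<^sup>\<bottom>) - x t)
              \<le> C * (1 + t ^ 3) * exp ((2 + K\<^sub>x E * \<Delta>t) * K\<^sub>x E * t) * (1 + norm v0 + \<epsilon>)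
                  * min (\<Delta>t / \<epsilon> ^ 3 * (1 + \<epsilon>\<^sup>2)) (\<Delta>t + \<epsilon>)))) \<and>
     (field_W_infinity 2 E \<longrightarrow>
       (\<exists>C. \<forall>\<epsilon>>0. \<forall>\<Delta>t>0. \<forall>x0 v0 yn vn x v.
          scheme E \<epsilon> \<Delta>t x0 v0 yn vn \<longrightarrow> exact_solution E \<epsilon> x0 v0 x v \<longrightarrow>
          (\<forall>n. let t = real n * \<Delta>t in
            norm (yn n - (x t - \<epsilon> *\<^sub>R (v t)\<^sup>\<bottom>))
              \<le> C * (1 + t ^ 4) * exp ((2 + K\<^sub>x E * \<Delta>t) * K\<^sub>x E * t) * (1 + (norm v0)\<^sup>2 + \<epsilon>\<^sup>2)
                  * min (\<Delta>t / \<epsilon> ^ 3 * (1 + \<epsilon>)) (\<Delta>t + \<epsilon>\<^sup>2))))"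
proof (intro conjI impI)
  show "\<forall>\<epsilon>>0. \<forall>\<Delta>t>0. \<forall>x0 v0. \<exists>!yv. scheme E \<epsilon> \<Delta>t x0 v0 (fst yv) (snd yv)"
    using scheme_unique_solution by blast
qed (use W1_infinity_field[of E] bounded_lipschitz_field.scheme_x_error[of E _ "K\<^sub>x E"]
    W2_infinity_field[of E] bounded_C11_field.scheme_y_error[of E _ "K\<^sub>x E"] in blast)+

end
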